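(* Assume $\Lambda_\varepsilon>0$ for every $\varepsilon>0$, and let $P_\varepsilon$ be an $\varepsilon$-NormCRM$(\rho,\kappa P_0)$ for each $\varepsilon>0$. Then $$P_\varepsilon\stackrel{d}{\rightarrow}P\quad\text{as }\varepsilon\to0,$$ where $P$ is a NormCRM$(\rho,\kappa P_0)$. Moreover, as $\varepsilon\to+\infty$, $P_\varepsilon\stackrel{d}{\rightarrow}\delta_{\tau_0}$, where $\tau_0\sim P_0$.
   Context: Setting. $\Theta\subset\mathbb{R}^m$ is a Borel set, $P_0$ is a probability measure on $\Theta$, $\kappa>0$, and $\rho:(0,+\infty)\to[0,+\infty)$ is measurable with $\int_0^{+\infty}\min\{1,s\}\rho(s)\,ds<\infty$ and $\int_0^{+\infty}\rho(s)\,ds=+\infty$. NormCRM$(\rho,\kappa P_0)$ (homogeneous normalized completely random measure): let $\{J_j\}_{j\ge1}$ be the points of a Poisson process on $(0,+\infty)$ with intensity $\kappa\rho(s)\,ds$, and, independently, let $\tau_1,\tau_2,\dots$ be iid from $P_0$. Then $T=\sum_{j\ge1}J_j\in(0,\infty)$ a.s., and $P=\sum_{j\ge1}\frac{J_j}{T}\delta_{\tau_j}$ is a NormCRM$(\rho,\kappa P_0)$. For $\varepsilon>0$ put $\Lambda_\varepsilon:=\kappa\int_\varepsilon^{+\infty}\rho(s)\,ds$ (which is finite) and, when $\Lambda_\varepsilon>0$, let $\rho_\varepsilon(s):=\frac{\kappa\rho(s)}{\Lambda_\varepsilon}\mathbb{I}_{(\varepsilon,+\infty)}(s)$, a probability density.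 $\varepsilon$-NormCRM$(\rho,\kappa P_0)$: let $N_\varepsilon\sim\text{Poisson}(\Lambda_\varepsilon)$; conditionally on $N_\varepsilon$, let $J_0,J_1,\dots,J_{N_\varepsilon}$ be iid with density $\rho_\varepsilon$ and, independently of these, let $\tau_0,\dots,\tau_{N_\varepsilon}$ be iid from $P_0$. With $T_\varepsilon=\sum_{j=0}^{N_\varepsilon}J_j$, the random probability measure $P_\varepsilon=\sum_{j=0}^{N_\varepsilon}\frac{J_j}{T_\varepsilon}\delta_{\tau_j}$ is called an $\varepsilon$-NormCRM$(\rho,\kappa P_0)$. $\stackrel{d}{\rightarrow}$ denotes convergence in distribution of random probability measures, viewed as random elements of the space of probability measures on $\Theta$ with the topology of weak convergence. *)

theory Defs
  imports "HOL-Probability.Probability"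
begin

definition weak_topology :: "'a::topological_space set \<Rightarrow> 'a measure topology" where
  "weak_topology \<Theta> = topology_generated_by
     {{\<mu> \<in> space (prob_algebra (restrict_space borel \<Theta>)). (\<integral>x. f x \<partial>\<mu>) \<in> U} |
        (f :: 'a \<Rightarrow> real) U. continuous_on \<Theta> f \<and> bounded (f ` \<Theta>) \<and> open U}"

lemma topspace_weak_topology:
  "topspace (weak_topology \<Theta>) = {\<mu>. sets \<mu> = sets (restrict_space borel \<Theta>) \<and> prob_space \<mu>}"
proof -
  have "\<exists>(f :: 'a \<Rightarrow> real) U. space (prob_algebra (restrict_space borel \<Theta>)) =
      {\<mu> \<in> space (prob_algebra (restrict_space borel \<Theta>)). (\<integral>x. f x \<partial>\<mu>) \<in> U} \<and>
      continuous_on \<Theta> f \<and> bounded (f ` \<Theta>) \<and> open U"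
    by (rule exI[of _ "\<lambda>_. 0"], rule exI[of _ UNIV]) (auto simp: image_constant_conv)
  then show ?thesis
    unfolding weak_topology_def topology_generated_by_topspace space_prob_algebra[symmetric]
    by blast
qed

definition borel_algebra :: "'b topology \<Rightarrow> 'b measure" where
  "borel_algebra X = sigma (topspace X) {U. openin X U}"

text \<open>The random elements \<open>Y i\<close> may live on different probability spaces \<open>M i\<close>. Being a random
  element, i.e. measurability with respect to the Borel sets of \<open>X\<close>, is part of the definition.\<close>

definition converges_in_distribution ::
  "'b topology \<Rightarrow> ('i \<Rightarrow> 'w measure) \<Rightarrow> ('i \<Rightarrow> 'w \<Rightarrow> 'b) \<Rightarrow> 'i filter \<Rightarrow>
     'v measure \<Rightarrow> ('v \<Rightarrow> 'b) \<Rightarrow> bool" where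
  "converges_in_distribution X M Y F M' Z \<longleftrightarrow>
     (\<forall>\<^sub>F i in F. prob_space (M i) \<and> Y i \<in> measurable (M i) (borel_algebra X)) \<and>
     prob_space M' \<and> Z \<in> measurable M' (borel_algebra X) \<and>
     (\<forall>g. continuous_map X euclideanreal g \<and> bounded (g ` topspace X) \<longrightarrow>
        ((\<lambda>i. \<integral>\<omega>. g (Y i \<omega>) \<partial>M i) \<longlongrightarrow> (\<integral>\<omega>. g (Z \<omega>) \<partial>M')) F)"

text \<open>The measure \<open>\<Sum>i\<in>I. w i \<cdot> \<delta>\<^bsub>x i\<^esub>\<close> on the measurable space \<open>S\<close>.\<close>

definition discrete_measure ::
  "'a measure \<Rightarrow> 'i set \<Rightarrow> ('i \<Rightarrow> ennreal) \<Rightarrow> ('i \<Rightarrow> 'a) \<Rightarrow> 'a measure" where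
  "discrete_measure S I w x = distr (density (count_space I) w) S x"

lemma emeasure_discrete_measure:
  assumes "x \<in> I \<rightarrow> space S" "B \<in> sets S"
  shows "emeasure (discrete_measure S I w x) B = (\<integral>\<^sup>+i. w i * indicator B (x i) \<partial>count_space I)"
  using assms unfolding discrete_measure_def
  by (subst emeasure_distr) (auto simp: emeasure_density intro!: nn_integral_cong split: split_indicator)

definition poisson_law :: "ennreal \<Rightarrow> ennreal measure" where
  "poisson_law r =
     (if r = 0 then return borel 0
      else if r = \<infinity> then return borel \<infinity>
      else distr (measure_pmf (poisson_pmf (enn2real r))) borel of_nat)"

definition point_count :: "(nat \<Rightarrow> 'w \<Rightarrow> 'b) \<Rightarrow> 'b set \<Rightarrow> 'w \<Rightarrow> ennreal" where
  "point_count X A \<omega> = (\<Sum>j. indicator A (X j \<omega>))"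

text \<open>\<open>X\<close> enumerates (with multiplicity, in an arbitrary measurable order) the points of a Poisson
  process with intensity \<open>\<nu>\<close>. As the enumeration is by all of \<open>nat\<close>, this is only
  meaningful for \<open>\<nu>\<close> of infinite total mass.\<close>

definition poisson_process_points :: "'w measure \<Rightarrow> 'b measure \<Rightarrow> (nat \<Rightarrow> 'w \<Rightarrow> 'b) \<Rightarrow> bool" where
  "poisson_process_points M \<nu> X \<longleftrightarrow>
     (\<forall>j. X j \<in> measurable M \<nu>) \<and>
     (\<forall>A\<in>sets \<nu>. distr M borel (point_count X A) = poisson_law (emeasure \<nu> A)) \<and>
     (\<forall>(A :: nat \<Rightarrow> 'b set) n. (\<forall>i<n. A i \<in> sets \<nu>) \<and> disjoint_family_on A {..<n} \<longrightarrow>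
        prob_space.indep_vars M (\<lambda>_. borel) (\<lambda>i. point_count X (A i)) {..<n})"

definition iid :: "'w measure \<Rightarrow> 'b measure \<Rightarrow> ('i \<Rightarrow> 'w \<Rightarrow> 'b) \<Rightarrow> 'i set \<Rightarrow> bool" where
  "iid M D X I \<longleftrightarrow> prob_space.indep_vars M (\<lambda>_. D) X I \<and> (\<forall>i\<in>I. distr M D (X i) = D)"

text \<open>Independence of the \<open>\<sigma>\<close>-algebras generated by the two families (the library's
  \<open>indep_var\<close> would force \<open>X\<close> and \<open>Y\<close> to take values in the same type).\<close>

definition indep_families ::
  "'w measure \<Rightarrow> 'b measure \<Rightarrow> ('i \<Rightarrow> 'w \<Rightarrow> 'b) \<Rightarrow> 'c measure \<Rightarrow> ('i \<Rightarrow> 'w \<Rightarrow> 'c) \<Rightarrow> 'i set \<Rightarrow> bool" where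
  "indep_families M S X S' Y I \<longleftrightarrow>
     prob_space.indep_set M
       (sets (vimage_algebra (space M) (\<lambda>\<omega>. \<lambda>i\<in>I. X i \<omega>) (PiM I (\<lambda>_. S))))
       (sets (vimage_algebra (space M) (\<lambda>\<omega>. \<lambda>i\<in>I. Y i \<omega>) (PiM I (\<lambda>_. S'))))"

definition jump_intensity :: "(real \<Rightarrow> real) \<Rightarrow> real \<Rightarrow> real measure" where
  "jump_intensity \<rho> \<kappa> = density (restrict_space lborel {0<..}) (\<lambda>s. ennreal (\<kappa> * \<rho> s))"

text \<open>\<open>P\<close> is a random probability measure on the probability space \<open>M\<close>, given by the series almost
  surely (the total jump size is positive and finite only almost surely).\<close>

definition NormCRM ::
  "(real \<Rightarrow> real) \<Rightarrow> real \<Rightarrow> 'a measure \<Rightarrow> 'w measure \<Rightarrow> ('w \<Rightarrow> 'a measure) \<Rightarrow> bool" where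
  "NormCRM \<rho> \<kappa> P0 M P \<longleftrightarrow>
     prob_space M \<and> P \<in> measurable M (prob_algebra P0) \<and>
     (\<exists>(J :: nat \<Rightarrow> 'w \<Rightarrow> real) (\<tau> :: nat \<Rightarrow> 'w \<Rightarrow> 'a).
        poisson_process_points M (jump_intensity \<rho> \<kappa>) J \<and>
        iid M P0 \<tau> UNIV \<and>
        indep_families M (jump_intensity \<rho> \<kappa>) J P0 \<tau> UNIV \<and>
        (AE \<omega> in M. P \<omega> =
           discrete_measure P0 UNIV (\<lambda>j. ennreal (J j \<omega>) / (\<Sum>i. ennreal (J i \<omega>))) (\<lambda>j. \<tau> j \<omega>)))"

definition Lambda_eps :: "(real \<Rightarrow> real) \<Rightarrow> real \<Rightarrow> real \<Rightarrow> real" where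
  "Lambda_eps \<rho> \<kappa> \<epsilon> = \<kappa> * (LINT s:{\<epsilon><..}|lborel. \<rho> s)"

definition rho_eps :: "(real \<Rightarrow> real) \<Rightarrow> real \<Rightarrow> real \<Rightarrow> real \<Rightarrow> real" where
  "rho_eps \<rho> \<kappa> \<epsilon> s = \<kappa> * \<rho> s / Lambda_eps \<rho> \<kappa> \<epsilon> * indicator {\<epsilon><..} s"

text \<open>The conditional law given \<open>N = n\<close> is expressed by the measure conditioned on that event, which
  has positive probability when \<open>Lambda_eps \<rho> \<kappa> \<epsilon> > 0\<close>. Nothing is required of \<open>J j\<close> and \<open>\<tau> j\<close> on
  \<open>{N < j}\<close> except measurability.\<close>

definition eps_NormCRM ::
  "(real \<Rightarrow> real) \<Rightarrow> real \<Rightarrow> 'a measure \<Rightarrow> real \<Rightarrow> 'w measure \<Rightarrow> ('w \<Rightarrow> 'a measure) \<Rightarrow> bool" where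
  "eps_NormCRM \<rho> \<kappa> P0 \<epsilon> M P \<longleftrightarrow>
     prob_space M \<and> P \<in> measurable M (prob_algebra P0) \<and>
     (\<exists>(N :: 'w \<Rightarrow> nat) (J :: nat \<Rightarrow> 'w \<Rightarrow> real) (\<tau> :: nat \<Rightarrow> 'w \<Rightarrow> 'a).
        N \<in> measurable M (count_space UNIV) \<and>
        distr M (count_space UNIV) N = measure_pmf (poisson_pmf (Lambda_eps \<rho> \<kappa> \<epsilon>)) \<and>
        (\<forall>n. let M' = uniform_measure M {\<omega> \<in> space M. N \<omega> = n};
                 D = density lborel (\<lambda>s. ennreal (rho_eps \<rho> \<kappa> \<epsilon> s))
             in iid M' D J {..n} \<and> iid M' P0 \<tau> {..n} \<and> indep_families M' D J P0 \<tau> {..n}) \<and>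
        (AE \<omega> in M. P \<omega> =
           discrete_measure P0 {..N \<omega>} (\<lambda>j. ennreal (J j \<omega> / (\<Sum>i\<le>N \<omega>. J i \<omega>))) (\<lambda>j. \<tau> j \<omega>)))"

end

theory Submission
  imports Defs "HOL-Combinatorics.Multiset_Permutations"
begin

text \<open>
Fix a bounded continuous functional \<open>g\<close> on the probability measures on \<open>\<Theta>\<close>; convergence of
\<open>E g(P\<^sub>\<epsilon>)\<close> is what has to be shown. Integrating out the independent tags \<open>\<tau>\<^sub>j\<close> leaves a function
\<open>avg\<close> of the jumps alone, and because the tags are iid it depends only on the multiset of nonzero
jumps (\<open>avg_eq_if_same_fibre_counts\<close>). Write \<open>a\<^sub>n\<close> (\<open>mean_avg\<close>) for the mean of \<open>avg\<close> over \<open>n\<close> iid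
jumps with density \<open>\<rho>\<^sub>\<epsilon>\<close>, and \<open>p\<^sub>n\<close> for the Poisson weights with mean \<open>\<Lambda>\<^sub>\<epsilon>\<close>.

\<^item> By definition, \<open>E g(P\<^sub>\<epsilon>) = \<Sum>\<^sub>n p\<^sub>n a\<^sub>n\<^sub>+\<^sub>1\<close> (\<open>sums_expectation_eps_NormCRM\<close>).

\<^item> At the normalised sum over the jumps of \<open>P\<close> that exceed \<open>\<epsilon>\<close>, \<open>g\<close> has expectation \<open>\<Sum>\<^sub>n p\<^sub>n a\<^sub>n\<close>
  (\<open>sums_expectation_avg_points\<close>): given their number, the points of a Poisson process above \<open>\<epsilon>\<close> are,
  as a multiset, an iid sample. Since the points come in an arbitrary order and only counts in
  disjoint sets are known to be independent Poisson variables, this is checked after rounding the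
  jumps to finitely many values, where both sides are finite sums over multisets of values
  (\<open>discretized_expectation_of_points\<close>), and the rounding is then removed by continuity of \<open>g\<close>.

\<^item> The two series differ by the additional jump \<open>J\<^sub>0\<close> only, that is, by a shift of the Poisson law by
  one. Since \<open>p\<^sub>n\<^sub>-\<^sub>1 = p\<^sub>n n / \<Lambda>\<^sub>\<epsilon>\<close>, and since a Poisson variable divided by its mean has variance
  \<open>1 / \<Lambda>\<^sub>\<epsilon>\<close>, the difference is \<open>O(1 / sqrt \<Lambda>\<^sub>\<epsilon>)\<close> (\<open>poisson_shift_bound\<close>).

As \<open>\<epsilon> \<rightarrow> 0\<close> we have \<open>\<Lambda>\<^sub>\<epsilon> \<rightarrow> \<infinity>\<close>, so this difference vanishes, while the normalised sum over the jumps
above \<open>\<epsilon>\<close> converges almost surely to \<open>P\<close>. As \<open>\<epsilon> \<rightarrow> \<infinity>\<close> we have \<open>\<Lambda>\<^sub>\<epsilon> \<rightarrow> 0\<close>, so all mass of the series for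
\<open>E g(P\<^sub>\<epsilon>)\<close> moves to its first term \<open>a\<^sub>1\<close>, which is the expectation of \<open>g\<close> at a point mass with
location distributed as \<open>P0\<close>.

Convergence in distribution also asks that the random measures be Borel for the weak topology, while
they are given as measurable for the \<open>\<sigma>\<close>-algebra generated by the evaluations at measurable sets.
The former follows from the latter because every weakly open set is a union of members of one
countable family of sets that are measurable for the evaluations (\<open>openin_weak_topology_measurable\<close>).
\<close>

section \<open>Borel sets and convergence in the weak topology\<close>

lemma borel_measurable_continuous_on_restrict_prob:
  fixes f :: "'a::topological_space \<Rightarrow> real"
  assumes "continuous_on \<Theta> f" "\<mu> \<in> space (prob_algebra (restrict_space borel \<Theta>))"
  shows "f \<in> borel_measurable \<mu>"
  using borel_measurable_continuous_on_restrict[OF assms(1)] assms(2)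
  by (simp add: space_prob_algebra cong: measurable_cong_sets)

lemma integrable_bounded_continuous_prob:
  fixes f :: "'a::topological_space \<Rightarrow> real"
  assumes "continuous_on \<Theta> f" "bounded (f ` \<Theta>)"
    and \<mu>: "\<mu> \<in> space (prob_algebra (restrict_space borel \<Theta>))"
  shows "integrable \<mu> f"
proof -
  obtain C where C: "\<And>x. x \<in> \<Theta> \<Longrightarrow> \<bar>f x\<bar> \<le> C"
    using assms(2) by (auto simp: bounded_iff)
  interpret prob_space \<mu> using \<mu> by (simp add: space_prob_algebra)
  have "space \<mu> = \<Theta>"
    using \<mu> sets_eq_imp_space_eq[of \<mu> "restrict_space borel \<Theta>"]
    by (simp add: space_prob_algebra space_restrict_space)
  then show ?thesis
    using C by (intro integrable_const_bound[of _ C] AE_I2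
        borel_measurable_continuous_on_restrict_prob[OF assms(1) \<mu>]) auto
qed

text \<open>The maximum of the step functions \<open>q \<cdot> 1\<^sub>U\<close> over a list of pairs \<open>(q, U)\<close>, and of \<open>0\<close>. With rational
\<open>q\<close> and \<open>U\<close> from a countable base there are only countably many of these functions.\<close>

fun step_max :: "(real \<times> 'a set) list \<Rightarrow> 'a \<Rightarrow> real" where
  "step_max [] x = 0"
| "step_max ((q, U) # l) x = max (q * indicator U x) (step_max l x)"

lemma step_max_nonneg: "0 \<le> step_max l x"
  by (induction l) auto

lemma step_max_le:
  assumes "\<And>q U. (q, U) \<in> set l \<Longrightarrow> q * indicator U x \<le> c" "0 \<le> c"
  shows "step_max l x \<le> c"
  using assms by (induction l) fastforce+

lemma le_step_max: "(q, U) \<in> set l \<Longrightarrow> q * indicator U x \<le> step_max l x"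
  by (induction l) (auto simp: le_max_iff_disj)

lemma measurable_step_max:
  "(\<And>q U. (q, U) \<in> set l \<Longrightarrow> U \<in> sets M) \<Longrightarrow> step_max l \<in> borel_measurable M"
proof (induction l)
  case Nil
  have "step_max [] = (\<lambda>_::'a. 0)" by auto
  then show ?case by simp
next
  case (Cons p l)
  obtain q U where p: "p = (q, U)" by force
  have [measurable]: "U \<in> sets M" "step_max l \<in> borel_measurable M" using Cons p by auto
  have "step_max (p # l) = (\<lambda>x. max (q * indicator U x) (step_max l x))" using p by auto
  then show ?case by simp
qed

text \<open>A nonnegative continuous function is the pointwise supremum of the countably many \<open>q \<cdot> 1\<^sub>U\<close> below it;
the maxima of the first \<open>n\<close> of them increase to it, and dominated convergence gives convergence of
the integrals.\<close>

lemma step_max_approximates_from_below: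
  fixes f :: "'a::topological_space \<Rightarrow> real"
  assumes B: "topological_basis B" "countable B"
    and f: "continuous_on \<Theta> f" "\<And>x. x \<in> \<Theta> \<Longrightarrow> 0 \<le> f x" "bounded (f ` \<Theta>)"
    and \<mu>: "\<mu> \<in> space (prob_algebra (restrict_space borel \<Theta>))" and e: "0 < e"
  obtains l where "set l \<subseteq> (\<rat> \<inter> {0..}) \<times> B" "\<And>x. x \<in> \<Theta> \<Longrightarrow> step_max l x \<le> f x"
    "(\<integral>x. f x \<partial>\<mu>) - e < (\<integral>x. step_max l x \<partial>\<mu>)"
proof -
  interpret prob_space \<mu> using \<mu> by (simp add: space_prob_algebra)
  have setsmu: "sets \<mu> = sets (restrict_space borel \<Theta>)" using \<mu> by (simp add: space_prob_algebra)
  have space: "space \<mu> = \<Theta>"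
    using sets_eq_imp_space_eq[OF setsmu] by (simp add: space_restrict_space)
  define Q where "Q = {(q, U). (q, U) \<in> (\<rat> \<inter> {0..}) \<times> B \<and> (\<forall>x\<in>\<Theta>. q * indicator U x \<le> f x)}"
  have cQ: "countable Q"
    by (rule countable_subset[of _ "(\<rat> \<inter> {0..}) \<times> B"])
       (auto simp: Q_def intro!: countable_SIGMA countable_Int1 countable_rat B)
  have "B \<noteq> {}"
    using B(1) by (metis UNIV_I empty_iff open_UNIV topological_basisE)
  then obtain U0 where "U0 \<in> B" by auto
  then have "(0, U0) \<in> Q" using f by (auto simp: Q_def)
  then have neQ: "Q \<noteq> {}" by auto
  define l where "l n = map (from_nat_into Q) [0..<n]" for n
  have setl: "set (l n) \<subseteq> Q" for n
    unfolding l_def using from_nat_into[OF neQ] by auto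
  have le: "step_max (l n) x \<le> f x" if "x \<in> \<Theta>" for x n
    by (rule step_max_le) (use setl[of n] that f in \<open>auto simp: Q_def\<close>)
  have lim: "(\<lambda>n. step_max (l n) x) \<longlonglongrightarrow> f x" if x: "x \<in> \<Theta>" for x
  proof (rule increasing_tendsto)
    show "\<forall>\<^sub>F n in sequentially. step_max (l n) x \<le> f x" using le[OF x] by simp
    fix c assume c: "c < f x"
    show "\<forall>\<^sub>F n in sequentially. c < step_max (l n) x"
    proof (cases "c < 0")
      case True
      then show ?thesis using less_le_trans[OF True step_max_nonneg] by (intro always_eventually) auto
    next
      case False
      obtain q where q: "q \<in> \<rat>" "c < q" "q < f x" using Rats_dense_in_real[OF c] by auto
      obtain W where W: "open W" "x \<in> W" "\<And>y. y \<in> \<Theta> \<Longrightarrow> y \<in> W \<Longrightarrow> q < f y"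
        using f(1)[unfolded continuous_on_topological, rule_format, OF x, of "{q<..}"] q by auto
      obtain U where U: "U \<in> B" "x \<in> U" "U \<subseteq> W" using topological_basisE[OF B(1) W(1,2)] by auto
      have "(q, U) \<in> Q" using q U W False f(2) by (force simp: Q_def indicator_def)
      then obtain k where k: "from_nat_into Q k = (q, U)" using from_nat_into_surj[OF cQ] by metis
      show ?thesis
        using eventually_gt_at_top[of k]
      proof eventually_elim
        case (elim n)
        have "(q, U) \<in> set (l n)" using k elim by (force simp: l_def)
        from le_step_max[OF this, of x] show ?case using q U by simp
      qed
    qed
  qed
  obtain C where C: "\<And>x. x \<in> \<Theta> \<Longrightarrow> \<bar>f x\<bar> \<le> C" using f(3) by (auto simp: bounded_iff)
  have meas: "step_max (l n) \<in> borel_measurable \<mu>" for n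
  proof -
    have "step_max (l n) \<in> borel_measurable borel"
      by (rule measurable_step_max)
         (use setl[of n] topological_basis_open[OF B(1)] in \<open>auto simp: Q_def\<close>)
    then show ?thesis
      unfolding measurable_cong_sets[OF setsmu refl] by (rule measurable_restrict_space1)
  qed
  have "(\<lambda>n. \<integral>x. step_max (l n) x \<partial>\<mu>) \<longlonglongrightarrow> (\<integral>x. f x \<partial>\<mu>)"
  proof (rule integral_dominated_convergence[where w="\<lambda>_. C"])
    show "AE x in \<mu>. norm (step_max (l n) x) \<le> C" for n
    proof (intro AE_I2)
      fix x assume "x \<in> space \<mu>"
      then show "norm (step_max (l n) x) \<le> C"
        using le[of x n] C[of x] step_max_nonneg[of "l n" x] by (simp add: space abs_le_iff)
    qed
  qed (use lim meas borel_measurable_continuous_on_restrict_prob[OF f(1) \<mu>] in \<open>auto simp: space\<close>)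
  then have "\<forall>\<^sub>F n in sequentially. (\<integral>x. f x \<partial>\<mu>) - e < (\<integral>x. step_max (l n) x \<partial>\<mu>)"
    using e by (intro order_tendstoD) auto
  then obtain n where "(\<integral>x. f x \<partial>\<mu>) - e < (\<integral>x. step_max (l n) x \<partial>\<mu>)"
    by (auto simp: eventually_sequentially)
  moreover have "set (l n) \<subseteq> (\<rat> \<inter> {0..}) \<times> B" using setl[of n] by (auto simp: Q_def)
  ultimately show thesis using le that by blast
qed

text \<open>The sets \<open>{\<mu>. r < \<integral>h d\<mu>}\<close>, with \<open>r\<close> rational and \<open>h\<close> a \<open>step_max\<close> over a countable base, are countably
many and measurable. If \<open>\<integral>f d\<mu>\<close> lies in an open set, then so does \<open>\<integral>f d\<mu>'\<close> for all \<open>\<mu>'\<close> in the intersection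
of two such sets around \<open>\<mu>\<close>, one bounding the integral of \<open>f\<close> from below and one that of \<open>-f\<close>. So every
weakly open set is a union of finite intersections of these sets.\<close>

lemma openin_weak_topology_measurable:
  fixes \<Theta> :: "'a::second_countable_topology set"
  assumes U: "openin (weak_topology \<Theta>) U"
  shows "U \<in> sets (prob_algebra (restrict_space borel \<Theta>))"
proof -
  let ?S = "prob_algebra (restrict_space borel \<Theta>)"
  obtain B :: "'a set set" where B: "countable B" "topological_basis B" using ex_countable_basis by auto
  define L where "L = lists (((\<rat> \<inter> {0..}) :: real set) \<times> B)"
  define G where "G = (\<lambda>(l, r). {\<mu> \<in> space ?S. r < (\<integral>x. step_max l x \<partial>\<mu>)}) ` (L \<times> (\<rat> :: real set))"
  define G' where "G' = (\<lambda>F. \<Inter>F) ` {F. F \<subseteq> G \<and> finite F \<and> F \<noteq> {}}"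
  have "countable L"
    unfolding L_def by (intro countable_lists countable_SIGMA countable_Int1 countable_rat B)
  then have cG': "countable G'"
    unfolding G'_def G_def
    by (intro countable_image countable_subset[OF _ countable_Collect_finite_subset[of "G"]])
       (auto simp: G_def intro!: countable_image countable_SIGMA countable_rat)
  have meas: "step_max l \<in> borel_measurable (restrict_space borel \<Theta>)" if "l \<in> L" for l
    by (intro measurable_restrict_space1 measurable_step_max)
       (use that topological_basis_open[OF B(2)] in \<open>auto simp: L_def in_lists_conv_set\<close>)
  have GS: "A \<in> sets ?S" if A: "A \<in> G" for A
  proof -
    obtain l r where l: "l \<in> L" and A: "A = {\<mu> \<in> space ?S. r < (\<integral>x. step_max l x \<partial>\<mu>)}"
      using A by (auto simp: G_def)
    have [measurable]: "(\<lambda>\<mu>. \<integral>x. step_max l x \<partial>\<mu>) \<in> borel_measurable ?S"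
      unfolding prob_algebra_def
      by (intro measurable_restrict_space1 integral_measurable_subprob_algebra meas l)
    show ?thesis unfolding A by measurable
  qed
  have G'S: "A \<in> sets ?S" if "A \<in> G'" for A
    proof -
    obtain F where "F \<subseteq> G" "finite F" "F \<noteq> {}" "A = \<Inter>F" using \<open>A \<in> G'\<close> by (auto simp: G'_def)
    then show ?thesis using GS sets.finite_INT[of F "\<lambda>x. x" ?S] by auto
  qed
  have G_G': "A \<in> G'" if "A \<in> G" for A
    using that unfolding G'_def by (intro image_eqI[of _ _ "{A}"]) auto
  have G'_Int: "A \<inter> A' \<in> G'" if "A \<in> G'" "A' \<in> G'" for A A'
  proof -
    obtain F F' where "F \<subseteq> G \<and> finite F \<and> F \<noteq> {} \<and> A = \<Inter>F" "F' \<subseteq> G \<and> finite F' \<and> F' \<noteq> {} \<and> A' = \<Inter>F'"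
      using \<open>A \<in> G'\<close> \<open>A' \<in> G'\<close> by (auto simp: G'_def)
    then show ?thesis unfolding G'_def by (intro image_eqI[of _ _ "F \<union> F'"]) auto
  qed
  have lower: "\<exists>A\<in>G'. \<mu> \<in> A \<and> (\<forall>\<mu>'\<in>A. (\<integral>x. f x \<partial>\<mu>) - e < (\<integral>x. f x \<partial>\<mu>'))"
    if f: "continuous_on \<Theta> f" "bounded (f ` \<Theta>)" and \<mu>: "\<mu> \<in> space ?S" and e: "0 < e"
    for f :: "'a \<Rightarrow> real" and \<mu> e
  proof -
    obtain C where C: "\<And>x. x \<in> \<Theta> \<Longrightarrow> \<bar>f x\<bar> \<le> C" using f(2) by (auto simp: bounded_iff)
    \<comment> \<open>Shift \<open>f\<close> to a nonnegative function, as \<open>step_max\<close> functions are nonnegative.\<close>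
    have bdd: "bounded ((\<lambda>x. f x + C) ` \<Theta>)"
      using f(2) bounded_plus_comp[of f \<Theta> "\<lambda>_. C"] by (auto simp: image_constant_conv)
    have cont: "continuous_on \<Theta> (\<lambda>x. f x + C)" using f by (intro continuous_intros)
    have nonneg: "0 \<le> f x + C" if "x \<in> \<Theta>" for x using C[OF that] by (simp add: abs_le_iff)
    obtain l where l: "set l \<subseteq> (\<rat> \<inter> {0..}) \<times> B" "\<And>x. x \<in> \<Theta> \<Longrightarrow> step_max l x \<le> f x + C"
      "(\<integral>x. f x + C \<partial>\<mu>) - e < (\<integral>x. step_max l x \<partial>\<mu>)"
      using step_max_approximates_from_below[OF B(2,1) cont nonneg bdd \<mu> e] by blast
    then have lL: "l \<in> L" by (auto simp: L_def in_lists_conv_set)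
    have shift: "(\<integral>x. f x + C \<partial>\<mu>') = (\<integral>x. f x \<partial>\<mu>') + C" if \<mu>': "\<mu>' \<in> space ?S" for \<mu>'
    proof -
      interpret prob_space \<mu>' using \<mu>' by (simp add: space_prob_algebra)
      show ?thesis using integrable_bounded_continuous_prob[OF f \<mu>'] by (simp add: prob_space)
    qed
    obtain r where r: "r \<in> \<rat>" "(\<integral>x. f x \<partial>\<mu>) + C - e < r" "r < (\<integral>x. step_max l x \<partial>\<mu>)"
      using Rats_dense_in_real[OF l(3)] shift[OF \<mu>] by auto
    have "(\<integral>x. f x \<partial>\<mu>) - e < (\<integral>x. f x \<partial>\<mu>')"
      if \<mu>': "\<mu>' \<in> space ?S" "r < (\<integral>x. step_max l x \<partial>\<mu>')" for \<mu>'
    proof -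
      interpret prob_space \<mu>' using \<mu>' by (simp add: space_prob_algebra)
      have sets: "sets \<mu>' = sets (restrict_space borel \<Theta>)" using \<mu>' by (simp add: space_prob_algebra)
      have space: "space \<mu>' = \<Theta>"
        using sets_eq_imp_space_eq[OF sets] by (simp add: space_restrict_space)
      have "(\<integral>x. step_max l x \<partial>\<mu>') \<le> (\<integral>x. f x + C \<partial>\<mu>')"
      proof (rule integral_mono')
        show "integrable \<mu>' (\<lambda>x. f x + C)" by (rule integrable_bounded_continuous_prob[OF cont bdd \<mu>'(1)])
        show "step_max l x \<le> f x + C" if "x \<in> space \<mu>'" for x using l(2)[of x] that space by blast
        show "0 \<le> f x + C" if "x \<in> space \<mu>'" for x using C[of x] that space by (auto simp: abs_le_iff)
      qed
      then show ?thesis using \<mu>'(2) r shift[OF \<mu>'(1)] by linarith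
    qed
    moreover have "{\<mu> \<in> space ?S. r < (\<integral>x. step_max l x \<partial>\<mu>)} \<in> G'"
      using lL r by (intro G_G') (auto simp: G_def)
    ultimately show ?thesis using \<mu> r by (intro bexI[of _ "{\<mu> \<in> space ?S. r < (\<integral>x. step_max l x \<partial>\<mu>)}"]) auto
  qed
  have "generate_topology_on {{\<mu> \<in> space ?S. (\<integral>x. f x \<partial>\<mu>) \<in> U} |
        (f :: 'a \<Rightarrow> real) U. continuous_on \<Theta> f \<and> bounded (f ` \<Theta>) \<and> open U} U"
    using U unfolding weak_topology_def openin_topology_generated_by_iff .
  then have *: "\<forall>\<mu>\<in>U. \<exists>A\<in>G'. \<mu> \<in> A \<and> A \<subseteq> U"
  proof induction
    case (Int a b)
    show ?case
    proof
      fix \<mu> assume "\<mu> \<in> a \<inter> b"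
      then obtain A A' where "A \<in> G'" "\<mu> \<in> A" "A \<subseteq> a" "A' \<in> G'" "\<mu> \<in> A'" "A' \<subseteq> b"
        using Int.IH by blast
      then show "\<exists>A\<in>G'. \<mu> \<in> A \<and> A \<subseteq> a \<inter> b"
        using G'_Int by (intro bexI[of _ "A \<inter> A'"]) auto
    qed
  next
    case (UN K)
    show ?case
    proof
      fix \<mu> assume "\<mu> \<in> \<Union>K"
      then obtain k where "k \<in> K" "\<mu> \<in> k" by auto
      then obtain A where "A \<in> G'" "\<mu> \<in> A" "A \<subseteq> k" using UN.IH[of k] by auto
      then show "\<exists>A\<in>G'. \<mu> \<in> A \<and> A \<subseteq> \<Union>K" using \<open>k \<in> K\<close> by (intro bexI[of _ A]) auto
    qed
  next
    case (Basis s)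
    then obtain f :: "'a \<Rightarrow> real" and V where s: "s = {\<mu> \<in> space ?S. (\<integral>x. f x \<partial>\<mu>) \<in> V}"
      and f: "continuous_on \<Theta> f" "bounded (f ` \<Theta>)" and V: "open V" by blast
    show ?case
    proof
      fix \<mu> assume "\<mu> \<in> s"
      then have \<mu>: "\<mu> \<in> space ?S" "(\<integral>x. f x \<partial>\<mu>) \<in> V" by (auto simp: s)
      obtain e where e: "0 < e" "ball (\<integral>x. f x \<partial>\<mu>) e \<subseteq> V" using V \<mu>(2) open_contains_ball by blast
      have f': "continuous_on \<Theta> (\<lambda>x. - f x)" "bounded ((\<lambda>x. - f x) ` \<Theta>)"
        using f by (auto intro: continuous_intros simp: bounded_iff)
      obtain A A' where A: "A \<in> G'" "\<mu> \<in> A" "\<forall>\<mu>'\<in>A. (\<integral>x. f x \<partial>\<mu>) - e < (\<integral>x. f x \<partial>\<mu>')"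
        "A' \<in> G'" "\<mu> \<in> A'" "\<forall>\<mu>'\<in>A'. (\<integral>x. - f x \<partial>\<mu>) - e < (\<integral>x. - f x \<partial>\<mu>')"
        using lower[OF f \<mu>(1) e(1)] lower[OF f' \<mu>(1) e(1)] by blast
      have "A \<inter> A' \<subseteq> s"
      proof
        fix \<mu>' assume \<mu>': "\<mu>' \<in> A \<inter> A'"
        then have "(\<integral>x. f x \<partial>\<mu>') \<in> ball (\<integral>x. f x \<partial>\<mu>) e"
          using bspec[OF A(3), of \<mu>'] bspec[OF A(6), of \<mu>'] by (auto simp: dist_real_def abs_less_iff)
        moreover have "\<mu>' \<in> space ?S" using \<mu>' sets.sets_into_space[OF G'S[OF A(1)]] by auto
        ultimately show "\<mu>' \<in> s" using e(2) by (auto simp: s)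
      qed
      then show "\<exists>A\<in>G'. \<mu> \<in> A \<and> A \<subseteq> s" using A G'_Int by (intro bexI[of _ "A \<inter> A'"]) auto
    qed
  qed auto
  have "U = \<Union>{A \<in> G'. A \<subseteq> U}" using * by blast
  also have "\<dots> \<in> sets ?S"
    using cG' G'S by (intro sets.countable_Union) (auto intro: countable_subset)
  finally show ?thesis .
qed

lemma measurable_prob_algebra_weak_topology:
  fixes \<Theta> :: "'a::second_countable_topology set"
  assumes Y: "Y \<in> measurable M (prob_algebra K)" and K: "sets K = sets (restrict_space borel \<Theta>)"
  shows "Y \<in> measurable M (borel_algebra (weak_topology \<Theta>))"
  unfolding borel_algebra_def
proof (rule measurable_sigma_sets)
  have sp: "space (prob_algebra K) = topspace (weak_topology \<Theta>)"
    by (simp add: space_prob_algebra topspace_weak_topology K)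
  have KK: "sets (prob_algebra K) = sets (prob_algebra (restrict_space borel \<Theta>))"
    unfolding prob_algebra_def using subprob_algebra_cong[OF K] by simp
  show "sets (sigma (topspace (weak_topology \<Theta>)) {U. openin (weak_topology \<Theta>) U}) =
     sigma_sets (topspace (weak_topology \<Theta>)) {U. openin (weak_topology \<Theta>) U}"
    by (rule sets_measure_of) (auto dest: openin_subset)
  show "{U. openin (weak_topology \<Theta>) U} \<subseteq> Pow (topspace (weak_topology \<Theta>))"
    by (auto dest: openin_subset)
  show "Y \<in> space M \<rightarrow> topspace (weak_topology \<Theta>)"
    using measurable_space[OF Y] sp by auto
  show "Y -` U \<inter> space M \<in> sets M" if "U \<in> {U. openin (weak_topology \<Theta>) U}" for U
    using openin_weak_topology_measurable[of \<Theta> U] that KK by (intro measurable_sets[OF Y]) auto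
qed

lemma continuous_weak_topology_measurable:
  fixes \<Theta> :: "'a::second_countable_topology set"
  assumes g: "continuous_map (weak_topology \<Theta>) euclideanreal g"
    and K: "sets K = sets (restrict_space borel \<Theta>)"
  shows "g \<in> borel_measurable (prob_algebra K)"
proof (rule borel_measurableI)
  fix V :: "real set" assume "open V"
  have sp: "space (prob_algebra K) = topspace (weak_topology \<Theta>)"
    by (simp add: space_prob_algebra topspace_weak_topology K)
  have KK: "sets (prob_algebra K) = sets (prob_algebra (restrict_space borel \<Theta>))"
    unfolding prob_algebra_def using subprob_algebra_cong[OF K] by simp
  have "openin (weak_topology \<Theta>) {x \<in> topspace (weak_topology \<Theta>). g x \<in> V}"
    using openin_continuous_map_preimage[OF g, of V] \<open>open V\<close> by simp
  from openin_weak_topology_measurable[OF this]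
  show "g -` V \<inter> space (prob_algebra K) \<in> sets (prob_algebra K)"
    unfolding sp KK by (simp add: vimage_def Int_def conj_commute)
qed

text \<open>A neighbourhood of the limit contains a finite intersection of subbasic ones, so convergence of the
integrals of bounded continuous functions suffices.\<close>

lemma limitin_weak_topologyI:
  fixes \<mu> :: "'i \<Rightarrow> 'a::topological_space measure"
  assumes "\<And>i. \<mu> i \<in> space (prob_algebra (restrict_space borel \<Theta>))"
    and "\<nu> \<in> space (prob_algebra (restrict_space borel \<Theta>))"
    and conv: "\<And>f :: 'a \<Rightarrow> real. continuous_on \<Theta> f \<Longrightarrow> bounded (f ` \<Theta>) \<Longrightarrow>
      ((\<lambda>i. \<integral>x. f x \<partial>\<mu> i) \<longlongrightarrow> (\<integral>x. f x \<partial>\<nu>)) F"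
  shows "limitin (weak_topology \<Theta>) \<mu> \<nu> F"
  unfolding limitin_def
proof (intro conjI allI impI)
  show "\<nu> \<in> topspace (weak_topology \<Theta>)"
    using assms by (simp add: topspace_weak_topology space_prob_algebra)
  fix U assume U: "openin (weak_topology \<Theta>) U \<and> \<nu> \<in> U"
  then have "generate_topology_on {{\<mu> \<in> space (prob_algebra (restrict_space borel \<Theta>)). (\<integral>x. f x \<partial>\<mu>) \<in> U} |
        (f :: 'a \<Rightarrow> real) U. continuous_on \<Theta> f \<and> bounded (f ` \<Theta>) \<and> open U} U"
    unfolding weak_topology_def openin_topology_generated_by_iff by simp
  then have "\<nu> \<in> U \<longrightarrow> (\<forall>\<^sub>F i in F. \<mu> i \<in> U)"
  proof induction
    case (Int a b)
    then show ?case by (auto intro: eventually_conj)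
  next
    case (UN K)
    then show ?case by (blast intro: eventually_mono)
  next
    case (Basis s)
    then obtain f :: "'a \<Rightarrow> real" and V
      where s: "s = {\<mu> \<in> space (prob_algebra (restrict_space borel \<Theta>)). (\<integral>x. f x \<partial>\<mu>) \<in> V}"
      and f: "continuous_on \<Theta> f" "bounded (f ` \<Theta>)" and V: "open V" by blast
    show ?case using topological_tendstoD[OF conv[OF f] V] assms(1) by (auto simp: s)
  qed auto
  then show "\<forall>\<^sub>F i in F. \<mu> i \<in> U" using U by auto
qed

section \<open>Normalised weighted sums of point masses\<close>

text \<open>Weights of total mass \<open>0\<close> or \<open>\<infinity>\<close> cannot be normalised; the point mass at the first tag is used for
them, so that the value is always a probability measure, jointly measurable in weights and tags.
A finite sum is the case of weights that vanish from some index on.\<close>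

definition normalized_sum :: "'a measure \<Rightarrow> (nat \<Rightarrow> real) \<Rightarrow> (nat \<Rightarrow> 'a) \<Rightarrow> 'a measure" where
  "normalized_sum S x t =
     (if 0 < (\<Sum>j. ennreal (x j)) \<and> (\<Sum>j. ennreal (x j)) < \<infinity>
      then discrete_measure S UNIV (\<lambda>j. ennreal (x j) / (\<Sum>i. ennreal (x i))) t
      else return S (t 0))"

lemma sets_normalized_sum [simp, measurable_cong]: "sets (normalized_sum S x t) = sets S"
  by (simp add: normalized_sum_def discrete_measure_def)

lemma emeasure_normalized_sum:
  assumes "\<And>j. t j \<in> space S" "A \<in> sets S"
  shows "emeasure (normalized_sum S x t) A =
    (if 0 < (\<Sum>j. ennreal (x j)) \<and> (\<Sum>j. ennreal (x j)) < \<infinity>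
      then (\<Sum>j. ennreal (x j) / (\<Sum>i. ennreal (x i)) * indicator A (t j))
      else indicator A (t 0))"
  using assms unfolding normalized_sum_def
  by (auto simp: emeasure_discrete_measure nn_integral_count_space_nat)

lemma prob_space_normalized_sum:
  assumes t: "\<And>j. t j \<in> space S"
  shows "prob_space (normalized_sum S x t)"
proof
  have "space (normalized_sum S x t) = space S" by (rule sets_eq_imp_space_eq) simp
  moreover have "(\<Sum>j. ennreal (x j) / (\<Sum>i. ennreal (x i)) * indicator (space S) (t j)) = 1"
    if "0 < (\<Sum>j. ennreal (x j))" "(\<Sum>j. ennreal (x j)) < \<infinity>"
    using t that by (simp add: divide_ennreal_def ennreal_suminf_multc ennreal_divide_self[unfolded divide_ennreal_def])
  ultimately show "emeasure (normalized_sum S x t) (space (normalized_sum S x t)) = 1"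
    using t by (auto simp: emeasure_normalized_sum)
qed

lemma normalized_sum_in_space:
  "(\<And>j. t j \<in> space S) \<Longrightarrow> normalized_sum S x t \<in> space (prob_algebra S)"
  by (simp add: space_prob_algebra prob_space_normalized_sum)

lemma measurable_normalized_sum [measurable]:
  "(\<lambda>(x, t). normalized_sum S x t) \<in>
     (\<Pi>\<^sub>M (j::nat)\<in>UNIV. borel) \<Otimes>\<^sub>M (\<Pi>\<^sub>M j\<in>UNIV. S) \<rightarrow>\<^sub>M prob_algebra S" (is "?f \<in> ?M \<rightarrow>\<^sub>M _")
proof (rule measurable_prob_algebra_generated[of _ "space S" "sets S"])
  show "sets S = sigma_sets (space S) (sets S)" by (rule sets.sigma_sets_eq[symmetric])
  show "Int_stable (sets S)" by (simp add: Int_stable_def)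
  show "sets S \<subseteq> Pow (space S)" by (rule sets.space_closed)
  show "prob_space (?f a)" if "a \<in> space ?M" for a
    using that by (auto simp: space_pair_measure space_PiM PiE_iff intro!: prob_space_normalized_sum)
  show "sets (?f a) = sets S" for a by (auto split: prod.split)
  fix A assume A[measurable]: "A \<in> sets S"
  have "(\<lambda>a. emeasure (?f a) A) \<in> borel_measurable ?M \<longleftrightarrow>
    (\<lambda>a. if 0 < (\<Sum>j. ennreal (fst a j)) \<and> (\<Sum>j. ennreal (fst a j)) < \<infinity>
      then (\<Sum>j. ennreal (fst a j) / (\<Sum>i. ennreal (fst a i)) * indicator A (snd a j))
      else indicator A (snd a 0)) \<in> borel_measurable ?M"
    by (rule measurable_cong)
       (subst case_prod_beta, subst emeasure_normalized_sum, auto simp: space_pair_measure space_PiM PiE_iff)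
  then show "(\<lambda>a. emeasure (?f a) A) \<in> borel_measurable ?M" by simp
qed

lemma integral_normalized_sum:
  fixes f :: "'a \<Rightarrow> real"
  assumes t: "\<And>j. t j \<in> space S" and f: "f \<in> borel_measurable S"
    and x: "\<And>j. 0 \<le> x j" "summable x" "0 < suminf x"
    and C: "\<And>y. y \<in> space S \<Longrightarrow> \<bar>f y\<bar> \<le> C"
  shows "(\<integral>y. f y \<partial>normalized_sum S x t) = (\<Sum>j. x j * f (t j)) / suminf x"
proof -
  have T: "(\<Sum>j. ennreal (x j)) = ennreal (suminf x)"
    using x by (intro suminf_ennreal2) auto
  have "normalized_sum S x t = discrete_measure S UNIV (\<lambda>j. ennreal (x j / suminf x)) t"
    using x unfolding normalized_sum_def T by (simp add: divide_ennreal ennreal_less_top)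
  then have "(\<integral>y. f y \<partial>normalized_sum S x t) = (\<integral>j. x j / suminf x * f (t j) \<partial>count_space UNIV)"
    unfolding discrete_measure_def using t x f
    by (simp add: integral_distr integral_density)
  also have "\<dots> = (\<Sum>j. x j / suminf x * f (t j))"
  proof (rule integral_count_space_nat)
    have "summable (\<lambda>j. \<bar>x j / suminf x * f (t j)\<bar>)"
    proof (rule summable_comparison_test')
      show "summable (\<lambda>j. x j * (C / suminf x))" by (rule summable_mult2) fact
      show "norm \<bar>x j / suminf x * f (t j)\<bar> \<le> x j * (C / suminf x)" for j
        using C[OF t[of j]] x(1)[of j] x(3)
        by (simp add: abs_mult divide_right_mono mult_left_mono)
    qed
    then show "integrable (count_space UNIV) (\<lambda>j. x j / suminf x * f (t j))"
      by (simp add: integrable_count_space_nat_iff)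
  qed
  also have "\<dots> = (\<Sum>j. x j * f (t j)) / suminf x"
  proof -
    have "summable (\<lambda>j. x j * f (t j))"
    proof (rule summable_comparison_test')
      show "summable (\<lambda>j. x j * C)" by (rule summable_mult2) fact
      show "norm (x j * f (t j)) \<le> x j * C" for j
        using C[OF t[of j]] x(1)[of j] by (simp add: abs_mult mult_left_mono)
    qed
    then show ?thesis by (simp add: suminf_divide[symmetric])
  qed
  finally show ?thesis .
qed

lemma normalized_sum_eq_discrete_measure:
  assumes I: "finite I" "\<And>j. j \<notin> I \<Longrightarrow> x j = 0" "\<And>j. 0 \<le> x j" "0 < (\<Sum>j\<in>I. x j)"
    and t: "\<And>j. t j \<in> space S"
  shows "normalized_sum S x t = discrete_measure S I (\<lambda>j. ennreal (x j / (\<Sum>i\<in>I. x i))) t"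
proof (rule measure_eqI)
  show "sets (normalized_sum S x t) = sets (discrete_measure S I (\<lambda>j. ennreal (x j / (\<Sum>i\<in>I. x i))) t)"
    by (simp add: discrete_measure_def)
  fix A assume "A \<in> sets (normalized_sum S x t)"
  then have A: "A \<in> sets S" by simp
  have T: "(\<Sum>j. ennreal (x j)) = ennreal (\<Sum>i\<in>I. x i)"
    using I by (subst suminf_finite[of I]) (auto simp: sum_ennreal)
  have "emeasure (normalized_sum S x t) A = (\<Sum>j. ennreal (x j / (\<Sum>i\<in>I. x i)) * indicator A (t j))"
    using I t A by (subst emeasure_normalized_sum) (auto simp: T divide_ennreal ennreal_less_top)
  also have "\<dots> = (\<Sum>j\<in>I. ennreal (x j / (\<Sum>i\<in>I. x i)) * indicator A (t j))"
    using I by (intro suminf_finite) auto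
  also have "\<dots> = emeasure (discrete_measure S I (\<lambda>j. ennreal (x j / (\<Sum>i\<in>I. x i))) t) A"
    using I t A by (subst emeasure_discrete_measure) (auto simp: nn_integral_count_space_finite)
  finally show "emeasure (normalized_sum S x t) A =
    emeasure (discrete_measure S I (\<lambda>j. ennreal (x j / (\<Sum>i\<in>I. x i))) t) A" .
qed

lemma normalized_sum_permute:
  assumes \<pi>: "bij \<pi>" and t: "\<And>j. t j \<in> space S" and pos: "0 < (\<Sum>j. ennreal (x j))" "(\<Sum>j. ennreal (x j)) < \<infinity>"
  shows "normalized_sum S (\<lambda>j. x (\<pi> j)) (\<lambda>j. t (\<pi> j)) = normalized_sum S x t"
proof (rule measure_eqI)
  have perm: "(\<Sum>j. h (\<pi> j)) = (\<Sum>j. h j)" for h :: "nat \<Rightarrow> ennreal"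
    using nn_integral_bij_count_space[OF \<pi>, of h] by (simp add: nn_integral_count_space_nat)
  fix A assume "A \<in> sets (normalized_sum S (\<lambda>j. x (\<pi> j)) (\<lambda>j. t (\<pi> j)))"
  then have A: "A \<in> sets S" by simp
  show "emeasure (normalized_sum S (\<lambda>j. x (\<pi> j)) (\<lambda>j. t (\<pi> j))) A = emeasure (normalized_sum S x t) A"
    using perm[of "\<lambda>j. ennreal (x j)"] pos t A
      perm[of "\<lambda>j. ennreal (x j) / (\<Sum>i. ennreal (x i)) * indicator A (t j)"]
    by (simp add: emeasure_normalized_sum)
qed simp

text \<open>Numerator and denominator of \<open>\<integral>f\<close> are series that pass to the limit by Tannery's theorem, since the
weights have a common summable bound.\<close>

lemma limitin_normalized_sum:
  fixes \<Theta> :: "'a::topological_space set"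
  assumes S: "sets S = sets (restrict_space borel \<Theta>)" and t: "\<And>j. t j \<in> space S"
    and x: "\<And>k j. 0 \<le> x k j" "\<And>k j. x k j \<le> y j" "summable y"
    and lim: "\<And>j. (\<lambda>k. x k j) \<longlonglongrightarrow> z j" and z: "0 < suminf z"
  shows "limitin (weak_topology \<Theta>) (\<lambda>k. normalized_sum S (x k) t) (normalized_sum S z t) sequentially"
proof (rule limitin_weak_topologyI)
  have PS: "space (prob_algebra S) = space (prob_algebra (restrict_space borel \<Theta>))"
    by (simp add: space_prob_algebra S)
  show "normalized_sum S (x k) t \<in> space (prob_algebra (restrict_space borel \<Theta>))" for k
    unfolding PS[symmetric] by (rule normalized_sum_in_space[OF t])
  show "normalized_sum S z t \<in> space (prob_algebra (restrict_space borel \<Theta>))"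
    unfolding PS[symmetric] by (rule normalized_sum_in_space[OF t])
  fix f :: "'a \<Rightarrow> real" assume f: "continuous_on \<Theta> f" "bounded (f ` \<Theta>)"
  have sp: "space S = \<Theta>" using sets_eq_imp_space_eq[OF S] by (simp add: space_restrict_space)
  have fm: "f \<in> borel_measurable S"
    unfolding measurable_cong_sets[OF S refl] by (rule borel_measurable_continuous_on_restrict[OF f(1)])
  obtain C where C: "\<And>x. x \<in> \<Theta> \<Longrightarrow> \<bar>f x\<bar> \<le> C" using f(2) by (auto simp: bounded_iff)
  have z0: "0 \<le> z j" "z j \<le> y j" for j
    using lim[of j] x by (auto intro: LIMSEQ_le_const LIMSEQ_le_const2)
  have sx: "summable (x k)" for k
    by (rule summable_comparison_test'[OF x(3)]) (use x in auto)
  have sz: "summable z"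
    by (rule summable_comparison_test'[OF x(3)]) (use z0 in auto)
  have conv: "(\<lambda>k. \<Sum>j. x k j * h j) \<longlonglongrightarrow> (\<Sum>j. z j * h j)" if h: "\<And>j. \<bar>h j\<bar> \<le> D" for h D
  proof -
    have bd: "\<forall>\<^sub>F (j, k) in at_top \<times>\<^sub>F sequentially. norm (x k j * h j) \<le> y j * D"
      using x h by (intro always_eventually) (auto simp: abs_mult intro!: mult_mono order_trans[OF x(1) x(2)])
    have lim': "(\<lambda>k. x k j * h j) \<longlonglongrightarrow> z j * h j" for j
      by (intro tendsto_mult lim tendsto_const)
    show ?thesis
      using tannerys_theorem[OF lim' bd summable_mult2[OF x(3)]] by simp
  qed
  have T: "(\<lambda>k. suminf (x k)) \<longlonglongrightarrow> suminf z" using conv[of "\<lambda>_. 1" 1] by simp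
  have ratio: "(\<lambda>k. (\<Sum>j. x k j * f (t j)) / suminf (x k)) \<longlonglongrightarrow> (\<Sum>j. z j * f (t j)) / suminf z"
    by (intro tendsto_divide conv[of _ C] T) (use z C t in \<open>auto simp: sp\<close>)
  have eq: "\<forall>\<^sub>F k in sequentially. (\<Sum>j. x k j * f (t j)) / suminf (x k) = (\<integral>y. f y \<partial>normalized_sum S (x k) t)"
    using order_tendstoD(1)[OF T z]
    by eventually_elim (rule integral_normalized_sum[symmetric, OF t fm x(1) sx _ C], auto simp: sp)
  have eqz: "(\<integral>y. f y \<partial>normalized_sum S z t) = (\<Sum>j. z j * f (t j)) / suminf z"
    by (rule integral_normalized_sum[OF t fm z0(1) sz z C]) (auto simp: sp)
  show "(\<lambda>k. \<integral>y. f y \<partial>normalized_sum S (x k) t) \<longlonglongrightarrow> (\<integral>y. f y \<partial>normalized_sum S z t)"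
    unfolding eqz by (rule Lim_transform_eventually[OF ratio eq])
qed

section \<open>Averaging a test functional over the tags\<close>

lemma iid_measurable:
  assumes "prob_space M" "iid M D X I" "i \<in> I"
  shows "X i \<in> measurable M D"
proof -
  interpret prob_space M by fact
  show ?thesis using assms(2,3) by (auto simp: iid_def indep_vars_def)
qed

lemma distr_restrict_iid:
  assumes M: "prob_space M" and X: "iid M D X I" and I: "I \<noteq> {}"
  shows "distr M (\<Pi>\<^sub>M i\<in>I. D) (\<lambda>\<omega>. \<lambda>i\<in>I. X i \<omega>) = (\<Pi>\<^sub>M i\<in>I. D)"
proof -
  interpret prob_space M by fact
  have "random_variable D (X i)" if "i \<in> I" for i
    using X that by (auto simp: iid_def indep_vars_def)
  then have "distr M (\<Pi>\<^sub>M i\<in>I. D) (\<lambda>\<omega>. \<lambda>i\<in>I. X i \<omega>) = (\<Pi>\<^sub>M i\<in>I. distr M D (X i))"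
    using X I by (subst indep_vars_iff_distr_eq_PiM'[symmetric]) (auto simp: iid_def)
  also have "\<dots> = (\<Pi>\<^sub>M i\<in>I. D)" using X by (intro PiM_cong) (auto simp: iid_def)
  finally show ?thesis .
qed

text \<open>Independence of the two generated \<open>\<sigma>\<close>-algebras makes the joint law a product measure; this is the form in
which Fubini's theorem applies to jumps and tags.\<close>

lemma distr_pair_indep_families:
  assumes M: "prob_space M" and ind: "indep_families M S X S' Y I"
    and X: "\<And>i. i \<in> I \<Longrightarrow> X i \<in> measurable M S" and Y: "\<And>i. i \<in> I \<Longrightarrow> Y i \<in> measurable M S'"
  shows "distr M ((\<Pi>\<^sub>M i\<in>I. S) \<Otimes>\<^sub>M (\<Pi>\<^sub>M i\<in>I. S')) (\<lambda>\<omega>. (\<lambda>i\<in>I. X i \<omega>, \<lambda>i\<in>I. Y i \<omega>)) =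
    distr M (\<Pi>\<^sub>M i\<in>I. S) (\<lambda>\<omega>. \<lambda>i\<in>I. X i \<omega>) \<Otimes>\<^sub>M distr M (\<Pi>\<^sub>M i\<in>I. S') (\<lambda>\<omega>. \<lambda>i\<in>I. Y i \<omega>)"
    (is "distr M (?S \<Otimes>\<^sub>M ?S') _ = distr M _ ?X \<Otimes>\<^sub>M distr M _ ?Y")
proof -
  interpret prob_space M by fact
  have mX[measurable]: "?X \<in> measurable M ?S" using X by (intro measurable_restrict)
  have mY[measurable]: "?Y \<in> measurable M ?S'" using Y by (intro measurable_restrict)
  interpret X: prob_space "distr M ?S ?X" by (rule prob_space_distr) measurable
  interpret Y: prob_space "distr M ?S' ?Y" by (rule prob_space_distr) measurable
  show ?thesis
  proof (rule pair_measure_eqI[symmetric])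
    fix A B assume "A \<in> sets (distr M ?S ?X)" "B \<in> sets (distr M ?S' ?Y)"
    then have [measurable]: "A \<in> sets ?S" "B \<in> sets ?S'" by auto
    have "prob ((?X -` A \<inter> space M) \<inter> (?Y -` B \<inter> space M)) = prob (?X -` A \<inter> space M) * prob (?Y -` B \<inter> space M)"
      using measurable_space[OF mX] measurable_space[OF mY]
      by (intro indep_setD[OF ind[unfolded indep_families_def]]) (auto simp: sets_vimage_algebra2)
    moreover have "(\<lambda>\<omega>. (?X \<omega>, ?Y \<omega>)) -` (A \<times> B) \<inter> space M = (?X -` A \<inter> space M) \<inter> (?Y -` B \<inter> space M)"
      by auto
    ultimately show "emeasure (distr M ?S ?X) A * emeasure (distr M ?S' ?Y) B =
      emeasure (distr M (?S \<Otimes>\<^sub>M ?S') (\<lambda>\<omega>. (?X \<omega>, ?Y \<omega>))) (A \<times> B)"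
      by (simp add: emeasure_distr emeasure_eq_measure ennreal_mult'')
  qed (unfold_locales, simp cong: sets_pair_measure_cong)
qed

text \<open>Two sequences that are eventually constant \<open>z\<close> and take every other value equally often are permutations of each
other: match the fibres one by one. The two fibres over \<open>z\<close> are both infinite.\<close>

lemma bij_of_same_fibre_counts:
  fixes x y :: "nat \<Rightarrow> 'b"
  assumes fin: "finite {j. x j \<noteq> z}" "finite {j. y j \<noteq> z}"
    and card: "\<And>v. v \<noteq> z \<Longrightarrow> card {j. x j = v} = card {j. y j = v}"
  obtains \<pi> where "bij \<pi>" "\<And>j. y (\<pi> j) = x j"
proof -
  have "\<exists>h. bij_betw h {j. x j = v} {j. y j = v}" for v
  proof (cases "v = z")
    case True
    have "infinite {j. u j = z}" if "finite {j. u j \<noteq> z}" for u :: "nat \<Rightarrow> 'b"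
      using that infinite_UNIV_nat finite_Collect_not[of "\<lambda>j. u j = z"] finite_Un
      by (metis (mono_tags, lifting) Collect_neg_eq finite_Collect_not finite_compl)
    then have "bij_betw (enumerate {j. x j = v}) UNIV {j. x j = v}"
      "bij_betw (enumerate {j. y j = v}) UNIV {j. y j = v}"
      using fin True by (auto intro!: bij_enumerate)
    then show ?thesis using bij_betw_trans bij_betw_inv_into by blast
  next
    case False
    have "finite {j. x j = v}" "finite {j. y j = v}"
      using False by (auto intro: finite_subset[OF _ fin(1)] finite_subset[OF _ fin(2)])
    then show ?thesis using finite_same_card_bij card[OF False] by blast
  qed
  then obtain h where h: "\<And>v. bij_betw (h v) {j. x j = v} {j. y j = v}" by metis
  have img: "y (h (x j) j) = x j" for j using h[of "x j"] by (auto simp: bij_betw_def)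
  have "bij (\<lambda>j. h (x j) j)"
  proof (rule bijI)
    show "inj (\<lambda>j. h (x j) j)"
    proof (rule injI)
      fix i j assume eq: "h (x i) i = h (x j) j"
      then have "x i = x j" using img by metis
      then show "i = j" using eq h[of "x i"] by (auto simp: bij_betw_def inj_on_def)
    qed
    show "surj (\<lambda>j. h (x j) j)"
      unfolding surj_def
    proof
      fix k
      have "k \<in> h (y k) ` {j. x j = y k}" using h[of "y k"] by (auto simp: bij_betw_def)
      then obtain j where "k = h (y k) j" "x j = y k" by auto
      then show "\<exists>j. k = h (x j) j" by (intro exI[of _ j]) simp
    qed
  qed
  then show thesis using that img by blast
qed

lemma normalized_sum_cong:
  assumes t: "\<And>j. t j \<in> space S" "\<And>j. t' j \<in> space S"
    and eq: "\<And>j. x j \<noteq> 0 \<Longrightarrow> t j = t' j" "t 0 = t' 0"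
  shows "normalized_sum S x t = normalized_sum S x t'"
proof (rule measure_eqI)
  fix A assume "A \<in> sets (normalized_sum S x t)"
  then have A: "A \<in> sets S" by simp
  have "ennreal (x j) / s * indicator A (t j) = ennreal (x j) / s * indicator A (t' j)" for j s
    by (cases "x j = 0") (auto simp: eq)
  then show "emeasure (normalized_sum S x t) A = emeasure (normalized_sum S x t') A"
    using t A eq(2) by (simp add: emeasure_normalized_sum)
qed simp

text \<open>A finite sample as a sequence of weights; the zeros carry no mass in \<open>normalized_sum\<close>.\<close>

definition pad :: "nat \<Rightarrow> (nat \<Rightarrow> real) \<Rightarrow> nat \<Rightarrow> real" where
  "pad n x j = (if j < n then x j else 0)"

lemma measurable_pad [measurable]:
  assumes D: "sets D = sets borel"
  shows "pad n \<in> measurable (\<Pi>\<^sub>M i\<in>{..<n}. D) (\<Pi>\<^sub>M j\<in>UNIV. borel)"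
proof (rule measurable_PiM_single')
  show "(\<lambda>x. pad n x j) \<in> borel_measurable (\<Pi>\<^sub>M i\<in>{..<n}. D)" for j
  proof (cases "j < n")
    case True
    then have "(\<lambda>x. x j) \<in> measurable (\<Pi>\<^sub>M i\<in>{..<n}. D) D" by (intro measurable_component_singleton) auto
    then show ?thesis using True D by (simp add: pad_def cong: measurable_cong_sets)
  qed (simp add: pad_def)
qed auto

locale weak_test_functional =
  fixes \<Theta> :: "'a::second_countable_topology set" and P0 :: "'a measure"
    and g :: "'a measure \<Rightarrow> real" and C :: real
  assumes prob_P0: "prob_space P0" and sets_P0: "sets P0 = sets (restrict_space borel \<Theta>)"
    and g: "continuous_map (weak_topology \<Theta>) euclideanreal g"
    and g_bound: "\<And>\<mu>. \<mu> \<in> topspace (weak_topology \<Theta>) \<Longrightarrow> \<bar>g \<mu>\<bar> \<le> C"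
begin

abbreviation "weights \<equiv> \<Pi>\<^sub>M (j::nat)\<in>UNIV. (borel :: real measure)"
abbreviation "tags \<equiv> \<Pi>\<^sub>M (j::nat)\<in>UNIV. P0"

sublocale P0: prob_space P0 by (rule prob_P0)
sublocale tags: prob_space tags by (intro prob_space_PiM prob_P0)

lemma space_tags: "t \<in> space tags \<Longrightarrow> t j \<in> space P0"
  by (auto simp: space_PiM)

lemma measurable_g [measurable]: "g \<in> borel_measurable (prob_algebra P0)"
  by (rule continuous_weak_topology_measurable[OF g sets_P0])

lemma g_le: "\<mu> \<in> space (prob_algebra P0) \<Longrightarrow> \<bar>g \<mu>\<bar> \<le> C"
  using g_bound by (simp add: topspace_weak_topology space_prob_algebra sets_P0)

lemma C_nonneg: "0 \<le> C"
proof -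
  obtain y where "y \<in> space P0" using P0.not_empty by auto
  then have "return P0 y \<in> space (prob_algebra P0)" by (simp add: space_prob_algebra prob_space_return)
  from g_le[OF this] show ?thesis by simp
qed

lemma g_normalized_sum_le: "t \<in> space tags \<Longrightarrow> \<bar>g (normalized_sum P0 x t)\<bar> \<le> C"
  by (intro g_le normalized_sum_in_space space_tags)

lemma measurable_g_normalized_sum [measurable]:
  "(\<lambda>(x, t). g (normalized_sum P0 x t)) \<in> borel_measurable (weights \<Otimes>\<^sub>M tags)"
  using measurable_compose[OF measurable_normalized_sum measurable_g] by (simp add: case_prod_beta')

lemma measurable_g_normalized_sum_tags [measurable]:
  "(\<lambda>t. g (normalized_sum P0 x t)) \<in> borel_measurable tags"
  using measurable_Pair_compose_split[OF measurable_g_normalized_sum, of "\<lambda>_. x" tags "\<lambda>t. t"]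
  by (simp add: space_PiM)

text \<open>The conditional expectation of the test functional given the jumps, when the tags are iid.\<close>

definition avg :: "(nat \<Rightarrow> real) \<Rightarrow> real" where
  "avg x = (\<integral>t. g (normalized_sum P0 x t) \<partial>tags)"

lemma measurable_avg [measurable]: "avg \<in> borel_measurable weights"
  unfolding avg_def by (rule tags.borel_measurable_lebesgue_integral) measurable

lemma integrable_g_normalized_sum: "integrable tags (\<lambda>t. g (normalized_sum P0 x t))"
  by (rule tags.integrable_const_bound[of _ C]) (auto intro!: AE_I2 g_normalized_sum_le)

lemma avg_le: "\<bar>avg x\<bar> \<le> C"
proof -
  have "\<bar>avg x\<bar> \<le> (\<integral>t. \<bar>g (normalized_sum P0 x t)\<bar> \<partial>tags)"
    unfolding avg_def by (rule integral_abs_bound)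
  also have "\<dots> \<le> (\<integral>t. C \<partial>tags)"
    by (rule integral_mono) (auto simp: integrable_g_normalized_sum g_normalized_sum_le)
  also have "\<dots> = C" by (simp add: tags.prob_space)
  finally show ?thesis .
qed

text \<open>Permuting the weights is the same as permuting the tags, and the law of the tags is invariant under
permutations.\<close>

lemma avg_permute:
  assumes \<pi>: "bij \<pi>" and pos: "0 < (\<Sum>j. ennreal (x j))" "(\<Sum>j. ennreal (x j)) < \<infinity>"
  shows "avg (\<lambda>j. x (\<pi> j)) = avg x"
proof -
  have "distr tags tags (\<lambda>t. \<lambda>n\<in>UNIV. t (\<pi> n)) = tags"
    by (rule distr_PiM_reindex) (use \<pi> prob_P0 in \<open>auto simp: bij_def\<close>)
  then have d: "distr tags tags (\<lambda>t n. t (\<pi> n)) = tags" by (simp add: restrict_UNIV)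
  have m: "(\<lambda>t n. t (\<pi> n)) \<in> measurable tags tags" by (rule measurable_PiM_single') (auto simp: space_PiM)
  have "avg (\<lambda>j. x (\<pi> j)) = (\<integral>t. g (normalized_sum P0 (\<lambda>j. x (\<pi> j)) (\<lambda>n. t (\<pi> n))) \<partial>tags)"
    unfolding avg_def by (subst (1) d[symmetric], rule integral_distr[OF m]) measurable
  also have "\<dots> = avg x" unfolding avg_def
  proof (rule Bochner_Integration.integral_cong[OF refl])
    fix t assume "t \<in> space tags"
    then have "normalized_sum P0 (\<lambda>j. x (\<pi> j)) (\<lambda>n. t (\<pi> n)) = normalized_sum P0 x t"
      by (intro normalized_sum_permute[OF \<pi> _ pos] space_tags)
    then show "g (normalized_sum P0 (\<lambda>j. x (\<pi> j)) (\<lambda>n. t (\<pi> n))) = g (normalized_sum P0 x t)" by simp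
  qed
  finally show ?thesis .
qed

text \<open>So \<open>avg\<close> sees only how often each nonzero weight occurs. This is what makes the arbitrary enumeration of
the points of a Poisson process harmless.\<close>

lemma avg_eq_if_same_fibre_counts:
  assumes fin: "finite {j. x j \<noteq> 0}" "finite {j. y j \<noteq> 0}" and nonneg: "\<And>j. 0 \<le> y j"
    and card: "\<And>v. v \<noteq> 0 \<Longrightarrow> card {j. x j = v} = card {j. y j = v}"
  shows "avg x = avg y"
proof -
  obtain \<pi> where \<pi>: "bij \<pi>" "\<And>j. y (\<pi> j) = x j" using bij_of_same_fibre_counts[OF fin card] by blast
  then have x: "x = (\<lambda>j. y (\<pi> j))" by auto
  have S: "(\<Sum>j. ennreal (y j)) = ennreal (\<Sum>j\<in>{j. y j \<noteq> 0}. y j)"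
    using fin(2) nonneg by (subst suminf_finite[of "{j. y j \<noteq> 0}"]) (auto simp: sum_ennreal)
  show ?thesis
  proof (cases "(\<Sum>j\<in>{j. y j \<noteq> 0}. y j) = 0")
    case True
    then have "\<forall>j\<in>{j. y j \<noteq> 0}. y j = 0" using fin(2) nonneg by (subst (asm) sum_nonneg_eq_0_iff) auto
    then have "y j = 0" for j by auto
    then have "y = (\<lambda>_. 0)" by auto
    then show ?thesis unfolding x by simp
  next
    case False
    then have "0 < (\<Sum>j\<in>{j. y j \<noteq> 0}. y j)" using sum_nonneg[of _ y] nonneg by (metis order_le_less)
    then show ?thesis unfolding x by (intro avg_permute \<pi>) (auto simp: S)
  qed
qed

lemma g_normalized_sum_tendsto:
  assumes t: "\<And>j. t j \<in> space P0"
    and x: "\<And>k j. 0 \<le> x k j" "\<And>k j. x k j \<le> y j" "summable y"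
    and lim: "\<And>j. (\<lambda>k. x k j) \<longlonglongrightarrow> z j" and z: "0 < suminf z"
  shows "(\<lambda>k. g (normalized_sum P0 (x k) t)) \<longlonglongrightarrow> g (normalized_sum P0 z t)"
  using continuous_map_limit[OF g limitin_normalized_sum[OF sets_P0 t x lim z]]
  by (simp add: o_def)

lemma avg_tendsto:
  assumes x: "\<And>k j. 0 \<le> x k j" "\<And>k j. x k j \<le> y j" "summable y"
    and lim: "\<And>j. (\<lambda>k. x k j) \<longlonglongrightarrow> z j" and z: "0 < suminf z"
  shows "(\<lambda>k. avg (x k)) \<longlonglongrightarrow> avg z"
  unfolding avg_def
proof (rule integral_dominated_convergence[where w="\<lambda>_. C"])
  show "AE t in tags. (\<lambda>k. g (normalized_sum P0 (x k) t)) \<longlonglongrightarrow> g (normalized_sum P0 z t)"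
    by (intro AE_I2 g_normalized_sum_tendsto[OF space_tags x lim z])
qed (auto intro!: AE_I2 g_normalized_sum_le)

lemma expectation_g_normalized_sum:
  assumes M: "prob_space M" and ind: "indep_families M \<nu> J P0 \<tau> UNIV" and \<tau>: "iid M P0 \<tau> UNIV"
    and J: "\<And>j. J j \<in> measurable M \<nu>" and h: "h \<in> borel_measurable \<nu>"
  shows "(\<integral>\<omega>. g (normalized_sum P0 (\<lambda>j. h (J j \<omega>)) (\<lambda>j. \<tau> j \<omega>)) \<partial>M) = (\<integral>\<omega>. avg (\<lambda>j. h (J j \<omega>)) \<partial>M)"
proof -
  interpret prob_space M by fact
  let ?J = "\<Pi>\<^sub>M (j::nat)\<in>UNIV. \<nu>"
  have \<tau>m: "\<tau> j \<in> measurable M P0" for j using \<tau> by (auto simp: iid_def indep_vars_def)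
  have mJ[measurable]: "(\<lambda>\<omega> j. J j \<omega>) \<in> measurable M ?J"
    by (rule measurable_PiM_single') (use J measurable_space[OF J] in auto)
  have m\<tau>[measurable]: "(\<lambda>\<omega> j. \<tau> j \<omega>) \<in> measurable M tags"
    by (rule measurable_PiM_single') (use \<tau>m measurable_space[OF \<tau>m] in auto)
  have mh[measurable]: "(\<lambda>x j. h (x j)) \<in> measurable ?J weights"
    by (rule measurable_PiM_single') (use h in \<open>auto intro: measurable_compose[OF measurable_component_singleton]\<close>)
  have d\<tau>: "distr M tags (\<lambda>\<omega> j. \<tau> j \<omega>) = tags" using distr_restrict_iid[OF M \<tau>] by (simp add: restrict_UNIV)
  have pair: "distr M (?J \<Otimes>\<^sub>M tags) (\<lambda>\<omega>. (\<lambda>j. J j \<omega>, \<lambda>j. \<tau> j \<omega>)) = distr M ?J (\<lambda>\<omega> j. J j \<omega>) \<Otimes>\<^sub>M tags"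
    using distr_pair_indep_families[OF M ind J \<tau>m] by (simp add: d\<tau> restrict_UNIV)
  interpret J: prob_space "distr M ?J (\<lambda>\<omega> j. J j \<omega>)" by (rule prob_space_distr) measurable
  interpret JT: pair_prob_space "distr M ?J (\<lambda>\<omega> j. J j \<omega>)" tags ..
  have mF[measurable]: "(\<lambda>(x, t). g (normalized_sum P0 (\<lambda>j. h (x j)) t)) \<in> borel_measurable (?J \<Otimes>\<^sub>M tags)"
    using measurable_compose[OF _ measurable_g_normalized_sum, of "\<lambda>(x, t). (\<lambda>j. h (x j), t)" "?J \<Otimes>\<^sub>M tags"]
    by (simp add: case_prod_beta')
  have "(\<integral>\<omega>. g (normalized_sum P0 (\<lambda>j. h (J j \<omega>)) (\<lambda>j. \<tau> j \<omega>)) \<partial>M) =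
    (\<integral>(x, t). g (normalized_sum P0 (\<lambda>j. h (x j)) t) \<partial>distr M (?J \<Otimes>\<^sub>M tags) (\<lambda>\<omega>. (\<lambda>j. J j \<omega>, \<lambda>j. \<tau> j \<omega>)))"
    by (subst integral_distr) auto
  also have "\<dots> = (\<integral>x. (\<integral>t. g (normalized_sum P0 (\<lambda>j. h (x j)) t) \<partial>tags) \<partial>distr M ?J (\<lambda>\<omega> j. J j \<omega>))"
    unfolding pair
  proof (rule JT.integral_fst[symmetric])
    show "integrable (distr M ?J (\<lambda>\<omega> j. J j \<omega>) \<Otimes>\<^sub>M tags) (\<lambda>(x, t). g (normalized_sum P0 (\<lambda>j. h (x j)) t))"
    proof (rule JT.integrable_const_bound[of _ C])
      show "AE p in distr M ?J (\<lambda>\<omega> j. J j \<omega>) \<Otimes>\<^sub>M tags.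
          norm (case p of (x, t) \<Rightarrow> g (normalized_sum P0 (\<lambda>j. h (x j)) t)) \<le> C"
        by (intro AE_I2) (auto intro!: g_normalized_sum_le simp: space_pair_measure)
    qed measurable
  qed
  also have "\<dots> = (\<integral>\<omega>. avg (\<lambda>j. h (J j \<omega>)) \<partial>M)"
    unfolding avg_def[symmetric] by (subst integral_distr) auto
  finally show ?thesis .
qed

text \<open>Only \<open>n\<close> tags are available here. The sequence of tags is continued by repeating the last of them, which
has no effect as the corresponding weights are \<open>0\<close>.\<close>

lemma expectation_g_normalized_sum_finite:
  assumes M: "prob_space M" and D: "sets D = sets borel" and J: "iid M D J {..<n}" and \<tau>: "iid M P0 \<tau> {..<n}"
    and ind: "indep_families M D J P0 \<tau> {..<n}" and n: "0 < n"
  shows "(\<integral>\<omega>. g (normalized_sum P0 (pad n (\<lambda>j. J j \<omega>)) (\<lambda>j. \<tau> (min j (n - 1)) \<omega>)) \<partial>M) =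
    (\<integral>x. avg (pad n x) \<partial>(\<Pi>\<^sub>M j\<in>{..<n}. D))"
proof -
  interpret prob_space M by fact
  let ?J = "\<Pi>\<^sub>M j\<in>{..<n}. D" and ?T = "\<Pi>\<^sub>M j\<in>{..<n}. P0"
  let ?ext = "\<lambda>(t :: nat \<Rightarrow> 'a) j. t (min j (n - 1))"
  let ?XJ = "\<lambda>\<omega>. \<lambda>j\<in>{..<n}. J j \<omega>" and ?XT = "\<lambda>\<omega>. \<lambda>j\<in>{..<n}. \<tau> j \<omega>"
  have Jm: "J j \<in> measurable M D" if "j \<in> {..<n}" for j using J that by (auto simp: iid_def indep_vars_def)
  have \<tau>m: "\<tau> j \<in> measurable M P0" if "j \<in> {..<n}" for j using \<tau> that by (auto simp: iid_def indep_vars_def)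
  have mJ[measurable]: "?XJ \<in> measurable M ?J" using Jm by (intro measurable_restrict)
  have m\<tau>[measurable]: "?XT \<in> measurable M ?T" using \<tau>m by (intro measurable_restrict)
  have min: "min j (n - 1) < n" for j using n by auto
  have mext[measurable]: "?ext \<in> measurable ?T tags"
    by (rule measurable_PiM_single') (use min in \<open>auto intro!: measurable_component_singleton simp: space_PiM PiE_iff\<close>)
  note [measurable] = measurable_pad[OF D, of n]
  have dJ: "distr M ?J ?XJ = ?J" by (rule distr_restrict_iid[OF M J]) (use n in auto)
  have d\<tau>: "distr M ?T ?XT = ?T" by (rule distr_restrict_iid[OF M \<tau>]) (use n in auto)
  have pair: "distr M (?J \<Otimes>\<^sub>M ?T) (\<lambda>\<omega>. (?XJ \<omega>, ?XT \<omega>)) = ?J \<Otimes>\<^sub>M ?T"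
    using distr_pair_indep_families[OF M ind Jm \<tau>m] by (simp add: d\<tau> dJ)
  interpret J: prob_space ?J using prob_space_distr[OF mJ] unfolding dJ .
  interpret T: prob_space ?T using prob_space_distr[OF m\<tau>] unfolding d\<tau> .
  interpret JT: pair_prob_space ?J ?T ..
  interpret TT: product_prob_space "\<lambda>_. P0" "UNIV :: nat set" ..
  have mF[measurable]: "(\<lambda>(x, t). g (normalized_sum P0 (pad n x) (?ext t))) \<in> borel_measurable (?J \<Otimes>\<^sub>M ?T)"
  proof -
    have "(\<lambda>p. (pad n (fst p), ?ext (snd p))) \<in> measurable (?J \<Otimes>\<^sub>M ?T) (weights \<Otimes>\<^sub>M tags)"
      by (intro measurable_Pair measurable_compose[OF measurable_fst measurable_pad[OF D]]
          measurable_compose[OF measurable_snd mext])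
    from measurable_compose[OF this measurable_g_normalized_sum] show ?thesis
      by (simp add: case_prod_beta')
  qed
  have sp: "?ext t \<in> space tags" if "t \<in> space ?T" for t
    using measurable_space[OF mext that] .
  have "(\<integral>\<omega>. g (normalized_sum P0 (pad n (\<lambda>j. J j \<omega>)) (\<lambda>j. \<tau> (min j (n - 1)) \<omega>)) \<partial>M) =
    (\<integral>\<omega>. (\<lambda>(x, t). g (normalized_sum P0 (pad n x) (?ext t))) (?XJ \<omega>, ?XT \<omega>) \<partial>M)"
  proof (rule Bochner_Integration.integral_cong[OF refl])
    fix \<omega>
    have "pad n (?XJ \<omega>) = pad n (\<lambda>j. J j \<omega>)" by (auto simp: pad_def)
    moreover have "?ext (?XT \<omega>) = (\<lambda>j. \<tau> (min j (n - 1)) \<omega>)" using min by auto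
    ultimately show "g (normalized_sum P0 (pad n (\<lambda>j. J j \<omega>)) (\<lambda>j. \<tau> (min j (n - 1)) \<omega>)) =
      (\<lambda>(x, t). g (normalized_sum P0 (pad n x) (?ext t))) (?XJ \<omega>, ?XT \<omega>)" by simp
  qed
  also have "\<dots> = (\<integral>(x, t). g (normalized_sum P0 (pad n x) (?ext t)) \<partial>distr M (?J \<Otimes>\<^sub>M ?T) (\<lambda>\<omega>. (?XJ \<omega>, ?XT \<omega>)))"
    by (rule integral_distr[OF _ mF, symmetric]) measurable
  also have "\<dots> = (\<integral>x. (\<integral>t. g (normalized_sum P0 (pad n x) (?ext t)) \<partial>?T) \<partial>?J)"
    unfolding pair
  proof (rule JT.integral_fst[symmetric])
    show "integrable (?J \<Otimes>\<^sub>M ?T) (\<lambda>(x, t). g (normalized_sum P0 (pad n x) (?ext t)))"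
    proof (rule JT.integrable_const_bound[OF _ mF])
      show "AE p in ?J \<Otimes>\<^sub>M ?T. norm (case p of (x, t) \<Rightarrow> g (normalized_sum P0 (pad n x) (?ext t))) \<le> C"
        by (intro AE_I2) (use sp in \<open>auto intro!: g_normalized_sum_le simp: space_pair_measure\<close>)
    qed
  qed
  also have "\<dots> = (\<integral>x. avg (pad n x) \<partial>?J)"
  proof (rule Bochner_Integration.integral_cong[OF refl])
    fix x
    have mx: "(\<lambda>t. g (normalized_sum P0 (pad n x) (?ext t))) \<in> borel_measurable ?T"
      by (rule measurable_compose[OF mext measurable_g_normalized_sum_tags])
    have "(\<integral>t. g (normalized_sum P0 (pad n x) (?ext t)) \<partial>?T) =
      (\<integral>t. g (normalized_sum P0 (pad n x) (?ext t)) \<partial>distr tags ?T (\<lambda>t. restrict t {..<n}))"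
      by (subst TT.distr_PiM_restrict_finite) auto
    also have "\<dots> = (\<integral>t. g (normalized_sum P0 (pad n x) (?ext (restrict t {..<n}))) \<partial>tags)"
      by (rule integral_distr[OF measurable_restrict_subset mx]) auto
    also have "\<dots> = avg (pad n x)"
      unfolding avg_def
    proof (rule Bochner_Integration.integral_cong[OF refl])
      fix t assume t: "t \<in> space tags"
      have "normalized_sum P0 (pad n x) (?ext (restrict t {..<n})) = normalized_sum P0 (pad n x) t"
        by (rule normalized_sum_cong) (use min n space_tags[OF t] in \<open>auto simp: pad_def split: if_splits\<close>)
      then show "g (normalized_sum P0 (pad n x) (?ext (restrict t {..<n}))) = g (normalized_sum P0 (pad n x) t)"
        by simp
    qed
    finally show "(\<integral>t. g (normalized_sum P0 (pad n x) (?ext t)) \<partial>?T) = avg (pad n x)" .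
  qed
  finally show ?thesis .
qed

end

section \<open>Points of a Poisson process above a threshold\<close>

lemma point_count_eq_emeasure: "point_count X A \<omega> = emeasure (count_space UNIV) {j. X j \<omega> \<in> A}"
proof -
  have "point_count X A \<omega> = (\<integral>\<^sup>+j. indicator {j. X j \<omega> \<in> A} j \<partial>count_space UNIV)"
  proof -
    have "indicator A (X j \<omega>) = (indicator {j. X j \<omega> \<in> A} j :: ennreal)" for j by (simp add: indicator_def)
    then show ?thesis unfolding point_count_def nn_integral_count_space_nat by simp
  qed
  then show ?thesis by simp
qed

lemma point_count_eq_of_nat_iff:
  "point_count X A \<omega> = of_nat n \<longleftrightarrow> finite {j. X j \<omega> \<in> A} \<and> card {j. X j \<omega> \<in> A} = n"
  unfolding point_count_eq_emeasure
  by (cases "finite {j. X j \<omega> \<in> A}") (auto simp: emeasure_count_space)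

lemma measurable_point_count:
  assumes "\<And>j. X j \<in> measurable M \<nu>" "A \<in> sets \<nu>"
  shows "point_count X A \<in> borel_measurable M"
proof -
  have [measurable]: "(\<lambda>\<omega>. indicator A (X j \<omega>) :: ennreal) \<in> borel_measurable M" for j
    using assms by (intro measurable_compose[OF assms(1)] borel_measurable_indicator)
  have "point_count X A = (\<lambda>\<omega>. \<Sum>j. indicator A (X j \<omega>))" by (auto simp: point_count_def)
  then show ?thesis by simp
qed

lemma measure_poisson_law:
  assumes "0 \<le> r"
  shows "measure (poisson_law (ennreal r)) {of_nat k} = r ^ k / fact k * exp (- r)"
proof (cases "r = 0")
  case True
  have "measure (return borel (0::ennreal)) {of_nat k} = indicator {of_nat k} (0::ennreal)"
    by (rule measure_return) simp
  then show ?thesis using True by (cases k) (auto simp: poisson_law_def)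
next
  case False
  then have r: "0 < r" using assms by simp
  have "poisson_law (ennreal r) = distr (measure_pmf (poisson_pmf r)) borel of_nat"
    using r by (simp add: poisson_law_def)
  moreover have "(of_nat :: nat \<Rightarrow> ennreal) -` {of_nat k} = {k}" by auto
  ultimately show ?thesis using r
    by (simp add: measure_distr measure_pmf_single)
qed

text \<open>The value \<open>r v = 0\<close> is included: the Poisson weights then reduce to the indicator of \<open>k v = 0\<close>.\<close>

lemma prob_poisson_point_counts:
  assumes M: "prob_space M" and pp: "poisson_process_points M \<nu> X"
    and V: "finite V" "V \<noteq> {}" and A: "\<And>v. v \<in> V \<Longrightarrow> A v \<in> sets \<nu>" "disjoint_family_on A V"
    and r: "\<And>v. v \<in> V \<Longrightarrow> emeasure \<nu> (A v) = ennreal (r v)" "\<And>v. v \<in> V \<Longrightarrow> 0 \<le> r v"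
  shows "measure M {\<omega> \<in> space M. \<forall>v\<in>V. point_count X (A v) \<omega> = of_nat (k v)} =
    (\<Prod>v\<in>V. r v ^ k v / fact (k v) * exp (- r v))"
proof -
  interpret prob_space M by fact
  obtain h where h: "bij_betw h {0..<card V} V" using ex_bij_betw_nat_finite[OF V(1)] by blast
  have hV: "h i \<in> V" if "i < card V" for i using h that by (auto simp: bij_betw_def)
  have X: "X j \<in> measurable M \<nu>" for j using pp by (auto simp: poisson_process_points_def)
  have single: "prob (point_count X (A v) -` {of_nat (k v)} \<inter> space M) = r v ^ k v / fact (k v) * exp (- r v)"
    if "v \<in> V" for v
  proof -
    have "distr M borel (point_count X (A v)) = poisson_law (ennreal (r v))"
      using pp A(1)[OF that] r(1)[OF that] by (auto simp: poisson_process_points_def)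
    then have "prob (point_count X (A v) -` {of_nat (k v)} \<inter> space M) = measure (poisson_law (ennreal (r v))) {of_nat (k v)}"
      using measure_distr[OF measurable_point_count[of X M \<nu>, OF X A(1)[OF that]], of "{of_nat (k v)}"] by simp
    then show ?thesis using measure_poisson_law r(2)[OF that] by simp
  qed
  have dis: "disjoint_family_on (\<lambda>i. A (h i)) {..<card V}"
    unfolding disjoint_family_on_def
  proof (intro ballI impI)
    fix i j assume ij: "i \<in> {..<card V}" "j \<in> {..<card V}" "i \<noteq> j"
    then have "h i \<noteq> h j" using h by (auto simp: bij_betw_def inj_on_def)
    then show "A (h i) \<inter> A (h j) = {}" using A(2) hV ij by (auto simp: disjoint_family_on_def)
  qed
  have ind: "indep_vars (\<lambda>_. borel) (\<lambda>i. point_count X (A (h i))) {..<card V}"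
    using pp dis A(1) hV unfolding poisson_process_points_def by auto
  have "{\<omega> \<in> space M. \<forall>v\<in>V. point_count X (A v) \<omega> = of_nat (k v)} =
    (\<Inter>i\<in>{..<card V}. point_count X (A (h i)) -` {of_nat (k (h i))} \<inter> space M)"
  proof -
    have "V = h ` {..<card V}" using h by (auto simp: bij_betw_def atLeast0LessThan)
    then have "Ball V Q \<longleftrightarrow> (\<forall>i\<in>{..<card V}. Q (h i))" for Q
      using Set.ball_simps(9)[of h "{..<card V}" Q] by simp
    moreover have "0 < card V" using V by (simp add: card_gt_0_iff)
    ultimately show ?thesis by auto
  qed
  also have "prob \<dots> = (\<Prod>i\<in>{..<card V}. prob (point_count X (A (h i)) -` {of_nat (k (h i))} \<inter> space M))"
    by (rule indep_varsD[OF ind]) (use V card_gt_0_iff[of V] in auto)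
  also have "\<dots> = (\<Prod>i\<in>{..<card V}. r (h i) ^ k (h i) / fact (k (h i)) * exp (- r (h i)))"
    using single hV by (intro prod.cong) auto
  also have "\<dots> = (\<Prod>v\<in>V. r v ^ k v / fact (k v) * exp (- r v))"
    using h by (intro prod.reindex_bij_betw) (simp add: atLeast0LessThan)
  finally show ?thesis .
qed

text \<open>The multinomial count: a multiset \<open>A\<close> of size \<open>n\<close> has \<open>n! / \<Prod>\<^sub>v (count A v)!\<close> orderings. It turns a sum
over ordered samples into one over unordered samples, with the weights of independent Poisson counts.\<close>

lemma sum_lists_by_multiset:
  fixes q :: "'b \<Rightarrow> real"
  assumes V: "finite V"
  shows "(\<Sum>xs | set xs \<subseteq> V \<and> length xs = n. prod_list (map q xs) * c (mset xs)) =
    fact n * (\<Sum>A\<in>mset ` {xs. set xs \<subseteq> V \<and> length xs = n}. (\<Prod>v\<in>V. q v ^ count A v / fact (count A v)) * c A)"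
proof -
  let ?L = "{xs. set xs \<subseteq> V \<and> length xs = n}"
  have "(\<Sum>xs\<in>?L. prod_list (map q xs) * c (mset xs)) =
    (\<Sum>A\<in>mset ` ?L. \<Sum>xs\<in>{xs \<in> ?L. mset xs = A}. prod_list (map q xs) * c (mset xs))"
    by (rule sum.image_gen) (rule finite_lists_length_eq[OF V])
  also have "\<dots> = (\<Sum>A\<in>mset ` ?L. fact n * ((\<Prod>v\<in>V. q v ^ count A v / fact (count A v)) * c A))"
  proof (rule sum.cong[OF refl])
    fix A assume "A \<in> mset ` ?L"
    then have A: "set_mset A \<subseteq> V" "size A = n" by auto
    have pq: "prod_list (map q xs) = (\<Prod>v\<in>V. q v ^ count A v)" if "mset xs = A" for xs
    proof -
      have "prod_list (map q xs) = (\<Prod>v\<in>set_mset A. q v ^ count A v)"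
        using that image_prod_mset_multiplicity[of q A]
        by (metis mset_map prod_mset_prod_list)
      also have "\<dots> = (\<Prod>v\<in>V. q v ^ count A v)"
        using A by (intro prod.mono_neutral_left V) (auto simp: not_in_iff)
      finally show ?thesis .
    qed
    \<comment> \<open>The summands are constant on the orderings of \<open>A\<close>, so only their number matters.\<close>
    have "{xs \<in> ?L. mset xs = A} = permutations_of_multiset A"
      using A by (auto simp: permutations_of_multiset_def)
    then have "(\<Sum>xs\<in>{xs \<in> ?L. mset xs = A}. prod_list (map q xs) * c (mset xs)) =
      (\<Sum>xs\<in>permutations_of_multiset A. (\<Prod>v\<in>V. q v ^ count A v) * c A)"
      using pq by (auto simp: permutations_of_multiset_def intro!: sum.cong)
    also have "\<dots> = real (card (permutations_of_multiset A)) * ((\<Prod>v\<in>V. q v ^ count A v) * c A)"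
      by simp
    also have "real (card (permutations_of_multiset A)) = fact n / (\<Prod>v\<in>V. fact (count A v))"
    proof -
      have "real (card (permutations_of_multiset A)) = fact n / (\<Prod>v\<in>set_mset A. fact (count A v))"
        using card_permutations_of_multiset[of A] A
        by (simp add: real_of_nat_div)
      also have "(\<Prod>v\<in>set_mset A. fact (count A v) :: real) = (\<Prod>v\<in>V. fact (count A v))"
        using A by (intro prod.mono_neutral_left V) (auto simp: not_in_iff)
      finally show ?thesis .
    qed
    finally show "(\<Sum>xs\<in>{xs \<in> ?L. mset xs = A}. prod_list (map q xs) * c (mset xs)) =
      fact n * ((\<Prod>v\<in>V. q v ^ count A v / fact (count A v)) * c A)"
      by (simp add: prod_dividef)
  qed
  finally show ?thesis by (simp add: sum_distrib_left)
qed

text \<open>\<open>D\<close> is the intensity \<open>\<nu>\<close> restricted to \<open>(\<epsilon>, \<infinity>)\<close> and normalised by its mass \<open>\<Lambda>\<close>.\<close>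

locale poisson_sample = prob_space M for M :: "'w measure" +
  fixes \<nu> :: "real measure" and J :: "nat \<Rightarrow> 'w \<Rightarrow> real" and \<epsilon> \<Lambda> :: real and D :: "real measure"
  assumes points: "poisson_process_points M \<nu> J"
    and sets_\<nu>: "sets \<nu> = sets (restrict_space borel {0<..})"
    and eps: "0 < \<epsilon>" and Lambda: "0 < \<Lambda>"
    and prob_D: "prob_space D" and sets_D: "sets D = sets borel"
    and D_cell: "\<And>A. A \<in> sets borel \<Longrightarrow> emeasure \<nu> (A \<inter> {\<epsilon><..}) = ennreal (\<Lambda> * measure D A)"
begin

sublocale D: prob_space D by (rule prob_D)

lemma J_measurable: "J j \<in> measurable M \<nu>"
  using points by (auto simp: poisson_process_points_def)

lemma J_borel [measurable]: "J j \<in> borel_measurable M"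
proof -
  have "J j \<in> measurable M (restrict_space borel {0<..})"
    using J_measurable sets_\<nu> by (simp cong: measurable_cong_sets)
  then show ?thesis by (simp add: measurable_restrict_space2_iff)
qed

lemma J_pos: "\<omega> \<in> space M \<Longrightarrow> 0 < J j \<omega>"
  using measurable_space[OF J_measurable, of \<omega> j] sets_eq_imp_space_eq[OF sets_\<nu>]
  by (simp add: space_restrict_space)

lemma tail_sets: "A \<in> sets borel \<Longrightarrow> A \<inter> {\<epsilon><..} \<in> sets \<nu>"
  unfolding sets_\<nu> sets_restrict_space using eps by (intro image_eqI[of _ _ "A \<inter> {\<epsilon><..}"]) auto

lemma AE_D: "AE x in D. \<epsilon> < x"
proof -
  have "ennreal (\<Lambda> * measure D {..\<epsilon>}) = emeasure \<nu> ({..\<epsilon>} \<inter> {\<epsilon><..})" by (rule D_cell[symmetric]) simp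
  also have "{..\<epsilon>} \<inter> {\<epsilon><..} = {}" by auto
  finally have "measure D {..\<epsilon>} = 0"
    using Lambda measure_nonneg[of D "{..\<epsilon>}"] by (simp add: ennreal_eq_0_iff mult_le_0_iff)
  then have "AE x in D. x \<notin> {..\<epsilon>}"
    using sets_D by (subst AE_iff_measurable[of "{..\<epsilon>}"]) (auto simp: D.emeasure_eq_measure sets_eq_imp_space_eq[OF sets_D])
  then show ?thesis by (simp add: not_le)
qed

lemma AE_sample: fixes n :: nat shows "AE x in (\<Pi>\<^sub>M i\<in>{..<n}. D). \<forall>i<n. \<epsilon> < x i"
proof -
  have "AE x in (\<Pi>\<^sub>M i\<in>{..<n}. D). \<forall>i\<in>{..<n}. \<epsilon> < x i"
    by (intro AE_finite_allI AE_PiM_component prob_D AE_D) auto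
  then show ?thesis unfolding Ball_def lessThan_iff .
qed

definition count_event :: "nat \<Rightarrow> 'w set" where
  "count_event n = {\<omega> \<in> space M. finite {j. \<epsilon> < J j \<omega>} \<and> card {j. \<epsilon> < J j \<omega>} = n}"

lemma count_event_eq: "count_event n = {\<omega> \<in> space M. point_count J {\<epsilon><..} \<omega> = of_nat n}"
  by (simp add: count_event_def point_count_eq_of_nat_iff)

lemma count_event_sets [measurable]: "count_event n \<in> sets M"
proof -
  have [measurable]: "point_count J {\<epsilon><..} \<in> borel_measurable M"
    using measurable_point_count[OF J_measurable tail_sets[of UNIV]] by simp
  show ?thesis unfolding count_event_eq by measurable
qed

lemma AE_count_event: "AE \<omega> in M. \<exists>n. \<omega> \<in> count_event n"
proof -
  have t: "{\<epsilon><..} \<in> sets \<nu>" using tail_sets[of UNIV] by simp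
  have mD: "measure D UNIV = 1" using D.prob_space sets_eq_imp_space_eq[OF sets_D] by simp
  have m: "point_count J {\<epsilon><..} \<in> borel_measurable M" by (rule measurable_point_count[OF J_measurable t])
  have "emeasure \<nu> {\<epsilon><..} = ennreal \<Lambda>" using D_cell[of UNIV] mD by simp
  then have d: "distr M borel (point_count J {\<epsilon><..}) = distr (measure_pmf (poisson_pmf \<Lambda>)) borel of_nat"
    using points t Lambda by (auto simp: poisson_process_points_def poisson_law_def)
  have "AE x in distr M borel (point_count J {\<epsilon><..}). x \<noteq> \<infinity>"
    unfolding d by (subst AE_distr_iff) auto
  then have "AE \<omega> in M. point_count J {\<epsilon><..} \<omega> \<noteq> \<infinity>" using AE_distrD[OF m] by simp
  then show ?thesis
  proof (rule AE_mp, intro AE_I2 impI)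
    fix \<omega> assume "\<omega> \<in> space M" "point_count J {\<epsilon><..} \<omega> \<noteq> \<infinity>"
    then show "\<exists>n. \<omega> \<in> count_event n"
      unfolding count_event_def point_count_eq_emeasure
      by (cases "finite {j. \<epsilon> < J j \<omega>}") (auto simp: emeasure_count_space)
  qed
qed


text \<open>Conditionally on their number, the points above \<open>\<epsilon>\<close> form an iid sample, tested on a symmetric function
\<open>\<phi>\<close> of the points rounded to a finite set \<open>V\<close>. Both sides are sums over the multisets \<open>A\<close> of size \<open>n\<close> over
\<open>V\<close>. On the left, the counts of the values in \<open>V\<close> are independent Poisson variables with means \<open>\<Lambda> q v\<close>. On
the right, \<open>A\<close> arises from all its orderings. The factor \<open>n!\<close> from the number of orderings cancels the
one in the Poisson weight of \<open>n\<close>. Positivity of the elements of \<open>V\<close> separates the points above \<open>\<epsilon>\<close>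
from the others, which are rounded to \<open>0\<close>.\<close>

lemma discretized_expectation_of_points:
  assumes r: "r \<in> borel_measurable borel" and V: "finite V" "V \<subseteq> {0<..}"
    and rV: "\<And>s. \<epsilon> < s \<Longrightarrow> r s \<in> V" "\<And>s. s \<le> \<epsilon> \<Longrightarrow> r s = 0"
    and \<phi>: "\<phi> \<in> borel_measurable (\<Pi>\<^sub>M j\<in>UNIV. borel)"
    and sym: "\<And>x y :: nat \<Rightarrow> real. finite {j. x j \<noteq> 0} \<Longrightarrow> finite {j. y j \<noteq> 0} \<Longrightarrow> (\<And>j. 0 \<le> y j) \<Longrightarrow>
      (\<And>v. v \<noteq> 0 \<Longrightarrow> card {j. x j = v} = card {j. y j = v}) \<Longrightarrow> \<phi> x = \<phi> y"
  shows "(\<integral>\<omega>. indicator (count_event n) \<omega> * \<phi> (\<lambda>j. r (J j \<omega>)) \<partial>M) =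
    \<Lambda> ^ n / fact n * exp (- \<Lambda>) * (\<integral>x. \<phi> (pad n (\<lambda>j. r (x j))) \<partial>(\<Pi>\<^sub>M j\<in>{..<n}. D))"
proof -
  define L where "L = {xs. set xs \<subseteq> V \<and> length xs = n}"
  have finL: "finite L" unfolding L_def by (rule finite_lists_length_eq[OF V(1)])
  have V0: "0 \<notin> V" using V(2) by auto
  have neV: "V \<noteq> {}" using rV(1)[of "\<epsilon> + 1"] by auto
  have r0: "r s = 0 \<longleftrightarrow> s \<le> \<epsilon>" for s using rV[of s] V0 by (metis not_le)
  have r_pos: "\<epsilon> < s" if "r s \<in> V" for s using that r0[of s] V0 by (metis not_le)
  have rle: "0 \<le> r s" for s using rV[of s] V(2) by (cases "\<epsilon> < s") fastforce+
  note [measurable] = r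
  define q where "q v = measure D {s. r s = v}" for v
  define cell where "cell v = {s. r s = v} \<inter> {\<epsilon><..}" for v
  have cell_b: "{s. r s = v} \<in> sets borel" for v by measurable
  have cell_sets: "cell v \<in> sets \<nu>" for v unfolding cell_def by (rule tail_sets[OF cell_b])
  have cell_eq: "cell v = {s. r s = v}" if "v \<in> V" for v
    using that r_pos unfolding cell_def by auto
  have sum_q: "(\<Sum>v\<in>V. q v) = 1"
  proof -
    have "(\<Sum>v\<in>V. q v) = measure D (\<Union>v\<in>V. {s. r s = v})"
      unfolding q_def by (rule D.finite_measure_finite_Union[symmetric])
        (use V cell_b sets_D in \<open>auto simp: disjoint_family_on_def\<close>)
    also have "\<dots> = 1"
      using V AE_D rV(1) cell_b sets_D by (intro D.prob_eq_1[THEN iffD2] sets.finite_UN) auto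
    finally show ?thesis .
  qed
  define E where "E A = {\<omega> \<in> space M. \<forall>v\<in>V. point_count J (cell v) \<omega> = of_nat (count A v)}" for A
  have E_sets[measurable]: "E A \<in> sets M" for A
  proof -
    have [measurable]: "point_count J (cell v) \<in> borel_measurable M" for v
      by (rule measurable_point_count[OF J_measurable cell_sets])
    show ?thesis unfolding E_def using V(1) by measurable
  qed
  have prob_E: "prob (E A) = (\<Prod>v\<in>V. (\<Lambda> * q v) ^ count A v / fact (count A v)) * exp (- \<Lambda>)" for A
  proof -
    have "prob (E A) = (\<Prod>v\<in>V. (\<Lambda> * q v) ^ count A v / fact (count A v) * exp (- (\<Lambda> * q v)))"
      unfolding E_def
    proof (rule prob_poisson_point_counts[OF prob_space_axioms points V(1) neV cell_sets])
      show "disjoint_family_on cell V" by (auto simp: disjoint_family_on_def cell_def)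
      show "emeasure \<nu> (cell v) = ennreal (\<Lambda> * q v)" for v
        unfolding cell_def q_def by (rule D_cell[OF cell_b])
      show "0 \<le> \<Lambda> * q v" for v using Lambda by (simp add: q_def)
    qed
    also have "\<dots> = (\<Prod>v\<in>V. (\<Lambda> * q v) ^ count A v / fact (count A v)) * exp (\<Sum>v\<in>V. - (\<Lambda> * q v))"
      using V(1) by (simp only: prod.distrib exp_sum)
    also have "(\<Sum>v\<in>V. - (\<Lambda> * q v)) = - \<Lambda>"
      using sum_q by (simp add: sum_negf sum_distrib_left[symmetric])
    finally show ?thesis .
  qed
  \<comment> \<open>The common value of \<open>\<phi>\<close> on all orderings of \<open>A\<close>; sorting merely picks one of them.\<close>
  define c where "c A = \<phi> (pad (size A) (\<lambda>i. sorted_list_of_multiset A ! i))" for A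
  have card_pad: "card {j. pad n (\<lambda>i. xs ! i) j = v} = count (mset xs) v" if "length xs = n" "v \<noteq> 0"
    for xs :: "real list" and v n
  proof -
    have "{j. pad n (\<lambda>i. xs ! i) j = v} = {i. i < length xs \<and> v = xs ! i}"
      using that by (auto simp: pad_def split: if_splits)
    then show ?thesis by (simp add: count_mset count_list_eq_length_filter length_filter_conv_card)
  qed
  have fin_pad: "finite {j. pad n x j \<noteq> 0}" for n x
    by (rule finite_subset[of _ "{..<n}"]) (auto simp: pad_def)
  have c_list: "\<phi> (pad n (\<lambda>i. xs ! i)) = c (mset xs)" if "xs \<in> L" for xs
    unfolding c_def
  proof (rule sym[OF fin_pad fin_pad])
    have len: "length xs = n" using that by (simp add: L_def)
    show "0 \<le> pad (size (mset xs)) (\<lambda>i. sorted_list_of_multiset (mset xs) ! i) j" for j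
    proof (cases "j < size (mset xs)")
      case True
      then have "sorted_list_of_multiset (mset xs) ! j \<in> set xs"
        using nth_mem[of j "sorted_list_of_multiset (mset xs)"] by simp
      then show ?thesis using that V(2) True by (force simp: L_def pad_def)
    qed (simp add: pad_def)
    fix v :: real assume "v \<noteq> 0"
    then show "card {j. pad n (\<lambda>i. xs ! i) j = v} =
        card {j. pad (size (mset xs)) (\<lambda>i. sorted_list_of_multiset (mset xs) ! i) j = v}"
      using card_pad[of xs n v] card_pad[of "sorted_list_of_multiset (mset xs)" "size (mset xs)" v] len by simp
  qed
  have E_iff: "point_count J (cell v) \<omega> = of_nat k \<longleftrightarrow> finite {j. r (J j \<omega>) = v} \<and> card {j. r (J j \<omega>) = v} = k"
    if "v \<in> V" for v \<omega> k
    unfolding point_count_eq_of_nat_iff cell_eq[OF that] by simp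
  \<comment> \<open>The three facts up to \<open>E_unique\<close>: on the event that there are \<open>n\<close> points above \<open>\<epsilon>\<close>, exactly one of the events \<open>E A\<close> occurs, and \<open>\<phi>\<close> takes the value \<open>c A\<close> there; off it none occurs.\<close>
  have E_count: "n = size A \<and> \<omega> \<in> count_event (size A) \<and> \<phi> (\<lambda>j. r (J j \<omega>)) = c A" if A: "A \<in> mset ` L" and \<omega>: "\<omega> \<in> E A" for A \<omega>
  proof -
    obtain xs where xs: "A = mset xs" "xs \<in> L" using A by auto
    have setA: "set_mset A \<subseteq> V" and size: "size A = n" using xs by (auto simp: L_def)
    have fib: "finite {j. r (J j \<omega>) = v}" "card {j. r (J j \<omega>) = v} = count A v" if "v \<in> V" for v
      using \<omega> E_iff[OF that] that by (auto simp: E_def)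
    have S: "{j. \<epsilon> < J j \<omega>} = (\<Union>v\<in>V. {j. r (J j \<omega>) = v})"
      using rV(1) r_pos by auto
    have finS: "finite {j. \<epsilon> < J j \<omega>}" unfolding S using V fib by auto
    have "card {j. \<epsilon> < J j \<omega>} = (\<Sum>v\<in>V. card {j. r (J j \<omega>) = v})"
      unfolding S using V fib by (intro card_UN_disjoint) auto
    also have "\<dots> = (\<Sum>v\<in>V. count A v)" using fib by simp
    also have "\<dots> = size A" unfolding size_multiset_overloaded_eq
      using setA V by (intro sum.mono_neutral_right) (auto simp: not_in_iff)
    finally have "\<omega> \<in> count_event (size A)" using finS \<omega> by (auto simp: count_event_def E_def)
    moreover have "\<phi> (pad n (\<lambda>i. xs ! i)) = \<phi> (\<lambda>j. r (J j \<omega>))"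
    proof (rule sym[OF fin_pad])
      show "finite {j. r (J j \<omega>) \<noteq> 0}" using finS by (simp add: r0 not_le)
      fix v :: real assume v: "v \<noteq> 0"
      have "card {j. r (J j \<omega>) = v} = count A v"
      proof (cases "v \<in> V")
        case False
        then have "{j. r (J j \<omega>) = v} = {}" using v rV by (metis (mono_tags, lifting) Collect_empty_eq not_le)
        moreover have "count A v = 0" using False setA by (auto simp: not_in_iff)
        ultimately show ?thesis by simp
      qed (use fib in simp)
      then show "card {j. pad n (\<lambda>i. xs ! i) j = v} = card {j. r (J j \<omega>) = v}"
        using card_pad[OF _ v, of xs n] xs by (simp add: L_def)
    qed (rule rle)
    ultimately show ?thesis using c_list[OF xs(2)] xs size by simp
  qed
  have E_exists: "\<exists>A\<in>mset ` L. \<omega> \<in> E A" if \<omega>: "\<omega> \<in> count_event n" for \<omega>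
  proof -
    let ?S = "{j. \<epsilon> < J j \<omega>}"
    have S: "finite ?S" "card ?S = n" "\<omega> \<in> space M" using \<omega> by (auto simp: count_event_def)
    define A where "A = image_mset (\<lambda>j. r (J j \<omega>)) (mset_set ?S)"
    have cA: "count A v = card {j. r (J j \<omega>) = v}" "finite {j. r (J j \<omega>) = v}" if "v \<in> V" for v
    proof -
      have "{j \<in> ?S. r (J j \<omega>) = v} = {j. r (J j \<omega>) = v}" using that r_pos by auto
      then show "count A v = card {j. r (J j \<omega>) = v}" "finite {j. r (J j \<omega>) = v}"
        unfolding A_def using S(1) count_image_mset_eq_card_vimage[OF S(1), of "\<lambda>j. r (J j \<omega>)" v]
        by (auto intro: finite_subset[of _ ?S])
    qed
    have "set_mset A \<subseteq> V" "size A = n" using S rV(1) by (auto simp: A_def)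
    moreover obtain xs where "mset xs = A" using ex_mset by blast
    ultimately have "A \<in> mset ` L" by (auto simp: L_def)
    moreover have "\<omega> \<in> E A" unfolding E_def using S(3) cA E_iff by auto
    ultimately show ?thesis by blast
  qed
  have E_unique: "A = B" if A: "A \<in> mset ` L" "B \<in> mset ` L" and "\<omega> \<in> E A" "\<omega> \<in> E B" for A B \<omega>
  proof (rule multiset_eqI)
    fix v
    show "count A v = count B v"
    proof (cases "v \<in> V")
      case True
      then show ?thesis using that E_iff[OF True] by (auto simp: E_def)
    next
      case False
      then have "v \<notin># A" "v \<notin># B" using A by (auto simp: L_def)
      then show ?thesis by (simp add: not_in_iff)
    qed
  qed
  have "(\<integral>\<omega>. indicator (count_event n) \<omega> * \<phi> (\<lambda>j. r (J j \<omega>)) \<partial>M) =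
    (\<integral>\<omega>. (\<Sum>A\<in>mset ` L. indicator (E A) \<omega> * c A) \<partial>M)"
  proof (rule Bochner_Integration.integral_cong[OF refl])
    fix \<omega>
    show "indicator (count_event n) \<omega> * \<phi> (\<lambda>j. r (J j \<omega>)) = (\<Sum>A\<in>mset ` L. indicator (E A) \<omega> * c A)"
    proof (cases "\<omega> \<in> count_event n")
      case True
      then obtain A where A: "A \<in> mset ` L" "\<omega> \<in> E A" using E_exists by blast
      have "(\<Sum>A\<in>mset ` L. indicator (E A) \<omega> * c A) = (\<Sum>A\<in>{A}. indicator (E A) \<omega> * c A)"
        using A E_unique finL by (intro sum.mono_neutral_right) (auto simp: indicator_def)
      then show ?thesis using A E_count[OF A] True by simp
    next
      case False
      then have "indicator (E A) \<omega> * c A = 0" if "A \<in> mset ` L" for A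
        using E_count[OF that] that by (auto simp: indicator_def)
      then show ?thesis using False by (simp add: sum.neutral)
    qed
  qed
  also have "\<dots> = (\<Sum>A\<in>mset ` L. prob (E A) * c A)"
    by (subst Bochner_Integration.integral_sum) (auto intro!: integrable_mult_left integrable_real_indicator simp: less_top[symmetric])
  also have "\<dots> = exp (- \<Lambda>) * \<Lambda> ^ n * (\<Sum>A\<in>mset ` L. (\<Prod>v\<in>V. q v ^ count A v / fact (count A v)) * c A)"
    unfolding sum_distrib_left
  proof (rule sum.cong[OF refl])
    fix A assume "A \<in> mset ` L"
    then have A: "set_mset A \<subseteq> V" "size A = n" by (auto simp: L_def)
    have "(\<Prod>v\<in>V. (\<Lambda> * q v) ^ count A v / fact (count A v)) =
      (\<Prod>v\<in>V. \<Lambda> ^ count A v) * (\<Prod>v\<in>V. q v ^ count A v / fact (count A v))"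
      unfolding prod.distrib[symmetric] by (simp add: power_mult_distrib)
    also have "(\<Prod>v\<in>V. \<Lambda> ^ count A v) = \<Lambda> ^ (\<Sum>v\<in>V. count A v)" by (rule power_sum[symmetric])
    also have "(\<Sum>v\<in>V. count A v) = n" unfolding A(2)[symmetric] size_multiset_overloaded_eq
      using A V by (intro sum.mono_neutral_right) (auto simp: not_in_iff)
    finally show "prob (E A) * c A = exp (- \<Lambda>) * \<Lambda> ^ n * ((\<Prod>v\<in>V. q v ^ count A v / fact (count A v)) * c A)"
      unfolding prob_E by simp
  qed
  also have "\<dots> = \<Lambda> ^ n / fact n * exp (- \<Lambda>) * (\<Sum>xs\<in>L. prod_list (map q xs) * c (mset xs))"
    unfolding L_def sum_lists_by_multiset[OF V(1)] by simp
  also have "(\<Sum>xs\<in>L. prod_list (map q xs) * c (mset xs)) =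
    (\<integral>x. \<phi> (pad n (\<lambda>j. r (x j))) \<partial>(\<Pi>\<^sub>M j\<in>{..<n}. D))"
  proof -
    let ?P = "\<Pi>\<^sub>M j\<in>{..<n}. D"
    interpret P: product_prob_space "\<lambda>_. D" "{..<n}" ..
    define B where "B xs = {x \<in> space ?P. \<forall>i\<in>{..<n}. x i \<in> {s. r s = xs ! i}}" for xs
    have sB: "{s. r s = v} \<in> sets D" for v using cell_b sets_D by simp
    have B_sets: "B xs \<in> sets ?P" for xs
    proof -
      have "B xs = (\<Pi>\<^sub>E i\<in>{..<n}. {s. r s = xs ! i})"
        unfolding B_def space_PiM using sets.sets_into_space[OF sB]
        by (auto simp: PiE_iff extensional_def)
      then show ?thesis using sB by (auto intro!: sets_PiM_I_finite)
    qed
    have mB: "P.prob (B xs) = prod_list (map q xs)" if "xs \<in> L" for xs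
    proof -
      have "emeasure ?P (B xs) = (\<Prod>i<n. emeasure D {s. r s = xs ! i})"
        unfolding B_def by (rule P.emeasure_PiM_Collect) (use sB in auto)
      also have "\<dots> = ennreal (\<Prod>i<n. q (xs ! i))"
        by (simp add: D.emeasure_eq_measure q_def prod_ennreal)
      also have "(\<Prod>i<n. q (xs ! i)) = prod_list (map q xs)"
        using that by (simp add: prod.list_conv_set_nth L_def atLeast0LessThan)
      finally have "emeasure ?P (B xs) = ennreal (prod_list (map q xs))" .
      moreover have "0 \<le> prod_list (map q xs)" by (induction xs) (auto simp: q_def)
      ultimately show ?thesis by (simp add: measure_def)
    qed
    have "(\<integral>x. \<phi> (pad n (\<lambda>j. r (x j))) \<partial>?P) = (\<integral>x. (\<Sum>xs\<in>L. indicator (B xs) x * c (mset xs)) \<partial>?P)"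
    proof (rule integral_cong_AE)
      have mp: "pad n \<in> measurable ?P (\<Pi>\<^sub>M j\<in>UNIV. borel)" by (rule measurable_pad[OF sets_D])
      have mr: "(\<lambda>x j. r (x j)) \<in> measurable (\<Pi>\<^sub>M (j::nat)\<in>UNIV. borel) (\<Pi>\<^sub>M j\<in>UNIV. borel)"
        by (rule measurable_PiM_single') auto
      have "pad n (\<lambda>j. r (x j)) = (\<lambda>j. r (pad n x j))" for x
        using eps rV(2)[of 0] by (auto simp: pad_def)
      then show "(\<lambda>x. \<phi> (pad n (\<lambda>j. r (x j)))) \<in> borel_measurable ?P"
        using measurable_compose[OF measurable_compose[OF mp mr] \<phi>] by simp
      show "(\<lambda>x. \<Sum>xs\<in>L. indicator (B xs) x * c (mset xs)) \<in> borel_measurable ?P"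
        using B_sets by measurable
      show "AE x in ?P. \<phi> (pad n (\<lambda>j. r (x j))) = (\<Sum>xs\<in>L. indicator (B xs) x * c (mset xs))"
        using AE_sample[of n] AE_space
      proof eventually_elim
        case (elim x)
        \<comment> \<open>Almost every sample falls into exactly one box, that of its rounded values.\<close>
        define ys where "ys = map (\<lambda>j. r (x j)) [0..<n]"
        have ys: "ys \<in> L" using elim(1) rV(1) by (auto simp: ys_def L_def)
        have iff: "x \<in> B xs \<longleftrightarrow> xs = ys" if "xs \<in> L" for xs
          using that elim(2) by (auto simp: B_def ys_def L_def list_eq_iff_nth_eq)
        have "(\<Sum>xs\<in>L. indicator (B xs) x * c (mset xs)) = (\<Sum>xs\<in>{ys}. indicator (B xs) x * c (mset xs))"
          using ys iff finL by (intro sum.mono_neutral_right) (auto simp: indicator_def)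
        also have "\<dots> = \<phi> (pad n (\<lambda>i. ys ! i))" using ys iff[OF ys] c_list[OF ys] by simp
        also have "pad n (\<lambda>i. ys ! i) = pad n (\<lambda>j. r (x j))" by (auto simp: pad_def ys_def)
        finally show ?case by simp
      qed
    qed
    also have "\<dots> = (\<Sum>xs\<in>L. P.prob (B xs) * c (mset xs))"
      using B_sets
      by (subst Bochner_Integration.integral_sum) (auto intro!: integrable_mult_left integrable_real_indicator simp: less_top[symmetric])
    also have "\<dots> = (\<Sum>xs\<in>L. prod_list (map q xs) * c (mset xs))" using mB by simp
    finally show ?thesis by simp
  qed
  finally show ?thesis .
qed

end

section \<open>From rounded jumps to the jumps themselves\<close>

lemma sums_integral_partition:
  fixes f :: "'w \<Rightarrow> real"
  assumes M: "prob_space M" and A: "\<And>n::nat. A n \<in> sets M" and disj: "disjoint_family A"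
    and cover: "AE \<omega> in M. \<exists>n. \<omega> \<in> A n" and f: "f \<in> borel_measurable M" and C: "\<And>\<omega>. \<omega> \<in> space M \<Longrightarrow> \<bar>f \<omega>\<bar> \<le> C"
  shows "(\<lambda>n. \<integral>\<omega>. indicator (A n) \<omega> * f \<omega> \<partial>M) sums (\<integral>\<omega>. f \<omega> \<partial>M)"
proof -
  interpret prob_space M by fact
  note [measurable] = A f
  have int: "integrable M (\<lambda>\<omega>. indicator (A n) \<omega> * f \<omega>)" for n
    by (rule integrable_const_bound[of _ "\<bar>C\<bar>"])
       (use C in \<open>auto intro!: AE_I2 simp: indicator_def intro: order_trans[OF C]\<close>)
  have part: "(\<Sum>n<N. indicator (A n) \<omega> * f \<omega>) = indicator (\<Union>n<N. A n) \<omega> * f \<omega>" for N \<omega>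
    using disj by (subst indicator_UN_disjoint) (auto simp: disjoint_family_on_def sum_distrib_right)
  have "(\<lambda>N. \<integral>\<omega>. (\<Sum>n<N. indicator (A n) \<omega> * f \<omega>) \<partial>M) \<longlonglongrightarrow> (\<integral>\<omega>. f \<omega> \<partial>M)"
  proof (rule integral_dominated_convergence[where w="\<lambda>_. \<bar>C\<bar>"])
    show "AE \<omega> in M. norm (\<Sum>n<N. indicator (A n) \<omega> * f \<omega>) \<le> \<bar>C\<bar>" for N
      unfolding part using C by (intro AE_I2) (auto simp: indicator_def intro: order_trans[OF C])
    show "AE \<omega> in M. (\<lambda>N. \<Sum>n<N. indicator (A n) \<omega> * f \<omega>) \<longlonglongrightarrow> f \<omega>"
      using cover
    proof eventually_elim
      case (elim \<omega>)
      then obtain n where "\<omega> \<in> A n" by auto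
      then have "(\<Sum>n<N. indicator (A n) \<omega> * f \<omega>) = f \<omega>" if "N > n" for N
        unfolding part using that by (auto simp: indicator_def)
      then show ?case
        by (intro tendsto_eventually eventually_mono[OF eventually_gt_at_top[of n]]) auto
    qed
  qed auto
  moreover have "(\<integral>\<omega>. (\<Sum>n<N. indicator (A n) \<omega> * f \<omega>) \<partial>M) = (\<Sum>n<N. \<integral>\<omega>. indicator (A n) \<omega> * f \<omega> \<partial>M)" for N
    by (rule Bochner_Integration.integral_sum) (rule int)
  ultimately show ?thesis unfolding sums_def by (simp only:)
qed

text \<open>The simple functions approximating the identity from below, cut off at \<open>\<epsilon>\<close> from below so that the
rounded values of points above \<open>\<epsilon>\<close> stay positive.\<close>

lemma rounding_sequence:
  fixes \<epsilon> :: real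
  assumes eps: "0 < \<epsilon>"
  obtains r :: "nat \<Rightarrow> real \<Rightarrow> real" where
    "\<And>m. r m \<in> borel_measurable borel"
    "\<And>m. \<exists>V. finite V \<and> V \<subseteq> {0<..} \<and> (\<forall>s>\<epsilon>. r m s \<in> V)"
    "\<And>m s. s \<le> \<epsilon> \<Longrightarrow> r m s = 0" "\<And>m s. \<epsilon> < s \<Longrightarrow> r m s \<le> s" "\<And>m s. 0 \<le> r m s"
    "\<And>s. \<epsilon> < s \<Longrightarrow> (\<lambda>m. r m s) \<longlonglongrightarrow> s"
proof -
  have "(\<lambda>s::real. ennreal s) \<in> borel_measurable borel" by measurable
  then obtain U where U: "\<And>i. simple_function borel (U i)" "incseq U" "\<And>i x. U i x < top"
    "\<And>x::real. (SUP i. U i x) = ennreal x"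
    using borel_measurable_implies_simple_function_sequence' by blast
  define r where "r m s = (if \<epsilon> < s then max \<epsilon> (enn2real (U m s)) else 0)" for m s
  show thesis
  proof (rule that[of r])
    have [measurable]: "U m \<in> borel_measurable borel" for m
      by (rule borel_measurable_simple_function[OF U(1)])
    show "r m \<in> borel_measurable borel" for m unfolding r_def by measurable
    show "\<exists>V. finite V \<and> V \<subseteq> {0<..} \<and> (\<forall>s>\<epsilon>. r m s \<in> V)" for m
    proof (intro exI conjI)
      show "finite ((\<lambda>u. max \<epsilon> (enn2real u)) ` U m ` UNIV)"
        using U(1)[of m] by (auto simp: simple_function_def)
      show "(\<lambda>u. max \<epsilon> (enn2real u)) ` U m ` UNIV \<subseteq> {0<..}" using eps by auto
      show "\<forall>s>\<epsilon>. r m s \<in> (\<lambda>u. max \<epsilon> (enn2real u)) ` U m ` UNIV" by (auto simp: r_def)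
    qed
    show "r m s \<le> s" if s: "\<epsilon> < s" for m s
    proof -
      have "U m s \<le> ennreal s" using U(4)[of s] by (metis SUP_upper UNIV_I)
      then have "enn2real (U m s) \<le> s" using s eps by (intro enn2real_leI) auto
      then show ?thesis using s by (simp add: r_def)
    qed
    show "(\<lambda>m. r m s) \<longlonglongrightarrow> s" if s: "\<epsilon> < s" for s
    proof -
      have "(\<lambda>m. U m s) \<longlonglongrightarrow> (SUP i. U i s)"
        using U(2) by (intro LIMSEQ_SUP) (auto simp: incseq_def le_fun_def)
      then have "(\<lambda>m. ennreal (enn2real (U m s))) \<longlonglongrightarrow> ennreal s"
        using U(3) by (simp add: U(4) ennreal_enn2real)
      then have "(\<lambda>m. enn2real (U m s)) \<longlonglongrightarrow> s"
        by (rule tendsto_ennrealD) (use s eps in auto)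
      then have "(\<lambda>m. max \<epsilon> (enn2real (U m s))) \<longlonglongrightarrow> max \<epsilon> s" by (rule tendsto_max[OF tendsto_const])
      then show ?thesis using s by (simp add: r_def)
    qed
  qed (use eps in \<open>auto simp: r_def\<close>)
qed

definition truncate :: "real \<Rightarrow> real \<Rightarrow> real" where
  "truncate \<epsilon> s = (if \<epsilon> < s then s else 0)"

lemma measurable_truncate [measurable]: "truncate \<epsilon> \<in> borel_measurable borel"
  unfolding truncate_def by measurable

context weak_test_functional
begin

definition mean_avg :: "real measure \<Rightarrow> nat \<Rightarrow> real" where
  "mean_avg D n = (\<integral>x. avg (pad n x) \<partial>(\<Pi>\<^sub>M j\<in>{..<n}. D))"

lemma mean_avg_le:
  assumes D: "prob_space D" "sets D = sets borel"
  shows "\<bar>mean_avg D n\<bar> \<le> C"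
proof -
  interpret P: prob_space "\<Pi>\<^sub>M j\<in>{..<n}. D" by (intro prob_space_PiM D)
  have [measurable]: "(\<lambda>x. avg (pad n x)) \<in> borel_measurable (\<Pi>\<^sub>M j\<in>{..<n}. D)"
    by (rule measurable_compose[OF measurable_pad[OF D(2)] measurable_avg])
  have int: "integrable (\<Pi>\<^sub>M j\<in>{..<n}. D) (\<lambda>x. avg (pad n x))"
    by (rule P.integrable_const_bound[of _ C]) (auto intro!: AE_I2 avg_le)
  have "\<bar>mean_avg D n\<bar> \<le> (\<integral>x. \<bar>avg (pad n x)\<bar> \<partial>(\<Pi>\<^sub>M j\<in>{..<n}. D))"
    unfolding mean_avg_def by (rule integral_abs_bound)
  also have "\<dots> \<le> (\<integral>x. C \<partial>(\<Pi>\<^sub>M j\<in>{..<n}. D))"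
    by (rule integral_mono) (auto simp: int avg_le)
  finally show ?thesis by (simp add: P.prob_space)
qed

lemma avg_rounding_tendsto:
  assumes eps: "0 < \<epsilon>"
    and r: "\<And>m s. s \<le> \<epsilon> \<Longrightarrow> r m s = 0" "\<And>m s. \<epsilon> < s \<Longrightarrow> r m s \<le> s" "\<And>m s. 0 \<le> r m s"
      "\<And>s. \<epsilon> < s \<Longrightarrow> (\<lambda>m. r m s) \<longlonglongrightarrow> s"
    and fin: "finite {j. \<epsilon> < x j}"
  shows "(\<lambda>m. avg (\<lambda>j. r m (x j))) \<longlonglongrightarrow> avg (\<lambda>j. truncate \<epsilon> (x j))"
proof (cases "{j. \<epsilon> < x j} = {}")
  case True
  then have "\<not> \<epsilon> < x j" for j by auto
  then have "r m (x j) = 0" "truncate \<epsilon> (x j) = 0" for m j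
    using r(1) by (auto simp: not_less[symmetric] truncate_def)
  then show ?thesis by simp
next
  case False
  show ?thesis
  proof (rule avg_tendsto)
    show "r m (x j) \<le> truncate \<epsilon> (x j)" for m j using r(1,2) by (auto simp: truncate_def not_less)
    show "summable (\<lambda>j. truncate \<epsilon> (x j))"
      by (rule summable_finite[OF fin]) (auto simp: truncate_def)
    show "(\<lambda>m. r m (x j)) \<longlonglongrightarrow> truncate \<epsilon> (x j)" for j
      using r(1,4) by (auto simp: truncate_def not_less)
    have "(\<Sum>j. truncate \<epsilon> (x j)) = (\<Sum>j\<in>{j. \<epsilon> < x j}. x j)"
      by (subst suminf_finite[OF fin]) (auto simp: truncate_def)
    also have "\<dots> > 0" using False fin eps by (intro sum_pos) auto
    finally show "0 < (\<Sum>j. truncate \<epsilon> (x j))" .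
  qed (rule r(3))
qed

text \<open>The Poisson process above \<open>\<epsilon>\<close> as a Poisson number of iid points: for each value of that number, let the
rounding in \<open>discretized_expectation_of_points\<close> become exact, by dominated convergence on both sides.\<close>

lemma sums_expectation_avg_points:
  assumes ps: "poisson_sample M \<nu> J \<epsilon> \<Lambda> D"
  shows "(\<lambda>n. \<Lambda> ^ n / fact n * exp (- \<Lambda>) * mean_avg D n) sums (\<integral>\<omega>. avg (\<lambda>j. truncate \<epsilon> (J j \<omega>)) \<partial>M)"
proof -
  interpret poisson_sample M \<nu> J \<epsilon> \<Lambda> D by fact
  have mJ: "(\<lambda>\<omega> j. h (J j \<omega>)) \<in> measurable M weights" if h: "h \<in> borel_measurable borel" for h :: "real \<Rightarrow> real"
    by (rule measurable_PiM_single') (use h in \<open>auto intro: measurable_compose[OF J_borel]\<close>)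
  have m_avg: "(\<lambda>\<omega>. avg (\<lambda>j. h (J j \<omega>))) \<in> borel_measurable M" if h: "h \<in> borel_measurable borel" for h :: "real \<Rightarrow> real"
    by (rule measurable_compose[OF mJ[OF h] measurable_avg])
  obtain r :: "nat \<Rightarrow> real \<Rightarrow> real" where r:
    "\<And>m. r m \<in> borel_measurable borel"
    "\<And>m. \<exists>V. finite V \<and> V \<subseteq> {0<..} \<and> (\<forall>s>\<epsilon>. r m s \<in> V)"
    "\<And>m s. s \<le> \<epsilon> \<Longrightarrow> r m s = 0" "\<And>m s. \<epsilon> < s \<Longrightarrow> r m s \<le> s" "\<And>m s. 0 \<le> r m s"
    "\<And>s. \<epsilon> < s \<Longrightarrow> (\<lambda>m. r m s) \<longlonglongrightarrow> s"
    using rounding_sequence[OF eps] by blast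
  have main: "(\<integral>\<omega>. indicator (count_event n) \<omega> * avg (\<lambda>j. truncate \<epsilon> (J j \<omega>)) \<partial>M) =
      \<Lambda> ^ n / fact n * exp (- \<Lambda>) * mean_avg D n" for n
  proof -
    let ?P = "\<Pi>\<^sub>M j\<in>{..<n}. D"
    interpret P: prob_space ?P by (intro prob_space_PiM prob_D)
    have eq: "(\<integral>\<omega>. indicator (count_event n) \<omega> * avg (\<lambda>j. r m (J j \<omega>)) \<partial>M) =
      \<Lambda> ^ n / fact n * exp (- \<Lambda>) * (\<integral>x. avg (pad n (\<lambda>j. r m (x j))) \<partial>?P)" for m
    proof -
      obtain V where V: "finite V" "V \<subseteq> {0<..}" "\<forall>s>\<epsilon>. r m s \<in> V" using r(2)[of m] by blast
      show ?thesis
      proof (rule discretized_expectation_of_points[OF r(1) V(1,2)])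
        show "r m s \<in> V" if "\<epsilon> < s" for s using V(3) that by blast
      qed (use r(3) measurable_avg avg_eq_if_same_fibre_counts in blast)+
    qed
    have left: "(\<lambda>m. \<integral>\<omega>. indicator (count_event n) \<omega> * avg (\<lambda>j. r m (J j \<omega>)) \<partial>M) \<longlonglongrightarrow>
      (\<integral>\<omega>. indicator (count_event n) \<omega> * avg (\<lambda>j. truncate \<epsilon> (J j \<omega>)) \<partial>M)"
    proof (rule integral_dominated_convergence[where w="\<lambda>_. C"])
      show "(\<lambda>\<omega>. indicator (count_event n) \<omega> * avg (\<lambda>j. truncate \<epsilon> (J j \<omega>))) \<in> borel_measurable M"
        using m_avg[OF measurable_truncate] by measurable
      show "(\<lambda>\<omega>. indicator (count_event n) \<omega> * avg (\<lambda>j. r m (J j \<omega>))) \<in> borel_measurable M" for m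
        using m_avg[OF r(1)] by measurable
      show "AE \<omega> in M. norm (indicator (count_event n) \<omega> * avg (\<lambda>j. r m (J j \<omega>))) \<le> C" for m
        using avg_le C_nonneg by (intro AE_I2) (auto simp: indicator_def)
      show "AE \<omega> in M. (\<lambda>m. indicator (count_event n) \<omega> * avg (\<lambda>j. r m (J j \<omega>))) \<longlonglongrightarrow>
          indicator (count_event n) \<omega> * avg (\<lambda>j. truncate \<epsilon> (J j \<omega>))"
      proof (intro AE_I2)
        fix \<omega>
        show "(\<lambda>m. indicator (count_event n) \<omega> * avg (\<lambda>j. r m (J j \<omega>))) \<longlonglongrightarrow>
          indicator (count_event n) \<omega> * avg (\<lambda>j. truncate \<epsilon> (J j \<omega>))"
          using avg_rounding_tendsto[OF eps r(3-6), of "\<lambda>j. J j \<omega>"]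
          by (cases "\<omega> \<in> count_event n") (auto simp: count_event_def)
      qed
    qed auto
    have right: "(\<lambda>m. \<integral>x. avg (pad n (\<lambda>j. r m (x j))) \<partial>?P) \<longlonglongrightarrow> mean_avg D n"
      unfolding mean_avg_def
    proof (rule integral_dominated_convergence[where w="\<lambda>_. C"])
      have r_pad: "pad n (\<lambda>j. r m (x j)) = (\<lambda>j. r m (pad n x j))" for m x
        using r(3)[of 0] eps by (auto simp: pad_def)
      show "(\<lambda>x. avg (pad n x)) \<in> borel_measurable ?P"
        by (rule measurable_compose[OF measurable_pad[OF sets_D] measurable_avg])
      show "(\<lambda>x. avg (pad n (\<lambda>j. r m (x j)))) \<in> borel_measurable ?P" for m
      proof -
        have "(\<lambda>y j. r m (y j)) \<in> measurable weights weights"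
          by (rule measurable_PiM_single') (use r(1) in \<open>auto intro: measurable_compose[OF measurable_component_singleton]\<close>)
        then show ?thesis unfolding r_pad
          by (intro measurable_compose[OF measurable_compose[OF measurable_pad[OF sets_D]] measurable_avg])
      qed
      show "AE x in ?P. norm (avg (pad n (\<lambda>j. r m (x j)))) \<le> C" for m
        using avg_le by (intro AE_I2) auto
      show "AE x in ?P. (\<lambda>m. avg (pad n (\<lambda>j. r m (x j)))) \<longlonglongrightarrow> avg (pad n x)"
        using AE_sample[of n]
      proof eventually_elim
        case (elim x)
        have "finite {j. \<epsilon> < pad n x j}"
          by (rule finite_subset[of _ "{..<n}"]) (use eps in \<open>auto simp: pad_def split: if_splits\<close>)
        moreover have "(\<lambda>j. truncate \<epsilon> (pad n x j)) = pad n x"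
          using elim by (auto simp: truncate_def pad_def)
        ultimately show ?case
          using avg_rounding_tendsto[OF eps r(3-6), of "pad n x"] unfolding r_pad by simp
      qed
    qed auto
    show ?thesis
      by (rule LIMSEQ_unique[OF left]) (unfold eq, intro tendsto_mult tendsto_const right)
  qed
  have "(\<lambda>n. \<integral>\<omega>. indicator (count_event n) \<omega> * avg (\<lambda>j. truncate \<epsilon> (J j \<omega>)) \<partial>M) sums
      (\<integral>\<omega>. avg (\<lambda>j. truncate \<epsilon> (J j \<omega>)) \<partial>M)"
  proof (rule sums_integral_partition[OF prob_space_axioms count_event_sets _ AE_count_event m_avg[OF measurable_truncate] avg_le])
    show "disjoint_family count_event" by (auto simp: disjoint_family_on_def count_event_def)
  qed
  then show ?thesis unfolding main .
qed

end

section \<open>Poisson weights, the jump law and the approximating process\<close>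

lemma poisson_weights_sums:
  fixes \<Lambda> :: real
  shows "(\<lambda>n. \<Lambda> ^ n / fact n * exp (- \<Lambda>)) sums 1"
proof -
  have "(\<lambda>n. \<Lambda> ^ n / fact n) sums exp \<Lambda>"
    using exp_converges[of \<Lambda>] by (simp add: divide_inverse mult.commute)
  from sums_mult2[OF this, of "exp (- \<Lambda>)"] show ?thesis by (simp add: exp_minus_inverse)
qed

text \<open>The identity \<open>p\<^sub>n\<^sub>-\<^sub>1 = p\<^sub>n n / \<Lambda>\<close> for Poisson weights, as a statement about series: a shift by one is a
reweighting by \<open>n / \<Lambda>\<close>. It also yields the moments.\<close>

lemma poisson_size_bias:
  fixes \<Lambda> :: real and f :: "nat \<Rightarrow> real"
  assumes "0 < \<Lambda>" "(\<lambda>n. \<Lambda> ^ n / fact n * exp (- \<Lambda>) * f (Suc n)) sums s"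
  shows "(\<lambda>n. \<Lambda> ^ n / fact n * exp (- \<Lambda>) * (real n / \<Lambda> * f n)) sums s"
proof -
  have "(\<lambda>n. \<Lambda> ^ Suc n / fact (Suc n) * exp (- \<Lambda>) * (real (Suc n) / \<Lambda> * f (Suc n))) =
    (\<lambda>n. \<Lambda> ^ n / fact n * exp (- \<Lambda>) * f (Suc n))"
  proof
    fix n
    have "\<Lambda> ^ Suc n / fact (Suc n) * (real (Suc n) / \<Lambda>) = \<Lambda> ^ n / fact n"
      using assms(1) by (simp add: field_simps del: of_nat_Suc)
    then show "\<Lambda> ^ Suc n / fact (Suc n) * exp (- \<Lambda>) * (real (Suc n) / \<Lambda> * f (Suc n)) =
      \<Lambda> ^ n / fact n * exp (- \<Lambda>) * f (Suc n)"
      by (metis (no_types, opaque_lifting) mult.assoc mult.commute)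
  qed
  then show ?thesis
    using assms(2) sums_Suc_iff[of "\<lambda>n. \<Lambda> ^ n / fact n * exp (- \<Lambda>) * (real n / \<Lambda> * f n)" s] by simp
qed

lemma poisson_relative_variance:
  fixes \<Lambda> :: real
  assumes L: "0 < \<Lambda>"
  shows "(\<lambda>n. \<Lambda> ^ n / fact n * exp (- \<Lambda>) * (1 - real n / \<Lambda>)\<^sup>2) sums (1 / \<Lambda>)"
proof -
  let ?p = "\<lambda>n. \<Lambda> ^ n / fact n * exp (- \<Lambda>)"
  have p0: "?p sums 1" by (rule poisson_weights_sums)
  have p1: "(\<lambda>n. ?p n * (real n / \<Lambda> * 1)) sums 1"
    by (rule poisson_size_bias[OF L]) (use p0 in simp)
  have "(\<lambda>n. ?p n * (real n / \<Lambda> * 1) + ?p n / \<Lambda>) sums (1 + 1 / \<Lambda>)"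
    by (intro sums_add p1 sums_divide p0)
  moreover have "?p n * (real n / \<Lambda> * 1) + ?p n / \<Lambda> = ?p n * (real (Suc n) / \<Lambda>)" for n
    by (simp add: ring_distribs add_divide_distrib)
  ultimately have "(\<lambda>n. ?p n * (real (Suc n) / \<Lambda>)) sums (1 + 1 / \<Lambda>)" by (simp only:)
  then have p2: "(\<lambda>n. ?p n * (real n / \<Lambda> * (real n / \<Lambda>))) sums (1 + 1 / \<Lambda>)"
    by (rule poisson_size_bias[OF L])
  have "(\<lambda>n. ?p n - 2 * (?p n * (real n / \<Lambda> * 1)) + ?p n * (real n / \<Lambda> * (real n / \<Lambda>))) sums (1 - 2 * 1 + (1 + 1 / \<Lambda>))"
    by (intro sums_add sums_diff sums_mult p0 p1 p2)
  moreover have "(\<lambda>n. ?p n - 2 * (?p n * (real n / \<Lambda> * 1)) + ?p n * (real n / \<Lambda> * (real n / \<Lambda>))) =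
    (\<lambda>n. ?p n * (1 - real n / \<Lambda>)\<^sup>2)"
    by (rule ext) (simp add: power2_eq_square ring_distribs mult_ac)
  ultimately show ?thesis by simp
qed

text \<open>By \<open>poisson_size_bias\<close> the difference is the Poisson mean of \<open>(1 - n / \<Lambda>) a n\<close>. Its absolute value is at
most \<open>C\<close> times the mean of \<open>|1 - n / \<Lambda>|\<close>, which the relative variance \<open>1 / \<Lambda>\<close> controls.\<close>

lemma poisson_shift_bound:
  fixes a :: "nat \<Rightarrow> real"
  assumes L: "0 < \<Lambda>" and a: "\<And>n. \<bar>a n\<bar> \<le> C"
    and s: "(\<lambda>n. \<Lambda> ^ n / fact n * exp (- \<Lambda>) * a n) sums s"
    and s': "(\<lambda>n. \<Lambda> ^ n / fact n * exp (- \<Lambda>) * a (Suc n)) sums s'"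
  shows "\<bar>s - s'\<bar> \<le> C / sqrt \<Lambda>"
proof -
  let ?p = "\<lambda>n. \<Lambda> ^ n / fact n * exp (- \<Lambda>)"
  define \<delta> where "\<delta> = 1 / sqrt \<Lambda>"
  have d: "0 < \<delta>" "\<delta> * \<delta> = 1 / \<Lambda>" using L by (auto simp: \<delta>_def)
  have "(\<lambda>n. ?p n * a n - ?p n * (real n / \<Lambda> * a n)) sums (s - s')"
    by (intro sums_diff s poisson_size_bias[OF L s'])
  moreover have "?p n * a n - ?p n * (real n / \<Lambda> * a n) = ?p n * ((1 - real n / \<Lambda>) * a n)" for n
    by (simp add: ring_distribs)
  ultimately have diff: "(\<lambda>n. ?p n * ((1 - real n / \<Lambda>) * a n)) sums (s - s')" by (simp only:)
  have "(\<lambda>n. C / 2 * (?p n * \<delta> + ?p n * (1 - real n / \<Lambda>)\<^sup>2 / \<delta>)) sums (C / 2 * (1 * \<delta> + 1 / \<Lambda> / \<delta>))"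
    by (intro sums_mult sums_add sums_mult2 sums_divide poisson_weights_sums poisson_relative_variance L)
  moreover have "C / 2 * (1 * \<delta> + 1 / \<Lambda> / \<delta>) = C / sqrt \<Lambda>"
    using d by (simp add: d(2)[symmetric]) (simp add: \<delta>_def)
  ultimately have bound: "(\<lambda>n. C / 2 * (?p n * \<delta> + ?p n * (1 - real n / \<Lambda>)\<^sup>2 / \<delta>)) sums (C / sqrt \<Lambda>)" by simp
  have le: "\<bar>?p n * ((1 - real n / \<Lambda>) * a n)\<bar> \<le> C / 2 * (?p n * \<delta> + ?p n * (1 - real n / \<Lambda>)\<^sup>2 / \<delta>)" for n
  proof -
    let ?u = "1 - real n / \<Lambda>"
    \<comment> \<open>\<open>\<delta>\<close> is the standard deviation of \<open>n / \<Lambda>\<close>, the optimal choice in this use of the AM-GM inequality.\<close>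
    have "0 \<le> (\<bar>?u\<bar> - \<delta>)\<^sup>2" by simp
    then have "2 * \<bar>?u\<bar> * \<delta> \<le> \<delta> * \<delta> + ?u\<^sup>2" by (simp add: power2_eq_square algebra_simps)
    then have u: "\<bar>?u\<bar> \<le> (\<delta> + ?u\<^sup>2 / \<delta>) / 2" using d(1) by (simp add: field_simps)
    have "\<bar>?u * a n\<bar> \<le> (\<delta> + ?u\<^sup>2 / \<delta>) / 2 * C"
      unfolding abs_mult using u a[of n] d(1) by (intro mult_mono) auto
    then have "?p n * \<bar>?u * a n\<bar> \<le> ?p n * ((\<delta> + ?u\<^sup>2 / \<delta>) / 2 * C)"
      using L by (intro mult_left_mono) auto
    moreover have "\<bar>?p n * (?u * a n)\<bar> = ?p n * \<bar>?u * a n\<bar>" using L by (simp add: abs_mult)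
    moreover have "?p n * ((\<delta> + ?u\<^sup>2 / \<delta>) / 2 * C) = C / 2 * (?p n * \<delta> + ?p n * ?u\<^sup>2 / \<delta>)"
      by (simp add: field_simps)
    ultimately show ?thesis by linarith
  qed
  have "norm (\<Sum>n. ?p n * ((1 - real n / \<Lambda>) * a n)) \<le> (\<Sum>n. C / 2 * (?p n * \<delta> + ?p n * (1 - real n / \<Lambda>)\<^sup>2 / \<delta>))"
    by (rule norm_suminf_le[OF _ sums_summable[OF bound]]) (use le in auto)
  then show ?thesis using sums_unique[OF diff] sums_unique[OF bound] by simp
qed

locale jump_density =
  fixes \<rho> :: "real \<Rightarrow> real" and \<kappa> :: real
  assumes kappa: "0 < \<kappa>" and rho_measurable: "\<rho> \<in> borel_measurable (restrict_space borel {0<..})"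
    and rho_nonneg: "\<And>s. 0 < s \<Longrightarrow> 0 \<le> \<rho> s"
    and infinite_activity: "(\<integral>\<^sup>+s\<in>{0<..}. ennreal (\<rho> s) \<partial>lborel) = \<infinity>"
    and Lambda_pos: "\<And>\<epsilon>. 0 < \<epsilon> \<Longrightarrow> 0 < Lambda_eps \<rho> \<kappa> \<epsilon>"
begin

abbreviation "\<nu> \<equiv> jump_intensity \<rho> \<kappa>"
abbreviation "jump_law \<epsilon> \<equiv> density lborel (\<lambda>s. ennreal (rho_eps \<rho> \<kappa> \<epsilon> s))"

lemma measurable_rho_on:
  assumes "A \<in> sets borel" "A \<subseteq> {0<..}"
  shows "(\<lambda>s. \<rho> s * indicator A s) \<in> borel_measurable borel"
proof -
  have [measurable]: "A \<in> sets borel" by fact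
  have [measurable]: "(\<lambda>s. indicator {0<..} s *\<^sub>R \<rho> s) \<in> borel_measurable borel"
    using rho_measurable by (subst (asm) borel_measurable_restrict_space_iff) auto
  have "(\<lambda>s. \<rho> s * indicator A s) = (\<lambda>s. indicator {0<..} s *\<^sub>R \<rho> s * indicator A s)"
    using assms(2) by (intro ext) (auto simp: indicator_def)
  then show ?thesis by (simp only:) measurable
qed

lemma emeasure_jump_intensity:
  assumes A: "A \<in> sets borel" "A \<subseteq> {0<..}"
  shows "emeasure \<nu> A = (\<integral>\<^sup>+s. ennreal (\<kappa> * (\<rho> s * indicator A s)) \<partial>lborel)"
proof -
  have S: "A \<in> sets (restrict_space lborel {0<..})"
    using A by (auto simp: sets_restrict_space_iff)
  have m: "(\<lambda>s. ennreal (\<kappa> * \<rho> s)) \<in> borel_measurable (restrict_space lborel {0<..})"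
  proof -
    have "\<rho> \<in> borel_measurable (restrict_space lborel {0<..})"
      using rho_measurable measurable_cong_sets[OF sets_restrict_space_cong[OF sets_lborel] refl] by blast
    then show ?thesis by measurable
  qed
  have "emeasure \<nu> A = (\<integral>\<^sup>+s. ennreal (\<kappa> * \<rho> s) * indicator A s \<partial>restrict_space lborel {0<..})"
    unfolding jump_intensity_def by (rule emeasure_density[OF m S])
  also have "\<dots> = (\<integral>\<^sup>+s. ennreal (\<kappa> * \<rho> s) * indicator A s * indicator {0<..} s \<partial>lborel)"
    by (rule nn_integral_restrict_space) auto
  also have "\<dots> = (\<integral>\<^sup>+s. ennreal (\<kappa> * (\<rho> s * indicator A s)) \<partial>lborel)"
    using A by (intro nn_integral_cong) (auto simp: indicator_def)
  finally show ?thesis .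
qed

lemma sets_nu: "sets \<nu> = sets (restrict_space borel {0<..})"
  unfolding jump_intensity_def by (simp cong: sets_restrict_space_cong)

text \<open>Positivity of \<open>Lambda_eps\<close> hides integrability: the integral of a function that is not integrable is \<open>0\<close>
by convention.\<close>

lemma tail_integrable:
  assumes "0 < \<epsilon>"
  shows "integrable lborel (\<lambda>s. \<rho> s * indicator {\<epsilon><..} s)"
proof (rule ccontr)
  assume "\<not> ?thesis"
  then have "(LINT s:{\<epsilon><..}|lborel. \<rho> s) = 0"
    by (simp add: set_lebesgue_integral_def not_integrable_integral_eq mult.commute)
  then show False using Lambda_pos[OF assms] by (simp add: Lambda_eps_def)
qed

lemma Lambda_eq: "Lambda_eps \<rho> \<kappa> \<epsilon> = \<kappa> * (\<integral>s. \<rho> s * indicator {\<epsilon><..} s \<partial>lborel)"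
  by (simp add: Lambda_eps_def set_lebesgue_integral_def mult.commute)

lemma emeasure_tail:
  assumes eps: "0 < \<epsilon>"
  shows "emeasure \<nu> {\<epsilon><..} = ennreal (Lambda_eps \<rho> \<kappa> \<epsilon>)"
proof -
  have "emeasure \<nu> {\<epsilon><..} = (\<integral>\<^sup>+s. ennreal (\<kappa> * (\<rho> s * indicator {\<epsilon><..} s)) \<partial>lborel)"
    using eps by (intro emeasure_jump_intensity) auto
  also have "\<dots> = ennreal (\<integral>s. \<kappa> * (\<rho> s * indicator {\<epsilon><..} s) \<partial>lborel)"
    using eps tail_integrable[OF eps] kappa rho_nonneg
    by (intro nn_integral_eq_integral) (auto simp: indicator_def)
  finally show ?thesis by (simp add: Lambda_eq)
qed

lemma emeasure_jump_law:
  assumes eps: "0 < \<epsilon>" and A: "A \<in> sets borel"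
  shows "emeasure \<nu> (A \<inter> {\<epsilon><..}) = ennreal (Lambda_eps \<rho> \<kappa> \<epsilon>) * emeasure (jump_law \<epsilon>) A"
proof -
  let ?L = "Lambda_eps \<rho> \<kappa> \<epsilon>"
  note [measurable] = A
  have [measurable]: "(\<lambda>s. \<rho> s * indicator {\<epsilon><..} s) \<in> borel_measurable borel"
    using eps by (intro measurable_rho_on) auto
  have eq: "rho_eps \<rho> \<kappa> \<epsilon> = (\<lambda>s. \<kappa> * (\<rho> s * indicator {\<epsilon><..} s) / ?L)"
    by (auto simp: rho_eps_def)
  have [measurable]: "rho_eps \<rho> \<kappa> \<epsilon> \<in> borel_measurable borel" unfolding eq by measurable
  have "emeasure \<nu> (A \<inter> {\<epsilon><..}) = (\<integral>\<^sup>+s. ennreal (\<kappa> * (\<rho> s * indicator (A \<inter> {\<epsilon><..}) s)) \<partial>lborel)"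
    using eps A by (intro emeasure_jump_intensity) auto
  also have "\<dots> = (\<integral>\<^sup>+s. ennreal ?L * (ennreal (rho_eps \<rho> \<kappa> \<epsilon> s) * indicator A s) \<partial>lborel)"
    using Lambda_pos[OF eps] eps kappa rho_nonneg
    by (intro nn_integral_cong) (auto simp: indicator_def rho_eps_def ennreal_mult'[symmetric])
  also have "\<dots> = ennreal ?L * (\<integral>\<^sup>+s. ennreal (rho_eps \<rho> \<kappa> \<epsilon> s) * indicator A s \<partial>lborel)"
    by (rule nn_integral_cmult) measurable
  also have "(\<integral>\<^sup>+s. ennreal (rho_eps \<rho> \<kappa> \<epsilon> s) * indicator A s \<partial>lborel) = emeasure (jump_law \<epsilon>) A"
    by (rule emeasure_density[symmetric]) measurable
  finally show ?thesis .
qed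

lemma prob_space_jump_law:
  assumes eps: "0 < \<epsilon>"
  shows "prob_space (jump_law \<epsilon>)"
proof
  have "ennreal (Lambda_eps \<rho> \<kappa> \<epsilon>) * emeasure (jump_law \<epsilon>) UNIV = ennreal (Lambda_eps \<rho> \<kappa> \<epsilon>) * 1"
    using emeasure_jump_law[OF eps, of UNIV] emeasure_tail[OF eps] by simp
  then show "emeasure (jump_law \<epsilon>) (space (jump_law \<epsilon>)) = 1"
    using Lambda_pos[OF eps] by (subst (asm) ennreal_mult_cancel_left) auto
qed

lemma poisson_sample_jumps:
  assumes M: "prob_space M" and J: "poisson_process_points M \<nu> J" and eps: "0 < \<epsilon>"
  shows "poisson_sample M \<nu> J \<epsilon> (Lambda_eps \<rho> \<kappa> \<epsilon>) (jump_law \<epsilon>)"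
proof -
  interpret D: prob_space "jump_law \<epsilon>" by (rule prob_space_jump_law[OF eps])
  show ?thesis
  proof (intro poisson_sample.intro poisson_sample_axioms.intro)
    show "emeasure \<nu> (A \<inter> {\<epsilon><..}) = ennreal (Lambda_eps \<rho> \<kappa> \<epsilon> * measure (jump_law \<epsilon>) A)" if "A \<in> sets borel" for A
      unfolding emeasure_jump_law[OF eps that] D.emeasure_eq_measure using Lambda_pos[OF eps]
      by (simp add: ennreal_mult')
  qed (use assms sets_nu Lambda_pos in \<open>auto intro: D.prob_space_axioms\<close>)
qed

lemma AE_jump_law:
  assumes "0 < \<epsilon>" shows "AE s in jump_law \<epsilon>. \<epsilon> < s"
proof -
  have [measurable]: "(\<lambda>s. \<rho> s * indicator {\<epsilon><..} s) \<in> borel_measurable borel"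
    using assms by (intro measurable_rho_on) auto
  have eq: "rho_eps \<rho> \<kappa> \<epsilon> = (\<lambda>s. \<kappa> * (\<rho> s * indicator {\<epsilon><..} s) / Lambda_eps \<rho> \<kappa> \<epsilon>)"
    by (auto simp: rho_eps_def)
  have "(\<lambda>s. ennreal (rho_eps \<rho> \<kappa> \<epsilon> s)) \<in> borel_measurable lborel" unfolding eq by measurable
  from AE_density[OF this] show ?thesis
    by (auto simp: rho_eps_def indicator_def intro!: AE_I2)
qed

text \<open>Stated along decreasing sequences because the right limit at \<open>0\<close> is taken along these; the total
intensity is infinite by assumption.\<close>

lemma Lambda_at_zero:
  assumes S: "\<And>n. 0 < S n" "decseq S" "S \<longlonglongrightarrow> 0"
  shows "filterlim (\<lambda>n. Lambda_eps \<rho> \<kappa> (S n)) at_top sequentially"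
proof -
  have U: "(\<Union>n. {S n<..}) = {0<..}"
  proof (intro equalityI subsetI)
    fix s :: real assume "s \<in> {0<..}"
    then have "\<forall>\<^sub>F n in sequentially. S n < s" using order_tendstoD(2)[OF S(3)] by simp
    then show "s \<in> (\<Union>n. {S n<..})" by (auto simp: eventually_sequentially)
  qed (use S(1) in \<open>auto intro: less_trans\<close>)
  have "(\<lambda>n. emeasure \<nu> {S n<..}) \<longlonglongrightarrow> emeasure \<nu> (\<Union>n. {S n<..})"
  proof (rule Lim_emeasure_incseq)
    show "range (\<lambda>n. {S n<..}) \<subseteq> sets \<nu>"
      using S(1) by (auto simp: sets_nu sets_restrict_space_iff intro: less_imp_le[OF S(1)])
    show "incseq (\<lambda>n. {S n<..})" using S(2) by (fastforce simp: incseq_def decseq_def intro: le_less_trans)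
  qed
  also have "emeasure \<nu> (\<Union>n. {S n<..}) = \<infinity>"
  proof -
    have [measurable]: "(\<lambda>s. \<rho> s * indicator {0<..} s) \<in> borel_measurable borel"
      by (intro measurable_rho_on) auto
    have "emeasure \<nu> {0<..} = (\<integral>\<^sup>+s. ennreal \<kappa> * ennreal (\<rho> s * indicator {0<..} s) \<partial>lborel)"
      using kappa rho_nonneg
      by (subst emeasure_jump_intensity) (auto intro!: nn_integral_cong simp: ennreal_mult' indicator_def)
    also have "\<dots> = ennreal \<kappa> * (\<integral>\<^sup>+s. ennreal (\<rho> s * indicator {0<..} s) \<partial>lborel)"
      by (rule nn_integral_cmult) measurable
    also have "(\<integral>\<^sup>+s. ennreal (\<rho> s * indicator {0<..} s) \<partial>lborel) = \<infinity>"
      unfolding infinite_activity[symmetric] by (intro nn_integral_cong) (auto simp: indicator_def)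
    finally show ?thesis using kappa unfolding U by (simp add: ennreal_mult_top)
  qed
  finally have "(\<lambda>n. ennreal (Lambda_eps \<rho> \<kappa> (S n))) \<longlonglongrightarrow> top"
    using S(1) by (simp add: emeasure_tail)
  then show ?thesis by (simp only: ennreal_tendsto_top_eq_at_top)
qed

lemma Lambda_at_top: "(Lambda_eps \<rho> \<kappa> \<longlongrightarrow> 0) at_top"
proof -
  have "((\<lambda>\<epsilon>. \<integral>s. \<rho> s * indicator {max \<epsilon> 1<..} s \<partial>lborel) \<longlongrightarrow> (\<integral>s. 0 \<partial>(lborel :: real measure))) at_top"
  proof (rule integral_dominated_convergence_at_top[where w="\<lambda>s. \<rho> s * indicator {1<..} s"])
    show "(\<lambda>s. \<rho> s * indicator {max \<epsilon> 1<..} s) \<in> borel_measurable lborel" for \<epsilon>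
      using measurable_rho_on[of "{max \<epsilon> 1<..}"] by auto
    show "AE s in lborel. ((\<lambda>\<epsilon>. \<rho> s * indicator {max \<epsilon> 1<..} s) \<longlongrightarrow> 0) at_top"
    proof (intro AE_I2 tendsto_eventually)
      fix s :: real
      show "\<forall>\<^sub>F \<epsilon> in at_top. \<rho> s * indicator {max \<epsilon> 1<..} s = 0"
        using eventually_ge_at_top[of s] by eventually_elim auto
    qed
    show "\<forall>\<^sub>F \<epsilon> in at_top. AE s in lborel. norm (\<rho> s * indicator {max \<epsilon> 1<..} s) \<le> \<rho> s * indicator {1<..} s"
      using rho_nonneg by (intro always_eventually allI AE_I2) (auto simp: indicator_def)
  qed (auto intro: tail_integrable)
  from tendsto_mult_left[OF this, of \<kappa>]
  have "((\<lambda>\<epsilon>. \<kappa> * (\<integral>s. \<rho> s * indicator {max \<epsilon> 1<..} s \<partial>lborel)) \<longlongrightarrow> 0) at_top" by simp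
  then show ?thesis
  proof (rule Lim_transform_eventually)
    show "\<forall>\<^sub>F \<epsilon> in at_top. \<kappa> * (\<integral>s. \<rho> s * indicator {max \<epsilon> 1<..} s \<partial>lborel) = Lambda_eps \<rho> \<kappa> \<epsilon>"
      using eventually_ge_at_top[of 1] by eventually_elim (simp add: Lambda_eq max_def)
  qed
qed

end

lemma discrete_measure_cong:
  assumes "\<And>i. i \<in> I \<Longrightarrow> w i = w' i" "\<And>i. i \<in> I \<Longrightarrow> x i = x' i"
  shows "discrete_measure S I w x = discrete_measure S I w' x'"
proof -
  have "density (count_space I) w = density (count_space I) w'"
    by (rule density_cong) (auto simp: AE_count_space assms)
  then show ?thesis unfolding discrete_measure_def by (intro distr_cong) (auto simp: assms)
qed

lemma integral_uniform_measure_eq: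
  fixes f :: "'w \<Rightarrow> real"
  assumes M: "prob_space M" and A: "A \<in> sets M" "measure M A \<noteq> 0" and f: "f \<in> borel_measurable M"
  shows "(\<integral>\<omega>. indicator A \<omega> * f \<omega> \<partial>M) = measure M A * (\<integral>\<omega>. f \<omega> \<partial>uniform_measure M A)"
proof -
  interpret prob_space M by fact
  have pos: "0 < prob A" using A(2) measure_nonneg[of M A] by linarith
  have "uniform_measure M A = density M (\<lambda>\<omega>. ennreal (indicator A \<omega> / prob A))"
    unfolding uniform_measure_def emeasure_eq_measure
    using pos by (intro density_cong) (use A in \<open>auto simp: divide_ennreal indicator_def divide_ennreal[of 1, simplified]\<close>)
  then have "(\<integral>\<omega>. f \<omega> \<partial>uniform_measure M A) = (\<integral>\<omega>. indicator A \<omega> / prob A * f \<omega> \<partial>M)"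
    using A f by (simp add: integral_density)
  also have "\<dots> = (\<integral>\<omega>. indicator A \<omega> * f \<omega> \<partial>M) / prob A" by simp
  finally show ?thesis using A(2) by simp
qed

context weak_test_functional
begin

text \<open>Condition on the Poisson variable \<open>N\<close>. Given \<open>N = n\<close>, there are \<open>n + 1\<close> jumps, which explains the shifted
index.\<close>

lemma sums_expectation_eps_NormCRM:
  assumes jd: "jump_density \<rho> \<kappa>" and eps: "0 < \<epsilon>" and P: "eps_NormCRM \<rho> \<kappa> P0 \<epsilon> M P"
  defines "\<Lambda> \<equiv> Lambda_eps \<rho> \<kappa> \<epsilon>" and "D \<equiv> density lborel (\<lambda>s. ennreal (rho_eps \<rho> \<kappa> \<epsilon> s))"
  shows "(\<lambda>n. \<Lambda> ^ n / fact n * exp (- \<Lambda>) * mean_avg D (Suc n)) sums (\<integral>\<omega>. g (P \<omega>) \<partial>M)"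
proof -
  interpret jump_density \<rho> \<kappa> by fact
  have L: "0 < \<Lambda>" unfolding \<Lambda>_def by (rule Lambda_pos[OF eps])
  have AE_D: "AE s in D. \<epsilon> < s" unfolding D_def by (rule AE_jump_law[OF eps])
  have sets_D: "sets D = sets borel" by (simp add: D_def)
  have M: "prob_space M" and Pm: "P \<in> measurable M (prob_algebra P0)" using P by (auto simp: eps_NormCRM_def)
  obtain N :: "_ \<Rightarrow> nat" and J \<tau> where N: "N \<in> measurable M (count_space UNIV)"
    "distr M (count_space UNIV) N = measure_pmf (poisson_pmf \<Lambda>)"
    and cond: "\<And>n. iid (uniform_measure M {\<omega> \<in> space M. N \<omega> = n}) D J {..n} \<and>
      iid (uniform_measure M {\<omega> \<in> space M. N \<omega> = n}) P0 \<tau> {..n} \<and>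
      indep_families (uniform_measure M {\<omega> \<in> space M. N \<omega> = n}) D J P0 \<tau> {..n}"
    and AE_P: "AE \<omega> in M. P \<omega> =
       discrete_measure P0 {..N \<omega>} (\<lambda>j. ennreal (J j \<omega> / (\<Sum>i\<le>N \<omega>. J i \<omega>))) (\<lambda>j. \<tau> j \<omega>)"
    using P unfolding eps_NormCRM_def Let_def \<Lambda>_def[symmetric] D_def[symmetric] by blast
  interpret prob_space M by fact
  define A where "A n = {\<omega> \<in> space M. N \<omega> = n}" for n
  have A: "A n \<in> sets M" for n unfolding A_def using N(1) by measurable
  have prob_A: "prob (A n) = \<Lambda> ^ n / fact n * exp (- \<Lambda>)" for n
  proof -
    have "prob (A n) = measure (distr M (count_space UNIV) N) {n}"
      using N(1) by (subst measure_distr) (auto simp: A_def vimage_def Int_def conj_commute)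
    then show ?thesis unfolding N(2) using L by (simp add: measure_pmf_single)
  qed
  have gP: "(\<lambda>\<omega>. g (P \<omega>)) \<in> borel_measurable M" by (rule measurable_compose[OF Pm measurable_g])
  have main: "(\<integral>\<omega>. indicator (A n) \<omega> * g (P \<omega>) \<partial>M) = \<Lambda> ^ n / fact n * exp (- \<Lambda>) * mean_avg D (Suc n)" for n
  proof -
    let ?M = "uniform_measure M (A n)"
    have pos: "prob (A n) \<noteq> 0" unfolding prob_A using L by simp
    then have M': "prob_space ?M"
      by (intro prob_space_uniform_measure) (auto simp: emeasure_eq_measure)
    have iidJ: "iid ?M D J {..<Suc n}" and iidT: "iid ?M P0 \<tau> {..<Suc n}"
      and ind: "indep_families ?M D J P0 \<tau> {..<Suc n}"
      using cond[of n] by (auto simp: A_def lessThan_Suc_atMost)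
    have Jm: "J j \<in> measurable ?M D" and Jd: "distr ?M D (J j) = D" if "j < Suc n" for j
      using iid_measurable[OF M' iidJ] iidJ that by (auto simp: iid_def)
    have Tm: "\<tau> j \<in> measurable ?M P0" if "j < Suc n" for j
      using iid_measurable[OF M' iidT] that by auto
    have "AE \<omega> in ?M. \<forall>j\<in>{..n}. \<epsilon> < J j \<omega>"
    proof (intro AE_finite_allI)
      fix j assume "j \<in> {..n}"
      then have j: "j < Suc n" by auto
      show "AE \<omega> in ?M. \<epsilon> < J j \<omega>"
        by (rule AE_distrD[OF Jm[OF j]]) (simp only: Jd[OF j] AE_D)
    qed simp
    moreover have "AE \<omega> in ?M. N \<omega> = n \<and> P \<omega> =
       discrete_measure P0 {..N \<omega>} (\<lambda>j. ennreal (J j \<omega> / (\<Sum>i\<le>N \<omega>. J i \<omega>))) (\<lambda>j. \<tau> j \<omega>)"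
      using AE_P by (intro AE_uniform_measureI A) (auto simp: A_def)
    ultimately have AE_eq: "AE \<omega> in ?M. P \<omega> = normalized_sum P0 (pad (Suc n) (\<lambda>j. J j \<omega>)) (\<lambda>j. \<tau> (min j (Suc n - 1)) \<omega>)"
      using AE_space
    proof eventually_elim
      case (elim \<omega>)
      have sum: "(\<Sum>j\<le>n. pad (Suc n) (\<lambda>j. J j \<omega>) j) = (\<Sum>j\<le>n. J j \<omega>)" by (rule sum.cong) (auto simp: pad_def)
      have spos: "0 < (\<Sum>j\<le>n. J j \<omega>)" using elim(1) eps by (intro sum_pos) force+
      have "normalized_sum P0 (pad (Suc n) (\<lambda>j. J j \<omega>)) (\<lambda>j. \<tau> (min j (Suc n - 1)) \<omega>) =
        discrete_measure P0 {..n} (\<lambda>j. ennreal (pad (Suc n) (\<lambda>j. J j \<omega>) j / (\<Sum>i\<le>n. pad (Suc n) (\<lambda>j. J j \<omega>) i)))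
          (\<lambda>j. \<tau> (min j (Suc n - 1)) \<omega>)"
      proof (rule normalized_sum_eq_discrete_measure)
        show "0 \<le> pad (Suc n) (\<lambda>j. J j \<omega>) j" for j
        proof (cases "j \<le> n")
          case True
          then have "\<epsilon> < J j \<omega>" using elim(1) by simp
          then show ?thesis using eps True by (simp add: pad_def)
        qed (simp add: pad_def)
        show "\<tau> (min j (Suc n - 1)) \<omega> \<in> space P0" for j
          using measurable_space[OF Tm[of "min j (Suc n - 1)"]] elim(3) by simp
        show "0 < (\<Sum>j\<le>n. pad (Suc n) (\<lambda>j. J j \<omega>) j)" unfolding sum by (rule spos)
      qed (auto simp: pad_def)
      also have "\<dots> = discrete_measure P0 {..n} (\<lambda>j. ennreal (J j \<omega> / (\<Sum>i\<le>n. J i \<omega>))) (\<lambda>j. \<tau> j \<omega>)"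
        unfolding sum by (rule discrete_measure_cong) (auto simp: pad_def)
      finally show ?case using elim(2) by simp
    qed
    have "(\<integral>\<omega>. g (P \<omega>) \<partial>?M) =
      (\<integral>\<omega>. g (normalized_sum P0 (pad (Suc n) (\<lambda>j. J j \<omega>)) (\<lambda>j. \<tau> (min j (Suc n - 1)) \<omega>)) \<partial>?M)"
    proof (rule integral_cong_AE)
      show "(\<lambda>\<omega>. g (P \<omega>)) \<in> borel_measurable ?M" using gP by simp
      have "(\<lambda>\<omega>. (pad (Suc n) (\<lambda>j. J j \<omega>), \<lambda>j. \<tau> (min j (Suc n - 1)) \<omega>)) \<in> measurable ?M (weights \<Otimes>\<^sub>M tags)"
      proof (intro measurable_Pair measurable_PiM_single')
        show "(\<lambda>\<omega>. pad (Suc n) (\<lambda>j. J j \<omega>) j) \<in> borel_measurable ?M" for j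
          using Jm[of j] measurable_cong_sets[OF refl sets_D] by (cases "j < Suc n") (auto simp: pad_def)
        show "(\<lambda>\<omega>. \<tau> (min j (Suc n - 1)) \<omega>) \<in> measurable ?M P0" for j
          by (rule Tm) auto
        show "(\<lambda>\<omega> j. \<tau> (min j (Suc n - 1)) \<omega>) \<in> space ?M \<rightarrow> (\<Pi>\<^sub>E j\<in>UNIV. space P0)"
          using measurable_space[OF Tm] by (auto simp: PiE_iff)
      qed auto
      from measurable_compose[OF this measurable_g_normalized_sum]
      show "(\<lambda>\<omega>. g (normalized_sum P0 (pad (Suc n) (\<lambda>j. J j \<omega>)) (\<lambda>j. \<tau> (min j (Suc n - 1)) \<omega>))) \<in> borel_measurable ?M"
        by simp
      show "AE \<omega> in ?M. g (P \<omega>) = g (normalized_sum P0 (pad (Suc n) (\<lambda>j. J j \<omega>)) (\<lambda>j. \<tau> (min j (Suc n - 1)) \<omega>))"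
        using AE_eq by eventually_elim simp
    qed
    also have "\<dots> = mean_avg D (Suc n)"
      unfolding mean_avg_def
      by (rule expectation_g_normalized_sum_finite[OF M' sets_D iidJ iidT ind]) simp
    finally show ?thesis
      unfolding integral_uniform_measure_eq[OF M A pos gP] prob_A by simp
  qed
  have "(\<lambda>n. \<integral>\<omega>. indicator (A n) \<omega> * g (P \<omega>) \<partial>M) sums (\<integral>\<omega>. g (P \<omega>) \<partial>M)"
  proof (rule sums_integral_partition[OF M A _ _ gP])
    show "disjoint_family A" by (auto simp: disjoint_family_on_def A_def)
    show "AE \<omega> in M. \<exists>n. \<omega> \<in> A n" by (intro AE_I2) (auto simp: A_def)
    show "\<bar>g (P \<omega>)\<bar> \<le> C" if "\<omega> \<in> space M" for \<omega> by (rule g_le[OF measurable_space[OF Pm that]])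
  qed
  then show ?thesis unfolding main .
qed

end

section \<open>The two limits\<close>

context weak_test_functional
begin

text \<open>Replace the jumps \<open>J\<^sub>j\<close> of \<open>P\<close> by their truncations to \<open>(\<epsilon>, \<infinity>)\<close>. As \<open>\<epsilon> \<rightarrow> 0\<close> the normalised sums converge
almost surely to \<open>P\<close>, and the expectation of \<open>g\<close> at them differs from that at \<open>P\<^sub>\<epsilon>\<close> by at most \<open>C / sqrt \<Lambda>\<^sub>\<epsilon>\<close>.\<close>

lemma expectation_eps_NormCRM_at_zero:
  assumes jd: "jump_density \<rho> \<kappa>" and P_eps: "\<And>\<epsilon>. 0 < \<epsilon> \<Longrightarrow> eps_NormCRM \<rho> \<kappa> P0 \<epsilon> (M \<epsilon>) (P_eps \<epsilon>)"
    and P: "NormCRM \<rho> \<kappa> P0 M' P"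
  shows "((\<lambda>\<epsilon>. \<integral>\<omega>. g (P_eps \<epsilon> \<omega>) \<partial>M \<epsilon>) \<longlongrightarrow> (\<integral>\<omega>. g (P \<omega>) \<partial>M')) (at_right 0)"
proof (rule tendsto_at_right_sequentially[of 0 1])
  fix S :: "nat \<Rightarrow> real" assume S: "\<And>n. 0 < S n" "decseq S" "S \<longlonglongrightarrow> 0"
  interpret jump_density \<rho> \<kappa> by fact
  have M': "prob_space M'" and Pm: "P \<in> measurable M' (prob_algebra P0)" using P by (auto simp: NormCRM_def)
  obtain J \<tau> where J: "poisson_process_points M' \<nu> J" and \<tau>: "iid M' P0 \<tau> UNIV"
    and ind: "indep_families M' \<nu> J P0 \<tau> UNIV"
    and AE_P: "AE \<omega> in M'. P \<omega> =
           discrete_measure P0 UNIV (\<lambda>j. ennreal (J j \<omega>) / (\<Sum>i. ennreal (J i \<omega>))) (\<lambda>j. \<tau> j \<omega>)"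
    using P unfolding NormCRM_def by blast
  interpret M': prob_space M' by fact
  have ps: "poisson_sample M' \<nu> J (S n) (Lambda_eps \<rho> \<kappa> (S n)) (jump_law (S n))" for n
    by (rule poisson_sample_jumps[OF M' J S(1)])
  interpret ps: poisson_sample M' \<nu> J "S 0" "Lambda_eps \<rho> \<kappa> (S 0)" "jump_law (S 0)" by (rule ps)
  have \<tau>m: "\<tau> j \<in> measurable M' P0" for j using iid_measurable[OF M' \<tau>] by simp
  have \<tau>sp: "\<omega> \<in> space M' \<Longrightarrow> \<tau> j \<omega> \<in> space P0" for j \<omega> using measurable_space[OF \<tau>m] .
  let ?Q = "\<lambda>n \<omega>. normalized_sum P0 (\<lambda>j. truncate (S n) (J j \<omega>)) (\<lambda>j. \<tau> j \<omega>)"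
  have trunc_nu: "truncate \<epsilon> \<in> borel_measurable \<nu>" for \<epsilon>
    using measurable_restrict_space1[OF measurable_truncate] sets_nu by (simp cong: measurable_cong_sets)
  have limit: "AE \<omega> in M'. (\<lambda>n. g (?Q n \<omega>)) \<longlonglongrightarrow> g (P \<omega>)"
    using AE_P AE_space
  proof eventually_elim
    case (elim \<omega>)
    have pos: "0 < J j \<omega>" for j using ps.J_pos[OF elim(2)] .
    let ?T = "\<Sum>i. ennreal (J i \<omega>)"
    have "prob_space (P \<omega>)" using measurable_space[OF Pm elim(2)] by (simp add: space_prob_algebra)
    then have mass: "emeasure (P \<omega>) (space (P \<omega>)) = 1" by (rule prob_space.emeasure_space_1)
    have "space (P \<omega>) = space P0"
      using measurable_space[OF Pm elim(2)] by (auto simp: space_prob_algebra dest: sets_eq_imp_space_eq)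
    then have mass': "(\<Sum>j. ennreal (J j \<omega>) / ?T) = 1"
      using mass \<tau>sp[OF elim(2)] unfolding elim(1)
      by (subst (asm) emeasure_discrete_measure) (auto simp: nn_integral_count_space_nat)
    \<comment> \<open>If the total were infinite, all weights \<open>J\<^sub>j / T\<close> would be \<open>0\<close> and the probability measure \<open>P \<omega>\<close> would have mass \<open>0\<close>.\<close>
    have fin: "?T < \<infinity>"
    proof (rule ccontr)
      assume "\<not> ?T < \<infinity>"
      then have "?T = \<infinity>" by (simp add: less_top[symmetric])
      then show False using mass' by (simp add: ennreal_divide_top)
    qed
    have sumJ: "summable (\<lambda>j. J j \<omega>)"
      using fin pos by (intro summable_suminf_not_top) (auto intro: less_imp_le)
    have "0 < (\<Sum>j. J j \<omega>)" using sumJ pos by (rule suminf_pos)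
    have T: "?T = ennreal (\<Sum>j. J j \<omega>)"
      using sumJ pos by (intro suminf_ennreal2) (auto intro: less_imp_le)
    have P_eq: "P \<omega> = normalized_sum P0 (\<lambda>j. J j \<omega>) (\<lambda>j. \<tau> j \<omega>)"
      unfolding elim(1) normalized_sum_def using fin \<open>0 < (\<Sum>j. J j \<omega>)\<close> by (simp add: T)
    show ?case unfolding P_eq
    proof (rule g_normalized_sum_tendsto[OF \<tau>sp[OF elim(2)]])
      show "0 \<le> truncate (S n) (J j \<omega>)" "truncate (S n) (J j \<omega>) \<le> J j \<omega>" for n j
        using pos[of j] by (auto simp: truncate_def)
      show "(\<lambda>n. truncate (S n) (J j \<omega>)) \<longlonglongrightarrow> J j \<omega>" for j
        by (rule tendsto_eventually, rule eventually_mono[OF order_tendstoD(2)[OF S(3) pos[of j]]])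
           (simp add: truncate_def)
    qed fact+
  qed
  have meas: "(\<lambda>\<omega>. g (?Q n \<omega>)) \<in> borel_measurable M'" for n
  proof -
    have "(\<lambda>\<omega>. (\<lambda>j. truncate (S n) (J j \<omega>), \<lambda>j. \<tau> j \<omega>)) \<in> measurable M' (weights \<Otimes>\<^sub>M tags)"
      by (intro measurable_Pair measurable_PiM_single')
         (use \<tau>m \<tau>sp in \<open>auto intro: measurable_compose[OF ps.J_borel]\<close>)
    from measurable_compose[OF this measurable_g_normalized_sum] show ?thesis by simp
  qed
  have "(\<lambda>n. \<integral>\<omega>. g (?Q n \<omega>) \<partial>M') \<longlonglongrightarrow> (\<integral>\<omega>. g (P \<omega>) \<partial>M')"
  proof (rule integral_dominated_convergence[where w="\<lambda>_. C"])
    show "(\<lambda>\<omega>. g (P \<omega>)) \<in> borel_measurable M'" by (rule measurable_compose[OF Pm measurable_g])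
    show "AE \<omega> in M'. norm (g (?Q n \<omega>)) \<le> C" for n
      using \<tau>sp by (intro AE_I2) (auto intro!: g_le normalized_sum_in_space)
  qed (use limit meas in auto)
  then have lim: "(\<lambda>n. \<integral>\<omega>. avg (\<lambda>j. truncate (S n) (J j \<omega>)) \<partial>M') \<longlonglongrightarrow> (\<integral>\<omega>. g (P \<omega>) \<partial>M')"
    by (simp add: expectation_g_normalized_sum[OF M' ind \<tau> ps.J_measurable trunc_nu])
  have close: "\<bar>(\<integral>\<omega>. avg (\<lambda>j. truncate (S n) (J j \<omega>)) \<partial>M') - (\<integral>\<omega>. g (P_eps (S n) \<omega>) \<partial>M (S n))\<bar>
      \<le> C / sqrt (Lambda_eps \<rho> \<kappa> (S n))" for n
    by (rule poisson_shift_bound[OF Lambda_pos[OF S(1)] _ sums_expectation_avg_points[OF ps]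
          sums_expectation_eps_NormCRM[OF jd S(1) P_eps[OF S(1)]]])
       (rule mean_avg_le[OF prob_space_jump_law[OF S(1)]], simp)
  have "filterlim (\<lambda>n. sqrt (Lambda_eps \<rho> \<kappa> (S n))) at_top sequentially"
    by (rule filterlim_compose[OF sqrt_at_top Lambda_at_zero[OF S]])
  then have "(\<lambda>n. C / sqrt (Lambda_eps \<rho> \<kappa> (S n))) \<longlonglongrightarrow> 0"
    by (rule real_tendsto_divide_at_top[OF tendsto_const])
  then have "(\<lambda>n. (\<integral>\<omega>. avg (\<lambda>j. truncate (S n) (J j \<omega>)) \<partial>M') - (\<integral>\<omega>. g (P_eps (S n) \<omega>) \<partial>M (S n))) \<longlonglongrightarrow> 0"
    by (rule Lim_null_comparison[rotated]) (use close in auto)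
  from tendsto_diff[OF lim this]
  show "(\<lambda>n. \<integral>\<omega>. g (P_eps (S n) \<omega>) \<partial>M (S n)) \<longlonglongrightarrow> (\<integral>\<omega>. g (P \<omega>) \<partial>M')" by simp
qed simp

text \<open>A single positive jump has normalised weight \<open>1\<close>, whatever its size.\<close>

lemma mean_avg_one:
  assumes D: "prob_space D" "sets D = sets borel" and pos: "AE s in D. 0 < s"
  shows "mean_avg D 1 = (\<integral>y. g (return P0 y) \<partial>P0)"
proof -
  interpret P: prob_space "\<Pi>\<^sub>M j\<in>{..<Suc 0}. D" by (intro prob_space_PiM D)
  interpret T: product_prob_space "\<lambda>_. P0" "UNIV :: nat set" ..
  have avg: "avg (pad (Suc 0) x) = (\<integral>y. g (return P0 y) \<partial>P0)" if "0 < x 0" for x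
  proof -
    have "normalized_sum P0 (pad (Suc 0) x) t = return P0 (t 0)" if t: "t \<in> space tags" for t
    proof (rule measure_eqI)
      fix A assume "A \<in> sets (normalized_sum P0 (pad (Suc 0) x) t)"
      then have A: "A \<in> sets P0" by simp
      have "(\<Sum>j. ennreal (pad (Suc 0) x j)) = ennreal (x 0)"
        by (subst suminf_finite[of "{0}"]) (auto simp: pad_def)
      moreover have "(\<Sum>j. ennreal (pad (Suc 0) x j) / ennreal (x 0) * indicator A (t j)) = indicator A (t 0)"
        using \<open>0 < x 0\<close> by (subst suminf_finite[of "{0}"]) (auto simp: pad_def ennreal_divide_self)
      ultimately show "emeasure (normalized_sum P0 (pad (Suc 0) x) t) A = emeasure (return P0 (t 0)) A"
        using A space_tags[OF t] \<open>0 < x 0\<close> by (simp add: emeasure_normalized_sum)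
    qed simp
    then have "avg (pad (Suc 0) x) = (\<integral>t. g (return P0 (t 0)) \<partial>tags)"
      unfolding avg_def by (intro Bochner_Integration.integral_cong) auto
    also have "\<dots> = (\<integral>y. g (return P0 y) \<partial>distr tags P0 (\<lambda>t. t 0))"
      by (rule integral_distr[symmetric]) (auto intro: measurable_compose[OF measurable_return_prob_space measurable_g])
    also have "distr tags P0 (\<lambda>t. t 0) = P0"
      by (rule distr_PiM_component) (auto intro: prob_P0)
    finally show ?thesis .
  qed
  have "AE x in (\<Pi>\<^sub>M j\<in>{..<Suc 0}. D). 0 < x 0"
    by (rule AE_PiM_component[where P="\<lambda>s. 0 < s"]) (auto intro: D pos)
  then have "AE x in (\<Pi>\<^sub>M j\<in>{..<Suc 0}. D). avg (pad (Suc 0) x) = (\<integral>y. g (return P0 y) \<partial>P0)"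
    by eventually_elim (rule avg)
  then have "mean_avg D (Suc 0) = (\<integral>x. (\<integral>y. g (return P0 y) \<partial>P0) \<partial>(\<Pi>\<^sub>M j\<in>{..<Suc 0}. D))"
    unfolding mean_avg_def
    by (intro integral_cong_AE) (auto intro: measurable_compose[OF measurable_pad[OF D(2)] measurable_avg])
  then show ?thesis by (simp add: P.prob_space)
qed

text \<open>All terms of the series for \<open>E g(P\<^sub>\<epsilon>)\<close> except the first have Poisson mass \<open>1 - exp (-\<Lambda>\<^sub>\<epsilon>)\<close> in total.\<close>

lemma expectation_eps_NormCRM_at_top:
  assumes jd: "jump_density \<rho> \<kappa>" and P_eps: "\<And>\<epsilon>. 0 < \<epsilon> \<Longrightarrow> eps_NormCRM \<rho> \<kappa> P0 \<epsilon> (M \<epsilon>) (P_eps \<epsilon>)"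
  shows "((\<lambda>\<epsilon>. \<integral>\<omega>. g (P_eps \<epsilon> \<omega>) \<partial>M \<epsilon>) \<longlongrightarrow> (\<integral>y. g (return P0 y) \<partial>P0)) at_top"
proof -
  interpret jump_density \<rho> \<kappa> by fact
  let ?l = "\<integral>y. g (return P0 y) \<partial>P0"
  have bound: "\<bar>(\<integral>\<omega>. g (P_eps \<epsilon> \<omega>) \<partial>M \<epsilon>) - ?l\<bar> \<le> 2 * C * (1 - exp (- Lambda_eps \<rho> \<kappa> \<epsilon>))" if eps: "0 < \<epsilon>" for \<epsilon>
  proof -
    define \<Lambda> where "\<Lambda> = Lambda_eps \<rho> \<kappa> \<epsilon>"
    define D where "D = jump_law \<epsilon>"
    have L: "0 < \<Lambda>" unfolding \<Lambda>_def by (rule Lambda_pos[OF eps])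
    have D: "prob_space D" "sets D = sets borel" unfolding D_def using prob_space_jump_law[OF eps] by auto
    let ?p = "\<lambda>n. \<Lambda> ^ n / fact n * exp (- \<Lambda>)"
    have "AE s in D. 0 < s" unfolding D_def using AE_jump_law[OF eps] by eventually_elim (use eps in auto)
    then have one: "mean_avg D (Suc 0) = ?l" using mean_avg_one[OF D] by simp
    have l: "\<bar>?l\<bar> \<le> C" using mean_avg_le[OF D, of "Suc 0"] one by simp
    have s: "(\<lambda>n. ?p n * mean_avg D (Suc n)) sums (\<integral>\<omega>. g (P_eps \<epsilon> \<omega>) \<partial>M \<epsilon>)"
      unfolding \<Lambda>_def D_def by (rule sums_expectation_eps_NormCRM[OF jd eps P_eps[OF eps]])
    have "(\<lambda>n. ?p n * mean_avg D (Suc n) - ?p n * ?l) sums ((\<integral>\<omega>. g (P_eps \<epsilon> \<omega>) \<partial>M \<epsilon>) - 1 * ?l)"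
      by (intro sums_diff s sums_mult2 poisson_weights_sums)
    then have d: "(\<lambda>n. ?p n * mean_avg D (Suc n) - ?p n * ?l) sums ((\<integral>\<omega>. g (P_eps \<epsilon> \<omega>) \<partial>M \<epsilon>) - ?l)" by simp
    have "(\<lambda>n. if n = 0 then exp (- \<Lambda>) else 0) sums exp (- \<Lambda>)"
      using sums_single[of 0 "\<lambda>_. exp (- \<Lambda>)"] by simp
    then have b: "(\<lambda>n. 2 * C * (?p n - (if n = 0 then exp (- \<Lambda>) else 0))) sums (2 * C * (1 - exp (- \<Lambda>)))"
      by (intro sums_mult sums_diff poisson_weights_sums)
    have le: "norm (?p n * mean_avg D (Suc n) - ?p n * ?l) \<le> 2 * C * (?p n - (if n = 0 then exp (- \<Lambda>) else 0))" for n
    proof (cases n)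
      case (Suc m)
      have "\<bar>mean_avg D (Suc n) - ?l\<bar> \<le> 2 * C" using mean_avg_le[OF D, of "Suc n"] l by linarith
      then have "?p n * \<bar>mean_avg D (Suc n) - ?l\<bar> \<le> ?p n * (2 * C)" using L by (intro mult_left_mono) auto
      moreover have "norm (?p n * mean_avg D (Suc n) - ?p n * ?l) = ?p n * \<bar>mean_avg D (Suc n) - ?l\<bar>"
        using L by (simp only: right_diff_distrib[symmetric] real_norm_def abs_mult) simp
      ultimately show ?thesis using Suc by (simp add: mult_ac)
    qed (simp add: one)
    have "norm (\<Sum>n. ?p n * mean_avg D (Suc n) - ?p n * ?l) \<le>
        (\<Sum>n. 2 * C * (?p n - (if n = 0 then exp (- \<Lambda>) else 0)))"
      by (rule norm_suminf_le[OF le sums_summable[OF b]])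
    then show ?thesis using sums_unique[OF d] sums_unique[OF b] by (simp add: \<Lambda>_def)
  qed
  have "((\<lambda>\<epsilon>. 2 * C * (1 - exp (- Lambda_eps \<rho> \<kappa> \<epsilon>))) \<longlongrightarrow> 2 * C * (1 - exp (- 0))) at_top"
    by (intro tendsto_intros Lambda_at_top)
  then have "((\<lambda>\<epsilon>. 2 * C * (1 - exp (- Lambda_eps \<rho> \<kappa> \<epsilon>))) \<longlongrightarrow> 0) at_top" by simp
  moreover have "\<forall>\<^sub>F \<epsilon> in at_top. norm ((\<integral>\<omega>. g (P_eps \<epsilon> \<omega>) \<partial>M \<epsilon>) - ?l) \<le> 2 * C * (1 - exp (- Lambda_eps \<rho> \<kappa> \<epsilon>))"
    using eventually_gt_at_top[of 0] by eventually_elim (use bound in simp)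
  ultimately have "((\<lambda>\<epsilon>. (\<integral>\<omega>. g (P_eps \<epsilon> \<omega>) \<partial>M \<epsilon>) - ?l) \<longlongrightarrow> 0) at_top"
    by (rule Lim_null_comparison[rotated])
  then show ?thesis by (rule LIM_zero_cancel)
qed

end

theorem proposition3:
  fixes \<Theta> :: "(real^'m) set"
    and P0 :: "(real^'m) measure"
    and \<kappa> :: real
    and \<rho> :: "real \<Rightarrow> real"
    and M :: "real \<Rightarrow> 'w measure"
    and P_eps :: "real \<Rightarrow> 'w \<Rightarrow> (real^'m) measure"
    and M_lim :: "'v measure"
    and P :: "'v \<Rightarrow> (real^'m) measure"
    and M_0 :: "'u measure"
    and \<tau>\<^sub>0 :: "'u \<Rightarrow> real^'m"
  assumes "\<Theta> \<in> sets borel"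
    and "prob_space P0" and "sets P0 = sets (restrict_space borel \<Theta>)"
    and "\<kappa> > 0"
    and "\<rho> \<in> borel_measurable (restrict_space borel {0<..})"
    and "\<forall>s>0. \<rho> s \<ge> 0"
    and "(\<integral>\<^sup>+s\<in>{0<..}. ennreal (min 1 s * \<rho> s) \<partial>lborel) < \<infinity>"
    and "(\<integral>\<^sup>+s\<in>{0<..}. ennreal (\<rho> s) \<partial>lborel) = \<infinity>"
    and "\<forall>\<epsilon>>0. Lambda_eps \<rho> \<kappa> \<epsilon> > 0"
    and "\<forall>\<epsilon>>0. eps_NormCRM \<rho> \<kappa> P0 \<epsilon> (M \<epsilon>) (P_eps \<epsilon>)"
    and "NormCRM \<rho> \<kappa> P0 M_lim P"
    and "prob_space M_0" and "\<tau>\<^sub>0 \<in> measurable M_0 P0" and "distr M_0 P0 \<tau>\<^sub>0 = P0"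
  shows "converges_in_distribution (weak_topology \<Theta>) M P_eps (at_right 0) M_lim P \<and>
         converges_in_distribution (weak_topology \<Theta>) M P_eps at_top
           M_0 (\<lambda>\<omega>. return (restrict_space borel \<Theta>) (\<tau>\<^sub>0 \<omega>))"
proof -
  note prob_P0 = assms(2) and sets_P0 = assms(3) and tau = assms(13,14)
  have jd: "jump_density \<rho> \<kappa>" using assms(4-6,8,9) by unfold_locales auto
  have eps: "eps_NormCRM \<rho> \<kappa> P0 \<epsilon> (M \<epsilon>) (P_eps \<epsilon>)" if "0 < \<epsilon>" for \<epsilon> using assms(10) that by blast
  have functional: "\<exists>C. weak_test_functional \<Theta> P0 g C"
    if g: "continuous_map (weak_topology \<Theta>) euclideanreal g \<and> bounded (g ` topspace (weak_topology \<Theta>))" for g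
  proof -
    obtain C where "\<And>\<mu>. \<mu> \<in> topspace (weak_topology \<Theta>) \<Longrightarrow> \<bar>g \<mu>\<bar> \<le> C" using g by (auto simp: bounded_iff)
    then show ?thesis using g prob_P0 sets_P0 by (intro exI[of _ C] weak_test_functional.intro) auto
  qed
  have P_eps_elem: "prob_space (M \<epsilon>) \<and> P_eps \<epsilon> \<in> measurable (M \<epsilon>) (borel_algebra (weak_topology \<Theta>))" if "0 < \<epsilon>" for \<epsilon>
    using eps[OF that] measurable_prob_algebra_weak_topology[OF _ sets_P0] by (auto simp: eps_NormCRM_def)
  have P_elem: "prob_space M_lim" "P \<in> measurable M_lim (borel_algebra (weak_topology \<Theta>))"
    using assms(11) measurable_prob_algebra_weak_topology[OF _ sets_P0] by (auto simp: NormCRM_def)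
  have ret: "return (restrict_space borel \<Theta>) = return P0" by (intro ext return_cong) (simp add: sets_P0)
  have ret_m: "(\<lambda>\<omega>. return P0 (\<tau>\<^sub>0 \<omega>)) \<in> measurable M_0 (prob_algebra P0)"
    by (rule measurable_compose[OF tau(1) measurable_return_prob_space])
  have zero: "((\<lambda>\<epsilon>. \<integral>\<omega>. g (P_eps \<epsilon> \<omega>) \<partial>M \<epsilon>) \<longlongrightarrow> (\<integral>\<omega>. g (P \<omega>) \<partial>M_lim)) (at_right 0)"
    if g: "continuous_map (weak_topology \<Theta>) euclideanreal g \<and> bounded (g ` topspace (weak_topology \<Theta>))" for g
    using functional[OF g] weak_test_functional.expectation_eps_NormCRM_at_zero[OF _ jd eps assms(11)] by blast
  have top: "((\<lambda>\<epsilon>. \<integral>\<omega>. g (P_eps \<epsilon> \<omega>) \<partial>M \<epsilon>) \<longlongrightarrow> (\<integral>\<omega>. g (return P0 (\<tau>\<^sub>0 \<omega>)) \<partial>M_0)) at_top"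
    if g: "continuous_map (weak_topology \<Theta>) euclideanreal g \<and> bounded (g ` topspace (weak_topology \<Theta>))" for g
  proof -
    obtain C where C: "weak_test_functional \<Theta> P0 g C" using functional[OF g] by blast
    have "(\<integral>\<omega>. g (return P0 (\<tau>\<^sub>0 \<omega>)) \<partial>M_0) = (\<integral>y. g (return P0 y) \<partial>distr M_0 P0 \<tau>\<^sub>0)"
      by (rule integral_distr[symmetric, OF tau(1)])
         (rule measurable_compose[OF measurable_return_prob_space weak_test_functional.measurable_g[OF C]])
    then show ?thesis
      using weak_test_functional.expectation_eps_NormCRM_at_top[OF C jd eps] by (simp add: tau(2))
  qed
  have "\<forall>\<^sub>F \<epsilon> in at_right 0. prob_space (M \<epsilon>) \<and> P_eps \<epsilon> \<in> measurable (M \<epsilon>) (borel_algebra (weak_topology \<Theta>))"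
    using eventually_at_right_less[of 0] by eventually_elim (rule P_eps_elem)
  moreover have "\<forall>\<^sub>F \<epsilon> in at_top. prob_space (M \<epsilon>) \<and> P_eps \<epsilon> \<in> measurable (M \<epsilon>) (borel_algebra (weak_topology \<Theta>))"
    using eventually_gt_at_top[of 0] by eventually_elim (rule P_eps_elem)
  ultimately show ?thesis
    unfolding converges_in_distribution_def ret
    using P_elem zero top assms(12) measurable_prob_algebra_weak_topology[OF ret_m sets_P0] by blast
qed

end
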